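(* Let $PW_x(t,\bar f)=\int_{-T}^{T}A(\tau,t)\,e^{\mathrm{i}\chi F(\tau,t,\bar f)}\,d\tau$ be the pseudo Wigner--Ville distribution (PWVD) of the signal $x(t)=a(t)e^{\mathrm{i}\chi\psi(t)}$ with window $w$, where $\chi\gg 1$ is a large asymptotic parameter and $$A(\tau,t)=w\left(\tfrac{\tau}{2}\right)w\left(-\tfrac{\tau}{2}\right)a\left(t+\tfrac{\tau}{2}\right)a\left(t-\tfrac{\tau}{2}\right),\qquad F(\tau,t,\bar f)=\psi\left(t+\tfrac{\tau}{2}\right)-\psi\left(t-\tfrac{\tau}{2}\right)-2\pi\bar f\tau .$$ Assume: 1. (Analyticity of the signal) the amplitude $a$ and the phase $\psi$ are real-analytic functions on the analysis interval; 2. (Tapered window) $w$ is real-analytic on $[-T/2,T/2]$ and vanishes continuously at the boundaries of its support, $w(\pm T/2)=0$; 3. (Non-degeneracy) the instantaneous frequency curve $f_i=\frac{\chi}{2\pi}\psi'$ has non-zero curvature at the analysis time $t$, i.e. $f_i''(t)\neq 0$. Then the canonical mapping $\tau\mapsto u(\tau)$ to the cubic phase, defined by $F(\tau,t,\bar f)=\frac{u^3}{3}-\xi u$, exists as an analytic diffeomorphism, and the PWVD admits the uniform asymptotic expansion $$PW_x(t,\bar f)=\frac{2\pi}{\chi^{1/3}}\,A_0\,\Phi_{inc}\left(-\chi^{2/3}\xi,\ \chi^{1/3}q\right)+R(\chi),$$ where the remainder satisfies $$|R(\chi)|\le C(t,\bar f)\,\chi^{-1}=\mathcal{O}(\chi^{-1})$$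 with $C(t,\bar f)$ a finite constant independent of $\chi$. Furthermore, the expansion is strictly uniform, i.e. $C(t,\bar f)$ is bounded by a global constant $C_{max}$, over any compact region in the time--frequency plane on which the following two conditions are met: the instantaneous frequency curvature is strictly bounded away from zero ($|f_i''(t)|\ge c>0$), and the stationary points remain strictly inside the window support ($\xi<q^2$).
   Context: Setting. $x(t)=a(t)e^{\mathrm{i}\chi\psi(t)}$ is an analytic signal with real amplitude $a$ and real phase function $\psi$; $w$ is a real-valued symmetric (even) window function defined on $[-T/2,T/2]$. The PWVD is $$PW_x(t,f)=\int_{-T}^{T}w\left(\tfrac{\tau}{2}\right)w\left(-\tfrac{\tau}{2}\right)x\left(t+\tfrac{\tau}{2}\right)x^{*}\left(t-\tfrac{\tau}{2}\right)e^{-\mathrm{i}2\pi f\tau}\,d\tau ,$$ where $^*$ is complex conjugation; with $\bar f=f/\chi$ (the asymptotic frequency) this is the integral displayed in the claim. The instantaneous frequency is $f_i(t)=\frac{\chi}{2\pi}\psi'(t)$. Stationary points. $\pm\tau_s$ are the stationary points of $\tau\mapsto F(\tau,t,\bar f)$, i.e. the solutions of $\frac12\left[f_i(t+\tau_s/2)+f_i(t-\tau_s/2)\right]=f$. They coalesce at $\tau=0$ when $f=f_i(t)$. They are real on one side of the instantaneous frequency curve and are understood by analytic continuation (complex) on the other side. Phase parameters. $\xi=\left[\frac32F(\tau_s,t,\bar f)\right]^{2/3}$ (real branch, analytically continued through $\xi=0$), and $q$ is the transformed integration limit, defined by $F(T,t,\bar f)=\frac{q^3}{3}-\xi q$; $\pm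 q$ are the images of $\pm T$ under $\tau\mapsto u(\tau)$. Neither $\xi$ nor $q$ depends on $\chi$ (for fixed $t,\bar f$). Leading coefficient. $A_0=G(\pm\sqrt{\xi})$ where $G(u)=A(\tau(u),t)\,\frac{d\tau}{du}$ and $\tau(u)$ is the inverse of the canonical mapping; explicitly $$A_0=\xi^{1/4}A(\tau_s,t)\left|\frac{2}{\partial_\tau^2F(\tau_s,t,\bar f)}\right|^{1/2}.$$ Symmetric incomplete Airy function: $$\Phi_{inc}(p,s)=\frac{1}{2\pi}\int_{-s}^{s}e^{\mathrm{i}\left(\frac{y^3}{3}+py\right)}\,dy .$$ *)

theory Defs
  imports "HOL-Complex_Analysis.Complex_Analysis"
begin

text \<open>Real analyticity on an arbitrary subset of the line, so that at the end points of a closed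
  interval the expansion is one-sided.\<close>

definition real_analytic_on :: "(real \<Rightarrow> real) \<Rightarrow> real set \<Rightarrow> bool" where
  "real_analytic_on f S \<longleftrightarrow>
     (\<forall>x\<in>S. \<exists>r>0. \<exists>c. \<forall>y\<in>S. \<bar>y - x\<bar> < r \<longrightarrow> (\<lambda>n. c n * (y - x) ^ n) sums f y)"

definition continuation_on :: "(complex \<Rightarrow> complex) \<Rightarrow> (real \<Rightarrow> real) \<Rightarrow> real set \<Rightarrow> complex set \<Rightarrow> bool" where
  "continuation_on fC f S D \<longleftrightarrow>
     open D \<and> of_real ` S \<subseteq> D \<and> fC holomorphic_on D \<and> (\<forall>x\<in>S. fC (of_real x) = of_real (f x))"

definition signal :: "(real \<Rightarrow> real) \<Rightarrow> (real \<Rightarrow> real) \<Rightarrow> real \<Rightarrow> real \<Rightarrow> complex" where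
  "signal a \<psi> chi s = of_real (a s) * exp (\<i> * of_real (chi * \<psi> s))"

definition pwvd :: "(real \<Rightarrow> real) \<Rightarrow> real \<Rightarrow> (real \<Rightarrow> complex) \<Rightarrow> real \<Rightarrow> real \<Rightarrow> complex" where
  "pwvd w T x t f =
     (LBINT \<tau>=-T..T. of_real (w (\<tau> / 2) * w (- (\<tau> / 2))) * x (t + \<tau> / 2) * cnj (x (t - \<tau> / 2))
        * exp (- \<i> * of_real (2 * pi * f * \<tau>)))"

definition inst_freq :: "real \<Rightarrow> (real \<Rightarrow> real) \<Rightarrow> real \<Rightarrow> real" where
  "inst_freq chi \<psi> s = chi / (2 * pi) * deriv \<psi> s"

text \<open>The functions \<open>A(\<tau>,t)\<close> and \<open>F(\<tau>,t,fb)\<close>. They are polymorphic so that they apply both to the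
  real data \<open>w\<close>, \<open>a\<close>, \<open>\<psi>\<close> and to their holomorphic continuations; \<open>fb\<close> is the asymptotic
  frequency \<open>f / chi\<close>.\<close>

definition pw_amp :: "('a::real_normed_field \<Rightarrow> 'a) \<Rightarrow> ('a \<Rightarrow> 'a) \<Rightarrow> real \<Rightarrow> 'a \<Rightarrow> 'a" where
  "pw_amp w a t \<tau> = w (\<tau> / 2) * w (- (\<tau> / 2)) * a (of_real t + \<tau> / 2) * a (of_real t - \<tau> / 2)"

definition pw_phase :: "('a::real_normed_field \<Rightarrow> 'a) \<Rightarrow> real \<Rightarrow> real \<Rightarrow> 'a \<Rightarrow> 'a" where
  "pw_phase \<psi> t fb \<tau> = \<psi> (of_real t + \<tau> / 2) - \<psi> (of_real t - \<tau> / 2) - of_real (2 * pi * fb) * \<tau>"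

text \<open>The integration interval together with the segment joining the two stationary points. When
  \<open>\<plusminus>\<tau>s\<close> are real and inside the window this is just \<open>[-T, T]\<close>.\<close>

definition pw_cross :: "real \<Rightarrow> complex \<Rightarrow> complex set" where
  "pw_cross T \<tau>s = closed_segment (- of_real T) (of_real T) \<union> closed_segment (- \<tau>s) \<tau>s"

text \<open>\<open>\<plusminus>\<tau>s\<close> is \<^emph>\<open>the\<close> pair of stationary points of the phase: there are no others on the cross, and
  they are simple unless they coalesce at \<open>0\<close>. As the phase is odd and real on the reals, its
  stationary points are symmetric under negation and conjugation, so a single pair is either real
  or purely imaginary; the imaginary case is the side of the instantaneous frequency curve on which
  the stationary points exist only by analytic continuation.\<close>

definition stationary_pair ::
  "complex set \<Rightarrow> complex set \<Rightarrow> real \<Rightarrow> (complex \<Rightarrow> complex) \<Rightarrow> real \<Rightarrow> real \<Rightarrow> complex \<Rightarrow> bool" where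
  "stationary_pair D Dw T \<psi>C t fb \<tau>s \<longleftrightarrow>
     (\<tau>s \<in> \<real> \<or> \<i> * \<tau>s \<in> \<real>) \<and>
     (\<forall>\<tau>\<in>pw_cross T \<tau>s. of_real t + \<tau> / 2 \<in> D \<and> of_real t - \<tau> / 2 \<in> D \<and>
                        \<tau> / 2 \<in> Dw \<and> - (\<tau> / 2) \<in> Dw) \<and>
     {\<tau>\<in>pw_cross T \<tau>s. deriv (pw_phase \<psi>C t fb) \<tau> = 0} = {\<tau>s, - \<tau>s} \<and>
     (\<tau>s \<noteq> 0 \<longrightarrow> deriv (deriv (pw_phase \<psi>C t fb)) \<tau>s \<noteq> 0)"

definition admissible ::
  "real set \<Rightarrow> complex set \<Rightarrow> complex set \<Rightarrow> real \<Rightarrow> (real \<Rightarrow> real) \<Rightarrow> (complex \<Rightarrow> complex) \<Rightarrow>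
     real \<Rightarrow> real \<Rightarrow> complex \<Rightarrow> bool" where
  "admissible I D Dw T \<psi> \<psi>C t fb \<tau>s \<longleftrightarrow>
     {t - T / 2..t + T / 2} \<subseteq> I \<and>
     (\<forall>chi\<ge>1. (deriv ^^ 2) (inst_freq chi \<psi>) t \<noteq> 0) \<and>
     stationary_pair D Dw T \<psi>C t fb \<tau>s"

text \<open>\<open>\<xi> = (3/2 F(\<tau>s))\<^bsup>2/3\<^esup>\<close>. The square is real, and \<open>root 3\<close> is the odd real cube root, so this is
  the real branch, non-negative for real \<open>\<tau>s\<close> and negative for imaginary \<open>\<tau>s \<noteq> 0\<close>.\<close>

definition pw_xi :: "(complex \<Rightarrow> complex) \<Rightarrow> complex \<Rightarrow> real" where
  "pw_xi F \<tau>s = root 3 (Re ((3 / 2 * F \<tau>s)\<^sup>2))"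

text \<open>\<open>u\<close> is an analytic diffeomorphism of (a neighbourhood of) the cross onto its image, with
  analytic inverse \<open>g\<close>, real on the real axis, that carries the phase to the canonical cubic.\<close>

definition canonical_map ::
  "real \<Rightarrow> (complex \<Rightarrow> complex) \<Rightarrow> complex \<Rightarrow> (complex \<Rightarrow> complex) \<Rightarrow> (complex \<Rightarrow> complex) \<Rightarrow> bool" where
  "canonical_map T F \<tau>s u g \<longleftrightarrow>
     u analytic_on pw_cross T \<tau>s \<and>
     g analytic_on u ` pw_cross T \<tau>s \<and>
     (\<forall>\<tau>\<in>pw_cross T \<tau>s. g (u \<tau>) = \<tau>) \<and>
     (\<forall>\<tau>\<in>pw_cross T \<tau>s. \<tau> \<in> \<real> \<longrightarrow> u \<tau> \<in> \<real>) \<and>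
     (\<forall>\<tau>\<in>pw_cross T \<tau>s. F \<tau> = u \<tau> ^ 3 / 3 - of_real (pw_xi F \<tau>s) * u \<tau>)"

text \<open>The image of \<open>T\<close> (real by the previous definition). It is negative when the canonical map
  reverses orientation, which depends on the sign of the curvature of the instantaneous frequency.\<close>

definition pw_q :: "real \<Rightarrow> (complex \<Rightarrow> complex) \<Rightarrow> real" where
  "pw_q T u = Re (u (of_real T))"

definition pw_G :: "(complex \<Rightarrow> complex) \<Rightarrow> (complex \<Rightarrow> complex) \<Rightarrow> complex \<Rightarrow> complex" where
  "pw_G A g v = A (g v) * deriv g v"

definition pw_A0 :: "(complex \<Rightarrow> complex) \<Rightarrow> (complex \<Rightarrow> complex) \<Rightarrow> real \<Rightarrow> complex" where
  "pw_A0 A g \<xi> = pw_G A g (csqrt (of_real \<xi>))"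

text \<open>The integral is oriented, so this is odd in \<open>s\<close>.\<close>

definition Phi_inc :: "real \<Rightarrow> real \<Rightarrow> complex" where
  "Phi_inc p s = 1 / (2 * pi) * (LBINT y=-s..s. exp (\<i> * of_real (y ^ 3 / 3 + p * y)))"

end

theory Submission
  imports Defs
begin

text \<open>Everything is done in the variable \<open>x = \<tau>\<^sup>2\<close>. The phase is odd, \<open>F' = \<sigma> (x - b) k(x)\<close> with
  \<open>b = \<tau>\<^sub>s\<^sup>2\<close> real, \<open>\<sigma> = 1\<close> or \<open>- 1\<close>, and \<open>k > 0\<close> on the real \<open>x\<close>-interval that represents the cross, so real,
  coalescing and imaginary stationary points are treated alike. Put \<open>u = \<sigma> \<tau> m(x)\<close> and
  \<open>u\<^sup>2 - \<xi> = (x - b) \<rho>(x)\<close>. Then \<open>F = u\<^sup>3/3 - \<xi> u\<close> follows from the system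

  \<open>\<rho>(x)\<^sup>2 = \<integral>\<^sub>0\<^sup>1 2 s (k m)(b + s (x - b)) ds\<close>,  \<open>m(x)\<^sup>2 = \<integral>\<^sub>0\<^sup>1 (k m / \<rho>)(s x) ds\<close>,

  in which no derivative is lost and nothing degenerates as \<open>b\<close> tends to \<open>0\<close>. For positive functions on the real
  interval the right-hand sides are monotone means, so \<open>log m \<mapsto> log \<rho>\<close> has Lipschitz constant \<open>1/2\<close> in the
  sup norm and the system is a contraction with constant \<open>3/4\<close> in \<open>log m\<close>. This survives, with a
  slightly larger constant, on a convex complex neighbourhood of the interval where \<open>arg k\<close> is small,
  and gives bounds that depend only on bounds for \<open>log k\<close>.

  Moreover \<open>u' = \<sigma> k / \<rho>\<close>. With \<open>A\<^sub>0 = A(\<tau>\<^sub>s) / u'(\<tau>\<^sub>s)\<close> the remainder is the integral of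
  \<open>(A - A\<^sub>0 u') e\<^sup>i\<^sup>\<chi>\<^sup>F\<close>, whose amplitude is divisible by \<open>F'\<close>, and one integration by parts gives
  \<open>O(1/\<chi>)\<close> with an explicit constant. For uniformity, the stationary points depend continuously on
  \<open>(t, f)\<close> while they stay inside the window, hence so does \<open>k\<close>, and the constant is locally bounded.\<close>

subsection \<open>Logarithmic means and the fixed point\<close>

text \<open>Origin of the system: differentiating \<open>F = u^3/3 - \<xi> u\<close> gives
  \<open>F' = (u^2 - \<xi>) u'\<close>, so \<open>u' = \<sigma> k / \<rho>\<close>. As functions of
  \<open>x\<close>, both \<open>y = u^2 = x m^2\<close> and \<open>Y = (x - b) \<rho>\<close> then
  have derivative \<open>k m / \<rho>\<close>. Integrating \<open>y'\<close> from \<open>0\<close>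
  gives the equation for \<open>m\<close>; integrating \<open>(Y^2)' = 2 (x - b) k m\<close> from
  \<open>b\<close> gives the one for \<open>\<rho>\<close> with its weight \<open>2 s\<close>.
  Conversely the two equations make \<open>y - Y\<close> constant, and that constant is
  \<open>\<xi>\<close>. A normal form built only near the coalescing points would tell neither how
  far it reaches along the window nor how it depends on \<open>(t, f)\<close>. The fixed point lives
  on the whole neighbourhood and its constants are absolute: with cosines of arguments at least
  \<open>7/8\<close>, one mean costs a factor \<open>8/7\<close>; the square roots halve this to
  \<open>4/7\<close> for \<open>\<rho>\<close> and to \<open>4/7 * 11/7 = 44/49\<close> for
  \<open>m\<close>. An imaginary part of \<open>log k\<close> up to \<open>1/40\<close> is
  reproduced within \<open>9/40\<close> for \<open>log m\<close>, since
  \<open>44/49 * (1/40 + 9/40) = 11/49 < 9/40\<close>.\<close>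

definition weight :: "(real \<Rightarrow> real) \<Rightarrow> bool" where
  "weight c \<longleftrightarrow> continuous_on {0..1} c \<and> (\<forall>s\<in>{0..1}. 0 \<le> c s) \<and> integral {0..1} c = 1"

definition exp_mean :: "(real \<Rightarrow> real) \<Rightarrow> (real \<Rightarrow> complex) \<Rightarrow> complex" where
  "exp_mean c f = integral {0..1} (\<lambda>s. of_real (c s) * exp (f s))"

text \<open>\<open>1 - 2 (1/4)^2 = 7/8\<close> by the double-angle formula. This value is the source
  of the factor \<open>8/7\<close> in the estimates that follow.\<close>

lemma cos_ge_seven_eighths: "\<bar>x\<bar> \<le> 1/2 \<Longrightarrow> 7/8 \<le> cos (x::real)"
proof -
  assume x: "\<bar>x\<bar> \<le> 1/2"
  have "cos x = 1 - 2 * (sin (x/2))\<^sup>2"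
    using cos_double_sin[of "x/2"] by simp
  moreover have "(sin (x/2))\<^sup>2 \<le> (1/4)\<^sup>2"
    using abs_sin_x_le_abs_x[of "x/2"] x
    by (intro power2_le_iff_abs_le[THEN iffD2]) auto
  ultimately show ?thesis by (simp add: power2_eq_square)
qed

text \<open>Arguments of size at most \<open>1/2\<close> allow almost no cancellation: each
  integrand keeps \<open>7/8\<close> of its modulus in its real part, and so does the mean. Hence
  its principal logarithm is harmless and \<open>r\<close> controls the mean from below.\<close>

lemma exp_mean_pos:
  assumes c: "weight c" and f: "continuous_on {0..1} f" and Im: "\<And>s. s \<in> {0..1} \<Longrightarrow> \<bar>Im (f s)\<bar> \<le> 1/2"
  defines "r \<equiv> integral {0..1} (\<lambda>s. c s * exp (Re (f s)))"
  shows "0 < r" "7/8 * r \<le> Re (exp_mean c f)" "0 < Re (exp_mean c f)"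
proof -
  have cc: "continuous_on {0..1} c" and c0: "\<And>s. s \<in> {0..1} \<Longrightarrow> 0 \<le> c s" and c1: "integral {0..1} c = 1"
    using c by (auto simp: weight_def)
  have int1: "(\<lambda>s. c s * exp (Re (f s))) integrable_on {0..1}"
    by (intro integrable_continuous_interval continuous_intros cc f)
  have "compact (f ` {0..1})"
    by (intro compact_continuous_image f) auto
  then obtain B where B: "\<And>s. s \<in> {0..1} \<Longrightarrow> cmod (f s) \<le> B"
    by (meson bounded_iff compact_imp_bounded image_eqI)
  \<comment> \<open>Only strict positivity of \<open>r\<close> is at stake; \<open>exp (-B)\<close>
    is a crude lower bound, which the total weight \<open>1\<close> passes on to the
    integral.\<close>
  have "exp (-B) = integral {0..1} (\<lambda>s. c s * exp (-B))"
    using c1 by simp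
  also have "\<dots> \<le> r" unfolding r_def
  proof (rule integral_le)
    fix s :: real assume s: "s \<in> {0..1}"
    show "c s * exp (-B) \<le> c s * exp (Re (f s))"
      using c0[OF s] B[OF s] abs_Re_le_cmod[of "f s"] by (intro mult_left_mono) auto
  qed (auto intro!: int1 integrable_continuous_interval continuous_intros cc)
  finally show r0: "0 < r" by (rule less_le_trans[OF exp_gt_zero])
  have int2: "(\<lambda>s. of_real (c s) * exp (f s)) integrable_on {0..1}"
    by (intro integrable_continuous_interval continuous_intros cc f)
  have "7/8 * r = integral {0..1} (\<lambda>s. 7/8 * (c s * exp (Re (f s))))"
    unfolding r_def by simp
  also have "\<dots> \<le> integral {0..1} (\<lambda>s. Re (of_real (c s) * exp (f s)))"
  proof (rule integral_le)
    fix s :: real assume s: "s \<in> {0..1}"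
    have "7/8 \<le> cos (Im (f s))" using cos_ge_seven_eighths Im[OF s] by simp
    then have "(c s * exp (Re (f s))) * (7/8) \<le> (c s * exp (Re (f s))) * cos (Im (f s))"
      using c0[OF s] by (intro mult_left_mono) auto
    then show "7/8 * (c s * exp (Re (f s))) \<le> Re (of_real (c s) * exp (f s))"
      by (simp add: Re_exp algebra_simps)
  qed (auto intro!: int1 integrable_continuous_interval continuous_intros cc f)
  also have "\<dots> = Re (exp_mean c f)"
    unfolding exp_mean_def
    using integral_linear[OF int2 bounded_linear_Re] by (simp add: o_def)
  finally show "7/8 * r \<le> Re (exp_mean c f)" .
  with r0 show "0 < Re (exp_mean c f)" by linarith
qed

text \<open>The derivative of \<open>Ln\<close> of the mean along a homotopy is a quotient: the
  numerator is at most \<open>d\<close> times the integral of the moduli, the denominator at least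
  \<open>7/8\<close> of that integral. The real parts of the exponents thus cancel and the constant
  does not depend on their size.\<close>

lemma Ln_exp_mean_lipschitz:
  assumes c: "weight c" and f: "continuous_on {0..1} f" and g: "continuous_on {0..1} g"
    and Imf: "\<And>s. s \<in> {0..1} \<Longrightarrow> \<bar>Im (f s)\<bar> \<le> 1/2" and Img: "\<And>s. s \<in> {0..1} \<Longrightarrow> \<bar>Im (g s)\<bar> \<le> 1/2"
    and d: "\<And>s. s \<in> {0..1} \<Longrightarrow> cmod (f s - g s) \<le> d"
  shows "cmod (Ln (exp_mean c f) - Ln (exp_mean c g)) \<le> 8/7 * d"
proof -
  have cc: "continuous_on {0..1} c" and c0: "\<And>s. s \<in> {0..1} \<Longrightarrow> 0 \<le> c s"
    using c by (auto simp: weight_def)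
  \<comment> \<open>The straight-line homotopy from \<open>g\<close> to \<open>f\<close> has a
    complex parameter, so the mean value inequality for complex derivatives applies on the segment
    from \<open>0\<close> to \<open>1\<close>.\<close>
  define h where "h = (\<lambda>z s. g s + z * (f s - g s))"
  define Z where "Z = (\<lambda>z. exp_mean c (h z))"
  define Z' where "Z' = (\<lambda>z. integral {0..1} (\<lambda>s. of_real (c s) * (exp (h z s) * (f s - g s))))"
  have conth: "continuous_on {0..1} (h z)" for z
    unfolding h_def by (intro continuous_intros f g)
  have derZ: "(Z has_field_derivative Z' z) (at z)" for z
  proof -
    have "((\<lambda>z. integral (cbox 0 1) (\<lambda>s. of_real (c s) * exp (h z s))) has_field_derivative
        integral (cbox 0 1) (\<lambda>s. of_real (c s) * (exp (h z s) * (f s - g s)))) (at z within UNIV)"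
    proof (rule leibniz_rule_field_derivative)
      show "((\<lambda>x. of_real (c t) * exp (h x t)) has_field_derivative of_real (c t) * (exp (h x t) * (f t - g t))) (at x within UNIV)" for x t
        unfolding h_def by (auto intro!: derivative_eq_intros)
      show "(\<lambda>s. of_real (c s) * exp (h x s)) integrable_on cbox 0 1" for x
        by (auto intro!: integrable_continuous_interval continuous_intros cc conth)
      have 1: "continuous_on (UNIV \<times> cbox 0 1) (\<lambda>p::complex\<times>real. f (snd p))"
        by (rule continuous_on_compose2[OF f]) (auto intro!: continuous_intros)
      have 2: "continuous_on (UNIV \<times> cbox 0 1) (\<lambda>p::complex\<times>real. g (snd p))"
        by (rule continuous_on_compose2[OF g]) (auto intro!: continuous_intros)
      have 3: "continuous_on (UNIV \<times> cbox 0 1) (\<lambda>p::complex\<times>real. c (snd p))"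
        by (rule continuous_on_compose2[OF cc]) (auto intro!: continuous_intros)
      show "continuous_on (UNIV \<times> cbox 0 1) (\<lambda>(x, t). of_real (c t) * (exp (h x t) * (f t - g t)))"
        unfolding h_def split_def by (intro continuous_intros 1 2 3)
    qed auto
    then show ?thesis by (simp add: Z_def Z'_def exp_mean_def)
  qed
  have Imh: "\<bar>Im (h z s)\<bar> \<le> 1/2" if z: "z \<in> closed_segment 0 1" and s: "s \<in> {0..1}" for z s
  proof -
    from z obtain r where r: "z = of_real r" "0 \<le> r" "r \<le> 1"
      by (auto simp: closed_segment_def scaleR_conv_of_real)
    have e: "Im (h z s) = (1 - r) * Im (g s) + r * Im (f s)"
      by (simp add: h_def r algebra_simps)
    have "\<bar>Im (h z s)\<bar> \<le> (1 - r) * \<bar>Im (g s)\<bar> + r * \<bar>Im (f s)\<bar>"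
      unfolding e using r by (auto simp: abs_mult intro: abs_triangle_ineq[THEN order_trans])
    also have "\<dots> \<le> (1 - r) * (1/2) + r * (1/2)"
      using r s by (intro add_mono mult_left_mono Imf Img) auto
    also have "\<dots> = 1/2" by (simp add: field_simps)
    finally show ?thesis .
  qed
  have bnd: "Z z \<notin> \<real>\<^sub>\<le>\<^sub>0 \<and> cmod (Z' z / Z z) \<le> 8/7 * d" if z: "z \<in> closed_segment 0 1" for z
  proof -
    define r where "r = integral {0..1} (\<lambda>s. c s * exp (Re (h z s)))"
    have r: "0 < r" "7/8 * r \<le> Re (Z z)"
      using exp_mean_pos[OF c conth Imh[OF z], folded r_def] by (auto simp: Z_def)
    have "cmod (Z' z) \<le> integral {0..1} (\<lambda>s. d * (c s * exp (Re (h z s))))"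
      unfolding Z'_def
    proof (rule integral_norm_bound_integral)
      fix s :: real assume s: "s \<in> {0..1}"
      have "cmod (of_real (c s) * (exp (h z s) * (f s - g s))) = (c s * exp (Re (h z s))) * cmod (f s - g s)"
        using c0[OF s] by (simp add: norm_mult)
      also have "\<dots> \<le> (c s * exp (Re (h z s))) * d"
        using c0[OF s] d[OF s] by (intro mult_left_mono) auto
      finally show "cmod (of_real (c s) * (exp (h z s) * (f s - g s))) \<le> d * (c s * exp (Re (h z s)))"
        by (simp add: mult_ac)
    qed (auto intro!: integrable_continuous_interval continuous_intros cc conth f g)
    also have "\<dots> = d * r" by (simp add: r_def)
    finally have 1: "cmod (Z' z) \<le> d * r" .
    have d0: "0 \<le> d" using norm_ge_zero[of "f 0 - g 0"] d[of 0] by (meson atLeastAtMost_iff order.refl order_trans zero_le_one)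
    have Zr: "7/8 * r \<le> cmod (Z z)" using r(2) complex_Re_le_cmod order_trans by blast
    have "cmod (Z' z) \<le> 8/7 * d * cmod (Z z)"
      using 1 mult_left_mono[OF Zr d0] by simp
    then have "cmod (Z' z / Z z) \<le> 8/7 * d"
      using Zr r(1) d0 by (simp add: norm_divide divide_le_eq)
    moreover have "Z z \<notin> \<real>\<^sub>\<le>\<^sub>0" using r by (auto simp: complex_nonpos_Reals_iff)
    ultimately show ?thesis by blast
  qed
  have "cmod (Ln (Z 1) - Ln (Z 0)) \<le> 8/7 * d * cmod (1 - 0)"
  proof (rule field_differentiable_bound[where S="closed_segment 0 1" and f'="\<lambda>z. Z' z / Z z"])
    fix z :: complex assume z: "z \<in> closed_segment 0 1"
    show "((\<lambda>z. Ln (Z z)) has_field_derivative Z' z / Z z) (at z within closed_segment 0 1)"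
      using bnd[OF z] by (auto intro!: derivative_eq_intros has_field_derivative_at_within[OF derZ] simp: field_simps)
  qed (use bnd in auto)
  moreover have "Z 1 = exp_mean c f" "Z 0 = exp_mean c g" by (auto simp: Z_def h_def)
  ultimately show ?thesis by simp
qed

text \<open>The right-hand side of either equation of the system in logarithmic form; the base point
  \<open>z\<close> is \<open>b\<close> in the equation for \<open>\<rho>\<close> and
  \<open>0\<close> in the one for \<open>m\<close>.\<close>

definition Lmean :: "(real \<Rightarrow> real) \<Rightarrow> complex \<Rightarrow> (complex \<Rightarrow> complex) \<Rightarrow> complex \<Rightarrow> complex" where
  "Lmean c z f x = Ln (exp_mean c (\<lambda>s. f (z + of_real s * (x - z))))"

lemma segment_in_convex:
  assumes "convex S" "z \<in> S" "x \<in> S" "0 \<le> s" "s \<le> 1"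
  shows "z + complex_of_real s * (x - z) \<in> S"
proof -
  have "(1 - s) *\<^sub>R z + s *\<^sub>R x \<in> S" using assms by (intro convexD) auto
  then show ?thesis by (simp add: scaleR_conv_of_real algebra_simps)
qed

lemma continuous_on_segment:
  assumes "convex S" "z \<in> S" "x \<in> S" "continuous_on S f"
  shows "continuous_on {0..1} (\<lambda>s. f (z + complex_of_real s * (x - z)))"
  by (rule continuous_on_compose2[OF assms(4)]) (auto intro!: continuous_intros segment_in_convex assms)

lemma exp_mean_real:
  assumes "\<And>s. s \<in> {0..1} \<Longrightarrow> f s \<in> \<real>" shows "exp_mean c f \<in> \<real>"
proof (cases "(\<lambda>s. of_real (c s) * exp (f s)) integrable_on {0..1}")
  case True
  have "Im (exp_mean c f) = integral {0..1} (\<lambda>s. Im (of_real (c s) * exp (f s)))"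
    unfolding exp_mean_def using integral_linear[OF True bounded_linear_Im] by (simp add: o_def)
  also have "\<dots> = integral {0..1} (\<lambda>s::real. 0)"
  proof (rule integral_cong)
    fix s :: real assume "s \<in> {0..1}"
    then show "Im (of_real (c s) * exp (f s)) = 0"
      using assms[of s] by (simp add: complex_is_Real_iff Im_exp)
  qed
  finally show ?thesis by (simp add: complex_is_Real_iff)
\<comment> \<open>Without integrability the integral is \<open>0\<close> by convention, which is
  real.\<close>
qed (simp add: exp_mean_def not_integrable_integral)

lemma Lmean_lipschitz:
  assumes "weight c" "convex S" "z \<in> S" "x \<in> S" "continuous_on S f" "continuous_on S g"
    and "\<And>x. x \<in> S \<Longrightarrow> \<bar>Im (f x)\<bar> \<le> 1/2" "\<And>x. x \<in> S \<Longrightarrow> \<bar>Im (g x)\<bar> \<le> 1/2"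
    and "\<And>x. x \<in> S \<Longrightarrow> cmod (f x - g x) \<le> d"
  shows "cmod (Lmean c z f x - Lmean c z g x) \<le> 8/7 * d"
  unfolding Lmean_def
proof (rule Ln_exp_mean_lipschitz)
  fix s :: real assume "s \<in> {0..1}"
  then have "z + of_real s * (x - z) \<in> S" using assms(2-4) by (intro segment_in_convex) auto
  then show "\<bar>Im (f (z + of_real s * (x - z)))\<bar> \<le> 1/2" "\<bar>Im (g (z + of_real s * (x - z)))\<bar> \<le> 1/2"
     "cmod (f (z + of_real s * (x - z)) - g (z + of_real s * (x - z))) \<le> d"
    using assms by blast+
qed (use assms in \<open>auto intro: continuous_on_segment\<close>)

text \<open>Along a segment of the real axis the mean is a positive real. Positivity matters here:
  the principal logarithm of a negative real is not real.\<close>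

lemma Lmean_real:
  assumes c: "weight c" and S: "convex S" "z \<in> S" "x \<in> S" and f: "continuous_on S f"
    and Im: "\<And>x. x \<in> S \<Longrightarrow> \<bar>Im (f x)\<bar> \<le> 1/2"
    and re: "\<And>x. x \<in> S \<Longrightarrow> x \<in> \<real> \<Longrightarrow> f x \<in> \<real>" and zx: "z \<in> \<real>" "x \<in> \<real>"
  shows "Lmean c z f x \<in> \<real>"
proof -
  define Z where "Z = exp_mean c (\<lambda>s. f (z + of_real s * (x - z)))"
  have "Z \<in> \<real>" unfolding Z_def
  proof (rule exp_mean_real)
    fix s :: real assume "s \<in> {0..1}"
    then show "f (z + of_real s * (x - z)) \<in> \<real>"
      using S zx by (intro re segment_in_convex Reals_add Reals_mult Reals_diff) auto
  qed
  moreover have "0 < Re Z" unfolding Z_def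
    by (rule exp_mean_pos(3)[OF c continuous_on_segment[OF S f]])
      (use Im segment_in_convex[OF S] in force)
  ultimately obtain r where "Z = of_real r" "0 < r" by (auto elim!: Reals_cases)
  then show ?thesis unfolding Lmean_def Z_def[symmetric] by (simp add: Ln_of_real)
qed

lemma Lmean_0: "weight c \<Longrightarrow> Lmean c z (\<lambda>_. 0) x = 0"
proof -
  assume c: "weight c"
  then have "c integrable_on {0..1}" by (auto simp: weight_def intro: integrable_continuous_interval)
  then have "integral {0..1} (\<lambda>s. complex_of_real (c s)) = of_real (integral {0..1} c)"
    by (intro integral_unique has_integral_of_real integrable_integral)
  with c show ?thesis by (simp add: Lmean_def exp_mean_def weight_def)
qed

text \<open>Comparison with the zero function, whose logarithmic mean vanishes because the weight
  has integral \<open>1\<close>.\<close>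

lemma Lmean_norm:
  assumes "weight c" "convex S" "z \<in> S" "x \<in> S" "continuous_on S f"
    and "\<And>x. x \<in> S \<Longrightarrow> \<bar>Im (f x)\<bar> \<le> 1/2" "\<And>x. x \<in> S \<Longrightarrow> cmod (f x) \<le> d"
  shows "cmod (Lmean c z f x) \<le> 8/7 * d"
  using Lmean_lipschitz[of c S z x f "\<lambda>_. 0" d] Lmean_0[of c z x] assms by auto

text \<open>Comparison of \<open>f\<close> with its real part: the mean of the latter is a positive
  real, so its logarithm has no imaginary part. The bound ignores the size of the real part, so the
  width of the strip can be prescribed independently of \<open>L\<close>.\<close>

lemma Ln_exp_mean_Im:
  assumes c: "weight c" and f: "continuous_on {0..1} f"
    and Im: "\<And>s. s \<in> {0..1} \<Longrightarrow> \<bar>Im (f s)\<bar> \<le> e" "e \<le> 1/2"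
  shows "\<bar>Im (Ln (exp_mean c f))\<bar> \<le> 8/7 * e"
proof -
  let ?g = "\<lambda>s. complex_of_real (Re (f s))"
  have g: "continuous_on {0..1} ?g" by (intro continuous_intros f)
  have "exp_mean c ?g \<in> \<real>" by (rule exp_mean_real) auto
  moreover have "0 < Re (exp_mean c ?g)"
    by (rule exp_mean_pos(3)[OF c g]) auto
  ultimately obtain r where r: "exp_mean c ?g = of_real r" "0 < r" by (auto elim!: Reals_cases)
  have "cmod (Ln (exp_mean c f) - Ln (exp_mean c ?g)) \<le> 8/7 * e"
  proof (rule Ln_exp_mean_lipschitz[OF c f g])
    fix s :: real assume s: "s \<in> {0..1}"
    have "f s - of_real (Re (f s)) = \<i> * of_real (Im (f s))" by (simp add: complex_eq_iff)
    then show "cmod (f s - of_real (Re (f s))) \<le> e" using Im(1)[OF s] by (simp add: norm_mult)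
    show "\<bar>Im (f s)\<bar> \<le> 1/2" using Im s by fastforce
  qed auto
  then show ?thesis
    using abs_Im_le_cmod[of "Ln (exp_mean c f) - Ln (exp_mean c ?g)"] r by (simp add: Ln_of_real)
qed

lemma Lmean_Im:
  assumes "weight c" "convex S" "z \<in> S" "x \<in> S" "continuous_on S f"
    and "\<And>x. x \<in> S \<Longrightarrow> \<bar>Im (f x)\<bar> \<le> e" "e \<le> 1/2"
  shows "\<bar>Im (Lmean c z f x)\<bar> \<le> 8/7 * e"
  unfolding Lmean_def
  by (rule Ln_exp_mean_Im) (use assms in \<open>auto intro!: continuous_on_segment segment_in_convex\<close>)

lemma exp_Lmean:
  assumes c: "weight c" and S: "convex S" "z \<in> S" "x \<in> S" and f: "continuous_on S f"
    and Im: "\<And>x. x \<in> S \<Longrightarrow> \<bar>Im (f x)\<bar> \<le> 1/2"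
  shows "exp (Lmean c z f x) = integral {0..1} (\<lambda>s. of_real (c s) * exp (f (z + of_real s * (x - z))))"
    and "0 < Re (exp_mean c (\<lambda>s. f (z + of_real s * (x - z))))"
proof -
  show *: "0 < Re (exp_mean c (\<lambda>s. f (z + of_real s * (x - z))))"
    by (rule exp_mean_pos(3)[OF c continuous_on_segment[OF S f]])
      (use Im segment_in_convex[OF S] in force)
  then show "exp (Lmean c z f x) = integral {0..1} (\<lambda>s. of_real (c s) * exp (f (z + of_real s * (x - z))))"
    unfolding Lmean_def by (subst exp_Ln) (auto simp: exp_mean_def)
qed

text \<open>Differentiation under the integral sign, with the mean kept in the right half-plane and
  so off the branch cut of \<open>Ln\<close>.\<close>

lemma Lmean_holomorphic:
  assumes c: "weight c" and S: "convex S" "open S" "z \<in> S" and f: "f holomorphic_on S"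
    and Im: "\<And>x. x \<in> S \<Longrightarrow> \<bar>Im (f x)\<bar> \<le> 1/2"
  shows "Lmean c z f holomorphic_on S"
proof -
  have cc: "continuous_on {0..1} c" using c by (auto simp: weight_def)
  have cf: "continuous_on S f" using f by (rule holomorphic_on_imp_continuous_on)
  have cf': "continuous_on S (deriv f)"
    using f S by (intro holomorphic_on_imp_continuous_on holomorphic_deriv)
  let ?p = "\<lambda>x s. z + complex_of_real s * (x - z)"
  have "(\<lambda>x. integral (cbox 0 1) (\<lambda>s. of_real (c s) * exp (f (?p x s)))) holomorphic_on S"
  proof (rule leibniz_rule_holomorphic)
    fix x and t :: real assume x: "x \<in> S" and t: "t \<in> cbox 0 1"
    have "?p x t \<in> S" using S x t by (intro segment_in_convex) auto
    then have "(f has_field_derivative deriv f (?p x t)) (at (?p x t))"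
      using f S holomorphic_derivI by blast
    then have "((\<lambda>x. f (?p x t)) has_field_derivative deriv f (?p x t) * of_real t) (at x)"
      by (rule DERIV_chain2) (auto intro!: derivative_eq_intros)
    from has_field_derivative_at_within[OF this]
    show "((\<lambda>x. of_real (c t) * exp (f (?p x t))) has_field_derivative
        of_real (c t) * (exp (f (?p x t)) * (deriv f (?p x t) * of_real t))) (at x within S)"
      by (auto intro!: derivative_eq_intros)
  next
    fix x assume x: "x \<in> S"
    show "(\<lambda>s. of_real (c s) * exp (f (?p x s))) integrable_on cbox 0 1"
      using continuous_on_segment[OF S(1,3) x cf]
      by (auto intro!: integrable_continuous_interval continuous_intros cc)
  next
    have 0: "continuous_on (S \<times> cbox 0 1) (\<lambda>p. ?p (fst p) (snd p))" by (intro continuous_intros)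
    have 00: "(\<lambda>p. ?p (fst p) (snd p)) ` (S \<times> cbox 0 1) \<subseteq> S"
      using S by (auto intro!: segment_in_convex)
    have 3: "continuous_on (S \<times> cbox 0 1) (\<lambda>p. c (snd p))"
      by (rule continuous_on_compose2[OF cc]) (auto intro!: continuous_intros)
    note 1 = continuous_on_compose2[OF cf 0 00] continuous_on_compose2[OF cf' 0 00]
    show "continuous_on (S \<times> cbox 0 1)
       (\<lambda>(x, t). of_real (c t) * (exp (f (?p x t)) * (deriv f (?p x t) * of_real t)))"
      unfolding split_def by (intro continuous_intros 1 3)
  qed fact
  then have "(\<lambda>x. exp_mean c (\<lambda>s. f (?p x s))) holomorphic_on S" by (simp add: exp_mean_def)
  moreover have "exp_mean c (\<lambda>s. f (?p x s)) \<notin> \<real>\<^sub>\<le>\<^sub>0" if "x \<in> S" for x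
    using exp_Lmean(2)[OF c S(1,3) that cf Im] by (auto simp: complex_nonpos_Reals_iff)
  ultimately show ?thesis
    unfolding Lmean_def[abs_def] by (intro holomorphic_intros) auto
qed

section \<open>The two weights and the contraction\<close>

lemma weight_1: "weight (\<lambda>_. 1)"
  by (simp add: weight_def)

text \<open>This weight comes from the zero at \<open>b\<close>: the derivative
  \<open>2 (x - b) k m\<close> of the square of \<open>(x - b) \<rho>\<close> becomes
  \<open>2 s (x - b)^2 k m\<close> once the segment from \<open>b\<close> to \<open>x\<close> is
  parametrised by \<open>s\<close>.\<close>

lemma weight_linear: "weight (\<lambda>s. 2 * s)"
proof -
  have "((\<lambda>s. 2 * s) has_integral 1\<^sup>2 - 0\<^sup>2) {0..1::real}"
    by (rule fundamental_theorem_of_calculus)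
      (auto intro!: derivative_eq_intros simp flip: has_real_derivative_iff_has_vector_derivative)
  then have "integral {0..1} (\<lambda>s::real. 2 * s) = 1"
    by (intro integral_unique) simp
  then show ?thesis by (auto simp: weight_def intro!: continuous_intros)
qed

text \<open>Banach iteration for \<open>\<mu> = log m\<close>, with
  \<open>\<nu> = log \<rho>\<close> eliminated. All estimates are in the sup norm on
  \<open>S\<close> and involve no derivative and no distance to the boundary, so the solution lives
  on the same \<open>S\<close> as \<open>\<kappa>\<close>.\<close>

lemma canonical_fixed_point:
  assumes S: "convex S" "open S" "0 \<in> S" "b \<in> S" "b \<in> \<real>" and L: "0 \<le> L"
    and k: "\<kappa> holomorphic_on S" "\<And>x. x \<in> S \<Longrightarrow> \<bar>Im (\<kappa> x)\<bar> \<le> 1/40" "\<And>x. x \<in> S \<Longrightarrow> cmod (\<kappa> x) \<le> L"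
      "\<And>x. x \<in> S \<Longrightarrow> x \<in> \<real> \<Longrightarrow> \<kappa> x \<in> \<real>"
  obtains \<mu> \<nu> where "\<mu> holomorphic_on S" "\<nu> holomorphic_on S"
    "\<And>x. x \<in> S \<Longrightarrow> \<bar>Im (\<mu> x)\<bar> \<le> 9/40"
    "\<And>x. x \<in> S \<Longrightarrow> x \<in> \<real> \<Longrightarrow> \<mu> x \<in> \<real>"
    "\<And>x. x \<in> S \<Longrightarrow> \<bar>Im (\<nu> x)\<bar> \<le> 1/7" "\<And>x. x \<in> S \<Longrightarrow> cmod (\<nu> x) \<le> 6 * L"
    "\<And>x. x \<in> S \<Longrightarrow> x \<in> \<real> \<Longrightarrow> \<nu> x \<in> \<real>"
    "\<And>x. x \<in> S \<Longrightarrow> exp (2 * \<nu> x) = integral {0..1} (\<lambda>s. of_real (2 * s) * exp (\<kappa> (b + of_real s * (x - b)) + \<mu> (b + of_real s * (x - b))))"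
    "\<And>x. x \<in> S \<Longrightarrow> exp (2 * \<mu> x) = integral {0..1} (\<lambda>s. exp (\<kappa> (of_real s * x) + \<mu> (of_real s * x) - \<nu> (of_real s * x)))"
proof -
  \<comment> \<open>The constants of this class close up: from \<open>9/40\<close> and
    \<open>9 L\<close> the bounds run through \<open>1/4\<close>, \<open>1/7\<close>,
    \<open>11/28\<close> and \<open>10 L\<close>, \<open>40/7 L\<close>, \<open>110/7 L\<close>, and
    end at \<open>11/49 \<le> 9/40\<close> and \<open>440/49 L \<le> 9 L\<close>.\<close>
  define good where "good = (\<lambda>f. f holomorphic_on S \<and> (\<forall>x\<in>S. \<bar>Im (f x)\<bar> \<le> 9/40) \<and>
     (\<forall>x\<in>S. cmod (f x) \<le> 9 * L) \<and> (\<forall>x\<in>S. x \<in> \<real> \<longrightarrow> f x \<in> \<real>))"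
  \<comment> \<open>The factor \<open>1/2\<close> is a square root in logarithmic form, as the
    equations determine \<open>\<rho>^2\<close> and \<open>m^2\<close>.\<close>
  define N where "N = (\<lambda>f x. 1/2 * Lmean (\<lambda>s. 2 * s) b (\<lambda>x. \<kappa> x + f x) x)"
  define \<Phi> where "\<Phi> = (\<lambda>f x. 1/2 * Lmean (\<lambda>_. 1) 0 (\<lambda>x. \<kappa> x + f x - N f x) x)"
  have ImKf: "\<bar>Im (\<kappa> x + f x)\<bar> \<le> 1/4" and nKf: "cmod (\<kappa> x + f x) \<le> 10 * L"
    and realKf: "x \<in> \<real> \<Longrightarrow> \<kappa> x + f x \<in> \<real>" if "good f" "x \<in> S" for f x
  proof -
    have f: "\<bar>Im (f x)\<bar> \<le> 9/40" "cmod (f x) \<le> 9 * L" "x \<in> \<real> \<Longrightarrow> f x \<in> \<real>"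
      using that by (auto simp: good_def)
    show "\<bar>Im (\<kappa> x + f x)\<bar> \<le> 1/4"
      using abs_triangle_ineq[of "Im (\<kappa> x)" "Im (f x)"] k(2)[OF that(2)] f(1) by simp
    have "cmod (\<kappa> x + f x) \<le> L + 9 * L"
      by (intro norm_triangle_mono k(3) f that)
    then show "cmod (\<kappa> x + f x) \<le> 10 * L" by simp
    show "x \<in> \<real> \<Longrightarrow> \<kappa> x + f x \<in> \<real>"
      using k(4)[OF that(2)] f(3) by (intro Reals_add)
  qed
  have holKf: "(\<lambda>x. \<kappa> x + f x) holomorphic_on S" if "good f" for f
    using that k(1) by (auto simp: good_def intro!: holomorphic_intros)
  have N: "N f holomorphic_on S \<and> (\<forall>x\<in>S. \<bar>Im (N f x)\<bar> \<le> 1/7) \<and> (\<forall>x\<in>S. cmod (N f x) \<le> 40/7 * L) \<and>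
      (\<forall>x\<in>S. x \<in> \<real> \<longrightarrow> N f x \<in> \<real>)" if f: "good f" for f
  proof (intro conjI ballI impI)
    note cont = holomorphic_on_imp_continuous_on[OF holKf[OF f]]
    have Im: "\<bar>Im (\<kappa> x + f x)\<bar> \<le> 1/2" if "x \<in> S" for x using ImKf[OF f that] by linarith
    show "N f holomorphic_on S" unfolding N_def
      by (intro holomorphic_intros Lmean_holomorphic weight_linear S holKf[OF f] Im)
    fix x assume x: "x \<in> S"
    show "\<bar>Im (N f x)\<bar> \<le> 1/7"
      using Lmean_Im[OF weight_linear S(1,4) x cont ImKf[OF f]] by (simp add: N_def)
    show "cmod (N f x) \<le> 40/7 * L"
      using Lmean_norm[OF weight_linear S(1,4) x cont Im nKf[OF f]] by (simp add: N_def norm_mult norm_divide)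
    assume "x \<in> \<real>"
    then show "N f x \<in> \<real>"
      using Lmean_real[OF weight_linear S(1,4) x cont Im realKf[OF f] S(5)]
      unfolding N_def by (intro Reals_mult) auto
  qed
  have ImKN: "\<bar>Im (\<kappa> x + f x - N f x)\<bar> \<le> 11/28" and nKN: "cmod (\<kappa> x + f x - N f x) \<le> 110/7 * L"
    and realKN: "x \<in> \<real> \<Longrightarrow> \<kappa> x + f x - N f x \<in> \<real>" if f: "good f" and x: "x \<in> S" for f x
  proof -
    have "\<bar>Im (N f x)\<bar> \<le> 1/7" using N[OF f] x by blast
    then show "\<bar>Im (\<kappa> x + f x - N f x)\<bar> \<le> 11/28"
      using abs_triangle_ineq4[of "Im (\<kappa> x + f x)" "Im (N f x)"] ImKf[OF f x] by simp
    have "cmod (N f x) \<le> 40/7 * L" using N[OF f] x by blast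
    then show "cmod (\<kappa> x + f x - N f x) \<le> 110/7 * L"
      using norm_triangle_ineq4[of "\<kappa> x + f x" "N f x"] nKf[OF f x] by linarith
    show "x \<in> \<real> \<Longrightarrow> \<kappa> x + f x - N f x \<in> \<real>"
      using N[OF f] x realKf[OF f x] by (intro Reals_diff) auto
  qed
  have holKN: "(\<lambda>x. \<kappa> x + f x - N f x) holomorphic_on S" if "good f" for f
    using holKf[OF that] N[OF that] by (auto intro: holomorphic_on_diff)
  have \<Phi>: "good (\<Phi> f)" if f: "good f" for f
    unfolding good_def
  proof (intro conjI ballI impI)
    note cont = holomorphic_on_imp_continuous_on[OF holKN[OF f]]
    have Im: "\<bar>Im (\<kappa> x + f x - N f x)\<bar> \<le> 1/2" if "x \<in> S" for x using ImKN[OF f that] by linarith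
    show "\<Phi> f holomorphic_on S" unfolding \<Phi>_def
      by (intro holomorphic_intros Lmean_holomorphic weight_1 S holKN[OF f] Im)
    fix x assume x: "x \<in> S"
    show "\<bar>Im (\<Phi> f x)\<bar> \<le> 9/40"
      using Lmean_Im[OF weight_1 S(1,3) x cont ImKN[OF f]] by (simp add: \<Phi>_def)
    show "cmod (\<Phi> f x) \<le> 9 * L"
      using Lmean_norm[OF weight_1 S(1,3) x cont Im nKN[OF f]] L by (simp add: \<Phi>_def norm_mult norm_divide)
    assume "x \<in> \<real>"
    then show "\<Phi> f x \<in> \<real>"
      using Lmean_real[OF weight_1 S(1,3) x cont Im realKN[OF f]]
      unfolding \<Phi>_def by (intro Reals_mult) auto
  qed
  have lipN: "cmod (N f x - N g x) \<le> 4/7 * d"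
    if f: "good f" and g: "good g" and d: "\<And>x. x \<in> S \<Longrightarrow> cmod (f x - g x) \<le> d" and x: "x \<in> S" for f g d x
  proof -
    have "cmod (Lmean (\<lambda>s. 2 * s) b (\<lambda>x. \<kappa> x + f x) x - Lmean (\<lambda>s. 2 * s) b (\<lambda>x. \<kappa> x + g x) x) \<le> 8/7 * d"
    proof (rule Lmean_lipschitz[OF weight_linear S(1,4) x])
      fix x assume x: "x \<in> S"
      show "\<bar>Im (\<kappa> x + f x)\<bar> \<le> 1/2" "\<bar>Im (\<kappa> x + g x)\<bar> \<le> 1/2"
        using ImKf[OF f x] ImKf[OF g x] by linarith+
    qed (use d in \<open>auto intro!: holomorphic_on_imp_continuous_on holKf f g\<close>)
    moreover have e: "N f x - N g x = 1/2 * (Lmean (\<lambda>s. 2 * s) b (\<lambda>x. \<kappa> x + f x) x - Lmean (\<lambda>s. 2 * s) b (\<lambda>x. \<kappa> x + g x) x)"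
      by (simp add: N_def algebra_simps)
    ultimately show ?thesis unfolding e norm_mult by simp
  qed
  \<comment> \<open>The factor is \<open>1/2 * 8/7 * (1 + 4/7)\<close>: \<open>f\<close> enters
    directly and once more through \<open>N f\<close>.\<close>
  have lip: "cmod (\<Phi> f x - \<Phi> g x) \<le> 44/49 * d"
    if f: "good f" and g: "good g" and d: "\<And>x. x \<in> S \<Longrightarrow> cmod (f x - g x) \<le> d" and x: "x \<in> S" for f g d x
  proof -
    have 1: "cmod ((\<kappa> x + f x - N f x) - (\<kappa> x + g x - N g x)) \<le> 11/7 * d" if "x \<in> S" for x
    proof -
      have e: "(\<kappa> x + f x - N f x) - (\<kappa> x + g x - N g x) = (f x - g x) - (N f x - N g x)" by simp
      show ?thesis unfolding e
        using norm_triangle_ineq4[of "f x - g x" "N f x - N g x"] d[OF that] lipN[OF f g d that] by linarith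
    qed
    have "cmod (Lmean (\<lambda>_. 1) 0 (\<lambda>x. \<kappa> x + f x - N f x) x - Lmean (\<lambda>_. 1) 0 (\<lambda>x. \<kappa> x + g x - N g x) x) \<le> 8/7 * (11/7 * d)"
    proof (rule Lmean_lipschitz[OF weight_1 S(1,3) x])
      fix x assume x: "x \<in> S"
      show "\<bar>Im (\<kappa> x + f x - N f x)\<bar> \<le> 1/2" "\<bar>Im (\<kappa> x + g x - N g x)\<bar> \<le> 1/2"
        using ImKN[OF f x] ImKN[OF g x] by linarith+
    qed (use 1 in \<open>auto intro!: holomorphic_on_imp_continuous_on holKN f g\<close>)
    moreover have e: "\<Phi> f x - \<Phi> g x = 1/2 * (Lmean (\<lambda>_. 1) 0 (\<lambda>x. \<kappa> x + f x - N f x) x - Lmean (\<lambda>_. 1) 0 (\<lambda>x. \<kappa> x + g x - N g x) x)"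
      by (simp add: \<Phi>_def algebra_simps)
    ultimately show ?thesis unfolding e norm_mult by simp
  qed
  define F where "F = (\<lambda>n. (\<Phi> ^^ n) (\<lambda>_. 0))"
  have goodF: "good (F n)" for n
  proof (induction n)
    case 0 show ?case using L by (simp add: F_def good_def)
  next
    case (Suc n) then show ?case using \<Phi> by (simp add: F_def)
  qed
  have step: "\<forall>x\<in>S. cmod (F (Suc n) x - F n x) \<le> (44/49) ^ n * (9 * L)" for n
  proof (induction n)
    case 0 show ?case using goodF[of 1] by (simp add: F_def good_def)
  next
    case (Suc n)
    have "cmod (\<Phi> (F (Suc n)) x - \<Phi> (F n) x) \<le> 44/49 * ((44/49) ^ n * (9 * L))" if "x \<in> S" for x
      using Suc by (intro lip goodF that) auto
    then show ?case by (simp add: F_def)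
  qed
  \<comment> \<open>The limit is written as a telescoping series, so that the geometric bound on the
    steps gives uniform convergence by the M-test.\<close>
  define \<mu> where "\<mu> = (\<lambda>x. \<Sum>n. F (Suc n) x - F n x)"
  have "uniform_limit S (\<lambda>n x. \<Sum>i<n. F (Suc i) x - F i x) \<mu> sequentially"
    unfolding \<mu>_def
  proof (rule Weierstrass_m_test)
    show "summable (\<lambda>n. (44/49) ^ n * (9 * L) :: real)"
      by (intro summable_mult2 summable_geometric) auto
  qed (use step in auto)
  moreover have "(\<Sum>i<n. F (Suc i) x - F i x) = F n x" for n x
    by (subst sum_lessThan_telescope) (simp add: F_def)
  ultimately have ulim: "uniform_limit S F \<mu> sequentially" by simp
  have lim: "(\<lambda>n. F n x) \<longlonglongrightarrow> \<mu> x" if "x \<in> S" for x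
    using tendsto_uniform_limitI[OF ulim that] .
  \<comment> \<open>Membership of the limit precedes the fixed-point equation, because the Lipschitz
    bound for \<open>\<Phi>\<close> holds between good functions.\<close>
  have good: "good \<mu>"
    unfolding good_def
  proof (intro conjI ballI impI)
    show "\<mu> holomorphic_on S"
    proof (rule holomorphic_uniform_sequence[OF S(2)])
      show "F n holomorphic_on S" for n using goodF by (simp add: good_def)
      fix x assume "x \<in> S"
      then obtain d where "d > 0" "cball x d \<subseteq> S" using S(2) open_contains_cball by blast
      then show "\<exists>d>0. cball x d \<subseteq> S \<and> uniform_limit (cball x d) F \<mu> sequentially"
        using uniform_limit_on_subset[OF ulim] by blast
    qed
    fix x assume x: "x \<in> S"
    have "(\<lambda>n. \<bar>Im (F n x)\<bar>) \<longlonglongrightarrow> \<bar>Im (\<mu> x)\<bar>" by (intro tendsto_intros lim x)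
    then show "\<bar>Im (\<mu> x)\<bar> \<le> 9/40"
      by (rule LIMSEQ_le_const2) (use goodF x in \<open>auto simp: good_def\<close>)
    have "(\<lambda>n. cmod (F n x)) \<longlonglongrightarrow> cmod (\<mu> x)" by (intro tendsto_intros lim x)
    then show "cmod (\<mu> x) \<le> 9 * L"
      by (rule LIMSEQ_le_const2) (use goodF x in \<open>auto simp: good_def\<close>)
    assume "x \<in> \<real>"
    then show "\<mu> x \<in> \<real>"
      using goodF x by (intro closed_sequentially[OF closed_complex_Reals _ lim[OF x]]) (auto simp: good_def)
  qed
  have fix_point: "\<Phi> \<mu> x = \<mu> x" if x: "x \<in> S" for x
  proof -
    have "cmod (\<Phi> \<mu> x - \<mu> x) \<le> 0 + e" if e: "0 < e" for e
    proof -
      have "\<forall>\<^sub>F n in sequentially. \<forall>x\<in>S. dist (F n x) (\<mu> x) < e/2"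
        using uniform_limitD[OF ulim, of "e/2"] e by simp
      then obtain n where n: "\<And>m x. m \<ge> n \<Longrightarrow> x \<in> S \<Longrightarrow> dist (F m x) (\<mu> x) < e/2"
        unfolding eventually_sequentially by blast
      have "cmod (\<Phi> \<mu> x - \<Phi> (F n) x) \<le> 44/49 * (e/2)"
      proof (rule lip[OF good goodF _ x])
        fix y assume "y \<in> S"
        then show "cmod (\<mu> y - F n y) \<le> e/2" using n[of n y] by (simp add: dist_norm norm_minus_commute)
      qed
      moreover have "cmod (\<Phi> (F n) x - \<mu> x) < e/2" using n[of "Suc n" x] x by (simp add: F_def dist_norm)
      moreover have "cmod (\<Phi> \<mu> x - \<mu> x) \<le> cmod (\<Phi> \<mu> x - \<Phi> (F n) x) + cmod (\<Phi> (F n) x - \<mu> x)"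
        using norm_triangle_ineq[of "\<Phi> \<mu> x - \<Phi> (F n) x" "\<Phi> (F n) x - \<mu> x"] by simp
      ultimately show ?thesis using e by linarith
    qed
    then have "cmod (\<Phi> \<mu> x - \<mu> x) \<le> 0" by (rule field_le_epsilon)
    then show ?thesis by simp
  qed
  show thesis
  proof (rule that[of \<mu> "N \<mu>"])
    fix x assume x: "x \<in> S"
    show "exp (2 * N \<mu> x) = integral {0..1} (\<lambda>s. of_real (2 * s) * exp (\<kappa> (b + of_real s * (x - b)) + \<mu> (b + of_real s * (x - b))))"
    proof -
      have "exp (Lmean (\<lambda>s. 2 * s) b (\<lambda>x. \<kappa> x + \<mu> x) x) = integral {0..1} (\<lambda>s. of_real (2 * s) * exp (\<kappa> (b + of_real s * (x - b)) + \<mu> (b + of_real s * (x - b))))"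
      proof (rule exp_Lmean(1)[OF weight_linear S(1,4) x])
        show "\<bar>Im (\<kappa> x + \<mu> x)\<bar> \<le> 1/2" if "x \<in> S" for x
          using ImKf[OF good that] by linarith
      qed (intro holomorphic_on_imp_continuous_on holKf good)
      then show ?thesis by (simp add: N_def)
    qed
    show "exp (2 * \<mu> x) = integral {0..1} (\<lambda>s. exp (\<kappa> (of_real s * x) + \<mu> (of_real s * x) - N \<mu> (of_real s * x)))"
    proof -
      have "exp (Lmean (\<lambda>_. 1) 0 (\<lambda>x. \<kappa> x + \<mu> x - N \<mu> x) x) = integral {0..1} (\<lambda>s. of_real 1 * exp (\<kappa> (0 + of_real s * (x - 0)) + \<mu> (0 + of_real s * (x - 0)) - N \<mu> (0 + of_real s * (x - 0))))"
      proof (rule exp_Lmean(1)[OF weight_1 S(1,3) x])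
        show "\<bar>Im (\<kappa> x + \<mu> x - N \<mu> x)\<bar> \<le> 1/2" if "x \<in> S" for x
          using ImKN[OF good that] by linarith
      qed (intro holomorphic_on_imp_continuous_on holKN good)
      then show ?thesis using fix_point[OF x] by (simp add: \<Phi>_def field_simps)
    qed
    have "cmod (N \<mu> x) \<le> 40/7 * L" using N[OF good] x by blast
    then show "cmod (N \<mu> x) \<le> 6 * L" using L by linarith
  qed (use good N[OF good] in \<open>auto simp: good_def\<close>)
qed

section \<open>The pair \<open>exp \<mu>\<close>, \<open>\<rho>\<close> and the variable
  \<open>y = u^2\<close>\<close>

lemma segment_primitive:
  fixes G f :: "complex \<Rightarrow> complex"
  assumes S: "convex S" "z \<in> S" "x \<in> S" and G: "\<And>x. x \<in> S \<Longrightarrow> (G has_field_derivative f x) (at x)"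
  shows "((\<lambda>s. f (z + of_real s * (x - z)) * (x - z)) has_integral G x - G z) {0..1}"
proof -
  have "((\<lambda>s. f (z + of_real s * (x - z)) * (x - z)) has_integral
      G (z + of_real 1 * (x - z)) - G (z + of_real 0 * (x - z))) {0..1}"
  proof (rule fundamental_theorem_of_calculus[where f="\<lambda>s. G (z + of_real s * (x - z))"])
    fix s :: real assume "s \<in> {0..1}"
    then have "z + of_real s * (x - z) \<in> S" using S by (intro segment_in_convex) auto
    then have "(G has_field_derivative f (z + of_real s * (x - z))) (at (z + of_real s * (x - z)))" by (rule G)
    then have "((\<lambda>w. G (z + w * (x - z))) has_field_derivative f (z + of_real s * (x - z)) * (x - z)) (at (of_real s))"
      by (rule DERIV_chain2) (auto intro!: derivative_eq_intros)
    from has_vector_derivative_real_field[OF this]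
    show "((\<lambda>s. G (z + of_real s * (x - z))) has_vector_derivative f (z + of_real s * (x - z)) * (x - z)) (at s within {0..1})"
      by (rule has_vector_derivative_at_within)
  qed simp
  then show ?thesis by simp
qed

text \<open>The mean value theorem holds for real parts of complex functions. Rotating
  \<open>f\<close> by the conjugate of the chord \<open>d = z - x\<close> first makes the mean value
  \<open>|d|^2 Re (f' u)\<close>, which cannot vanish on a proper chord.\<close>

lemma inj_on_Re_deriv_pos:
  fixes f f' :: "complex \<Rightarrow> complex"
  assumes S: "convex S" and f: "\<And>x. x \<in> S \<Longrightarrow> (f has_field_derivative f' x) (at x)"
    and pos: "\<And>x. x \<in> S \<Longrightarrow> 0 < Re (f' x)"
  shows "inj_on f S"
proof (rule inj_onI, rule ccontr)
  fix x z assume xz: "x \<in> S" "z \<in> S" "f x = f z" "x \<noteq> z"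
  have seg: "closed_segment x z \<subseteq> S" using xz S by (simp add: closed_segment_subset)
  have "\<exists>u. u \<in> closed_segment x z \<and>
      Re (cnj (z - x) * f z) - Re (cnj (z - x) * f x) = Re (cnj (z - x) * f' u * (z - x))"
  proof (rule complex_mvt_line[where f="\<lambda>w. cnj (z - x) * f w" and f'="\<lambda>w. cnj (z - x) * f' w"])
    fix u assume "u \<in> closed_segment x z"
    then show "((\<lambda>w. cnj (z - x) * f w) has_field_derivative cnj (z - x) * f' u) (at u)"
      using seg by (intro DERIV_cmult f) auto
  qed
  then obtain u where u: "u \<in> closed_segment x z" "Re (cnj (z - x) * f' u * (z - x)) = 0"
    using xz by auto
  define d where "d = z - x"
  have e: "cnj d * f' u * d = of_real ((cmod d)\<^sup>2) * f' u"
    by (simp add: complex_norm_square mult_ac del: of_real_power)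
  have "Re (cnj d * f' u * d) = (cmod d)\<^sup>2 * Re (f' u)"
    unfolding e by (simp del: of_real_power)
  then have "d = 0 \<or> Re (f' u) = 0" using u(2) by (simp add: d_def)
  then have "Re (f' u) = 0" using xz(4) by (simp add: d_def)
  then show False using pos[of u] u(1) seg by auto
qed

text \<open>The integral equations are read backwards as statements about primitives, which show
  that \<open>x m^2\<close> and \<open>(x - b) \<rho>\<close> differ by a constant. The conclusion
  then no longer mentions integrals.\<close>

lemma canonical_pair:
  assumes S: "convex S" "open S" "0 \<in> S" "b \<in> S" "b \<in> \<real>" and L: "0 \<le> L"
    and \<kappa>: "\<kappa> holomorphic_on S" "\<And>x. x \<in> S \<Longrightarrow> \<bar>Im (\<kappa> x)\<bar> \<le> 1/40" "\<And>x. x \<in> S \<Longrightarrow> cmod (\<kappa> x) \<le> L"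
      "\<And>x. x \<in> S \<Longrightarrow> x \<in> \<real> \<Longrightarrow> \<kappa> x \<in> \<real>"
  defines "k \<equiv> \<lambda>x. exp (\<kappa> x)"
  obtains \<mu> \<rho> where "\<mu> holomorphic_on S" "\<rho> holomorphic_on S"
    "\<And>x. x \<in> S \<Longrightarrow> x \<in> \<real> \<Longrightarrow> \<mu> x \<in> \<real>"
    "\<And>x. x \<in> S \<Longrightarrow> x \<in> \<real> \<Longrightarrow> \<rho> x \<in> \<real> \<and> 0 < Re (\<rho> x)"
    "\<And>x. x \<in> S \<Longrightarrow> exp (- (6 * L)) \<le> cmod (\<rho> x) \<and> cmod (\<rho> x) \<le> exp (6 * L)"
    "\<And>x. x \<in> S \<Longrightarrow> ((\<lambda>x. x * (exp (\<mu> x))\<^sup>2) has_field_derivative k x * exp (\<mu> x) / \<rho> x) (at x)"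
    "\<And>x. x \<in> S \<Longrightarrow> x * (exp (\<mu> x))\<^sup>2 = b * (exp (\<mu> b))\<^sup>2 + (x - b) * \<rho> x"
    "inj_on (\<lambda>x. x * (exp (\<mu> x))\<^sup>2) S"
    "(\<rho> b)\<^sup>2 = k b * exp (\<mu> b)"
proof -
  obtain \<mu> \<nu> where mn: "\<mu> holomorphic_on S" "\<nu> holomorphic_on S"
    "\<And>x. x \<in> S \<Longrightarrow> \<bar>Im (\<mu> x)\<bar> \<le> 9/40"
    "\<And>x. x \<in> S \<Longrightarrow> x \<in> \<real> \<Longrightarrow> \<mu> x \<in> \<real>"
    "\<And>x. x \<in> S \<Longrightarrow> \<bar>Im (\<nu> x)\<bar> \<le> 1/7" "\<And>x. x \<in> S \<Longrightarrow> cmod (\<nu> x) \<le> 6 * L"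
    "\<And>x. x \<in> S \<Longrightarrow> x \<in> \<real> \<Longrightarrow> \<nu> x \<in> \<real>"
    and I\<nu>: "\<And>x. x \<in> S \<Longrightarrow> exp (2 * \<nu> x) = integral {0..1} (\<lambda>s. of_real (2 * s) * exp (\<kappa> (b + of_real s * (x - b)) + \<mu> (b + of_real s * (x - b))))"
    and I\<mu>: "\<And>x. x \<in> S \<Longrightarrow> exp (2 * \<mu> x) = integral {0..1} (\<lambda>s. exp (\<kappa> (of_real s * x) + \<mu> (of_real s * x) - \<nu> (of_real s * x)))"
    using canonical_fixed_point[OF S L \<kappa>] by blast
  define m where "m = (\<lambda>x. exp (\<mu> x))"
  define \<rho> where "\<rho> = (\<lambda>x. exp (\<nu> x))"
  have hol: "m holomorphic_on S" "\<rho> holomorphic_on S" "k holomorphic_on S"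
    unfolding m_def \<rho>_def k_def using mn \<kappa> by (auto intro!: holomorphic_intros)
  have nz: "\<rho> x \<noteq> 0" for x by (simp add: \<rho>_def)
  \<comment> \<open>Up to constants, the primitives \<open>P\<close> and \<open>Q\<close> will turn
    out to be \<open>x m^2\<close> and the square of \<open>(x - b) \<rho>\<close>.\<close>
  obtain P where P: "\<And>x. x \<in> S \<Longrightarrow> (P has_field_derivative k x * m x / \<rho> x) (at x within S)"
    using holomorphic_convex_primitive'[OF S(1,2), of "\<lambda>x. k x * m x / \<rho> x"]
    holomorphic_on_divide[OF holomorphic_on_mult[OF hol(3,1)] hol(2)] nz by auto
  then have P: "\<And>x. x \<in> S \<Longrightarrow> (P has_field_derivative k x * m x / \<rho> x) (at x)"
    using at_within_open[OF _ S(2)] by metis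
  have "(\<lambda>x. 2 * (x - b) * (k x * m x)) holomorphic_on S"
    using hol by (intro holomorphic_intros)
  then obtain Q where "\<And>x. x \<in> S \<Longrightarrow> (Q has_field_derivative 2 * (x - b) * (k x * m x)) (at x within S)"
    using holomorphic_convex_primitive'[OF S(1,2)] by blast
  then have Q: "\<And>x. x \<in> S \<Longrightarrow> (Q has_field_derivative 2 * (x - b) * (k x * m x)) (at x)"
    using at_within_open[OF _ S(2)] by metis
  have y_eq: "x * (m x)\<^sup>2 = P x - P 0" if x: "x \<in> S" for x
  proof -
    have "P x - P 0 = integral {0..1} (\<lambda>s. exp (\<kappa> (of_real s * x) + \<mu> (of_real s * x) - \<nu> (of_real s * x)) * x)"
      using segment_primitive[OF S(1,3) x P]
      by (simp add: integral_unique k_def m_def \<rho>_def exp_add exp_diff)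
    also have "\<dots> = exp (2 * \<mu> x) * x" unfolding I\<mu>[OF x] by simp
    finally show ?thesis unfolding m_def exp_double by (simp add: mult.commute)
  qed
  have Dy: "((\<lambda>x. x * (m x)\<^sup>2) has_field_derivative k x * m x / \<rho> x) (at x)" if x: "x \<in> S" for x
  proof -
    have "((\<lambda>x. P x - P 0) has_field_derivative k x * m x / \<rho> x) (at x)"
      using P[OF x] by (auto intro!: derivative_eq_intros)
    then show ?thesis
      by (rule has_field_derivative_transform_within_open[OF _ S(2) x]) (simp add: y_eq)
  qed
  have Y_eq: "((x - b) * \<rho> x)\<^sup>2 = Q x - Q b" if x: "x \<in> S" for x
  proof -
    have "Q x - Q b = integral {0..1} (\<lambda>s. 2 * (b + of_real s * (x - b) - b) *
        (k (b + of_real s * (x - b)) * m (b + of_real s * (x - b))) * (x - b))"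
      by (rule sym, rule integral_unique, rule segment_primitive[OF S(1,4) x Q])
    also have "\<dots> = integral {0..1} (\<lambda>s. (x - b)\<^sup>2 * (of_real (2 * s) * exp (\<kappa> (b + of_real s * (x - b)) + \<mu> (b + of_real s * (x - b)))))"
      by (rule integral_cong) (simp add: k_def m_def exp_add power2_eq_square algebra_simps)
    also have "\<dots> = (x - b)\<^sup>2 * exp (2 * \<nu> x)" unfolding I\<nu>[OF x] by simp
    finally show ?thesis unfolding \<rho>_def exp_double by (simp add: power_mult_distrib)
  qed
  \<comment> \<open>At \<open>x = b\<close> the segment degenerates, and the weighted mean of a
    constant is that constant.\<close>
  have \<rho>b: "(\<rho> b)\<^sup>2 = k b * m b"
  proof -
    have "(\<rho> b)\<^sup>2 = integral {0..1} (\<lambda>s. of_real (2 * s) * exp (\<kappa> b + \<mu> b))"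
      using I\<nu>[OF S(4)] unfolding \<rho>_def exp_double by simp
    also have "\<dots> = of_real 1 * exp (\<kappa> b + \<mu> b)"
    proof (intro integral_unique has_integral_mult_left has_integral_of_real)
      show "((\<lambda>s. 2 * s) has_integral 1) {0..1::real}"
        using weight_linear by (auto simp: weight_def intro!: has_integral_integrable_integral[THEN iffD2] integrable_continuous_interval)
    qed
    finally show ?thesis by (simp add: k_def m_def exp_add)
  qed
  have DY: "((\<lambda>x. (x - b) * \<rho> x) has_field_derivative k x * m x / \<rho> x) (at x)" if x: "x \<in> S" for x
  proof -
    have D\<rho>: "(\<rho> has_field_derivative deriv \<rho> x) (at x)"
      using hol(2) S(2) x holomorphic_derivI by blast
    have D: "((\<lambda>x. (x - b) * \<rho> x) has_field_derivative \<rho> x + (x - b) * deriv \<rho> x) (at x)"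
      by (auto intro!: derivative_eq_intros D\<rho>)
    \<comment> \<open>Away from \<open>b\<close> this is the derivative of the squared identity
      divided by \<open>2 (x - b)\<close>; at \<open>b\<close> that division is void and the known
      value of \<open>\<rho>\<close> at \<open>b\<close> takes its place.\<close>
    have "\<rho> x + (x - b) * deriv \<rho> x = k x * m x / \<rho> x"
    proof (cases "x = b")
      case True
      then show ?thesis using \<rho>b nz[of b] by (simp add: field_simps power2_eq_square)
    next
      case False
      have "((\<lambda>x. ((x - b) * \<rho> x)\<^sup>2) has_field_derivative 2 * ((x - b) * \<rho> x) * (\<rho> x + (x - b) * deriv \<rho> x)) (at x)"
        by (auto intro!: derivative_eq_intros D\<rho> simp: algebra_simps)
      moreover have "((\<lambda>x. ((x - b) * \<rho> x)\<^sup>2) has_field_derivative 2 * (x - b) * (k x * m x)) (at x)"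
      proof (rule has_field_derivative_transform_within_open[OF _ S(2) x])
        show "((\<lambda>x. Q x - Q b) has_field_derivative 2 * (x - b) * (k x * m x)) (at x)"
          using Q[OF x] by (auto intro!: derivative_eq_intros)
      qed (simp add: Y_eq)
      ultimately have "2 * ((x - b) * \<rho> x) * (\<rho> x + (x - b) * deriv \<rho> x) = 2 * (x - b) * (k x * m x)"
        by (rule DERIV_unique)
      then have "(2 * (x - b)) * (\<rho> x * (\<rho> x + (x - b) * deriv \<rho> x)) = (2 * (x - b)) * (k x * m x)"
        by (simp only: mult_ac)
      then have "\<rho> x * (\<rho> x + (x - b) * deriv \<rho> x) = k x * m x" using False by simp
      then show ?thesis using nz[of x] by (simp add: field_simps)
    qed
    with D show ?thesis by simp
  qed
  \<comment> \<open>Both functions have the same derivative. Their difference at \<open>b\<close> is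
    \<open>b m(b)^2\<close>, the future \<open>\<xi>\<close>, so this is the relation
    \<open>u^2 - \<xi> = (x - b) \<rho>\<close>.\<close>
  have "\<exists>c. \<forall>x\<in>S. x * (m x)\<^sup>2 - (x - b) * \<rho> x = c"
  proof (rule has_field_derivative_zero_constant[OF S(1)])
    fix x assume x: "x \<in> S"
    have "((\<lambda>x. x * (m x)\<^sup>2 - (x - b) * \<rho> x) has_field_derivative 0) (at x)"
      using DERIV_diff[OF Dy[OF x] DY[OF x]] by simp
    then show "((\<lambda>x. x * (m x)\<^sup>2 - (x - b) * \<rho> x) has_field_derivative 0) (at x within S)"
      by (rule has_field_derivative_at_within)
  qed
  then obtain c where c: "\<And>x. x \<in> S \<Longrightarrow> x * (m x)\<^sup>2 - (x - b) * \<rho> x = c" by blast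
  have split: "x * (m x)\<^sup>2 = b * (m b)\<^sup>2 + (x - b) * \<rho> x" if "x \<in> S" for x
    using c[OF that] c[OF S(4)] by (simp add: algebra_simps)
  have inj: "inj_on (\<lambda>x. x * (m x)\<^sup>2) S"
  proof (rule inj_on_Re_deriv_pos[OF S(1) Dy])
    fix x assume x: "x \<in> S"
    \<comment> \<open>The bounds add up to \<open>1/40 + 9/40 + 1/7 = 11/28\<close>, so
      \<open>y'\<close> stays in the right half-plane, which gives injectivity on the convex set
      \<open>S\<close>.\<close>
    have "\<bar>Im (\<kappa> x + \<mu> x - \<nu> x)\<bar> \<le> 1/2"
      using \<kappa>(2)[OF x] mn(3,5)[OF x] unfolding plus_complex.sel minus_complex.sel abs_le_iff by linarith
    from cos_ge_seven_eighths[OF this] have "0 < Re (exp (\<kappa> x + \<mu> x - \<nu> x))"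
      unfolding Re_exp by (intro mult_pos_pos) auto
    then show "0 < Re (k x * m x / \<rho> x)"
      by (simp add: k_def m_def \<rho>_def exp_add exp_diff)
  qed
  have bnd: "exp (- (6 * L)) \<le> cmod (\<rho> x) \<and> cmod (\<rho> x) \<le> exp (6 * L)" if "x \<in> S" for x
    using mn(6)[OF that] abs_Re_le_cmod[of "\<nu> x"] by (auto simp: \<rho>_def)
  have pos: "\<rho> x \<in> \<real> \<and> 0 < Re (\<rho> x)" if "x \<in> S" "x \<in> \<real>" for x
  proof -
    have "\<nu> x \<in> \<real>" using mn(7) that by blast
    then obtain r where "\<nu> x = of_real r" by (auto elim: Reals_cases)
    then have "\<rho> x = of_real (exp r)" by (simp add: \<rho>_def exp_of_real)
    then show ?thesis by simp
  qed
  show thesis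
    by (rule that[of \<mu> \<rho>]) (use mn hol bnd pos Dy split inj \<rho>b in \<open>auto simp: m_def\<close>)
qed

section \<open>Square roots and division by a zero\<close>

lemma open_sqrt_preimage: "open S \<Longrightarrow> open {\<tau>::complex. \<tau>\<^sup>2 \<in> S}"
  using open_vimage[of S "\<lambda>\<tau>::complex. \<tau>\<^sup>2"] by (simp add: vimage_def continuous_intros)

text \<open>Outside the disc of radius \<open>d\<close> the quotient is at most \<open>M / d\<close>
  directly, and inside by the maximum principle from the boundary circle. The bound depends on the
  room around the zero and not on its position, hence it survives when the zero moves.\<close>

lemma holomorphic_division:
  assumes S: "open S" and f: "f holomorphic_on S" "f z = 0" "\<And>x. x \<in> S \<Longrightarrow> cmod (f x) \<le> M"
    and d: "0 < d" "cball z d \<subseteq> S"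
  obtains l where "l holomorphic_on S" "\<And>x. x \<in> S \<Longrightarrow> f x = (x - z) * l x" "\<And>x. x \<in> S \<Longrightarrow> cmod (l x) \<le> M / d"
proof -
  define l where "l = (\<lambda>x. if x = z then deriv f z else (f x - f z) / (x - z))"
  have hol: "l holomorphic_on S"
    unfolding l_def using f(1) S by (rule pole_lemma_open)
  have fac: "f x = (x - z) * l x" for x by (simp add: l_def f(2))
  have outer: "cmod (l x) \<le> M / d" if x: "x \<in> S" "d \<le> cmod (x - z)" for x
  proof -
    have "0 < cmod (x - z)" using x d(1) by linarith
    have "cmod (l x) = cmod (f x) / cmod (x - z)"
      using fac[of x] \<open>0 < cmod (x - z)\<close> by (simp add: norm_mult)
    also have "\<dots> \<le> M / d"
      using f(3)[OF x(1)] x(2) d(1) by (intro frac_le) (auto intro: order_trans[OF norm_ge_zero])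
    finally show ?thesis .
  qed
  have "cmod (l x) \<le> M / d" if x: "x \<in> S" for x
  proof (cases "d \<le> cmod (x - z)")
    case False
    show ?thesis
    proof (rule maximum_modulus_frontier[where f=l and S="ball z d"])
      show "l holomorphic_on interior (ball z d)"
        using d ball_subset_cball[of z d] by (intro holomorphic_on_subset[OF hol]) auto
      show "continuous_on (closure (ball z d)) l"
        using d by (auto intro: holomorphic_on_imp_continuous_on holomorphic_on_subset[OF hol])
      show "cmod (l w) \<le> M / d" if "w \<in> frontier (ball z d)" for w
        using that d by (intro outer) (auto simp: dist_norm norm_minus_commute subset_iff)
      show "x \<in> ball z d" using False by (simp add: dist_norm norm_minus_commute)
    qed auto
  qed (use outer x in auto)
  then show thesis using that hol fac by blast
qed

subsection \<open>The canonical map\<close>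

text \<open>The output of \<open>canonical_pair\<close> together with a phase whose derivative it
  factors. The sign \<open>\<sigma>\<close> is kept apart so that \<open>\<kappa>\<close> is the
  logarithm of a factor that is positive on the real axis.\<close>

locale cubic_chart =
  fixes S :: "complex set" and b \<sigma> L :: real and \<kappa> \<mu> \<rho> F :: "complex \<Rightarrow> complex"
  assumes S: "convex S" "open S" "0 \<in> S" "of_real b \<in> S"
    and \<sigma>: "\<sigma> = 1 \<or> \<sigma> = - 1"
    and \<kappa>: "\<kappa> holomorphic_on S" "\<And>x. x \<in> S \<Longrightarrow> x \<in> \<real> \<Longrightarrow> \<kappa> x \<in> \<real>"
    and \<kappa>_bound: "\<And>x. x \<in> S \<Longrightarrow> cmod (\<kappa> x) \<le> L"
    and hol: "\<mu> holomorphic_on S" "\<rho> holomorphic_on S"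
    and \<mu>_real: "\<And>x. x \<in> S \<Longrightarrow> x \<in> \<real> \<Longrightarrow> \<mu> x \<in> \<real>"
    and \<rho>_pos: "\<And>x. x \<in> S \<Longrightarrow> x \<in> \<real> \<Longrightarrow> \<rho> x \<in> \<real> \<and> 0 < Re (\<rho> x)"
    and \<rho>_bound: "\<And>x. x \<in> S \<Longrightarrow> exp (- (6 * L)) \<le> cmod (\<rho> x) \<and> cmod (\<rho> x) \<le> exp (6 * L)"
    and y_deriv: "\<And>x. x \<in> S \<Longrightarrow> ((\<lambda>x. x * (exp (\<mu> x))\<^sup>2) has_field_derivative exp (\<kappa> x) * exp (\<mu> x) / \<rho> x) (at x)"
    and y_eq: "\<And>x. x \<in> S \<Longrightarrow> x * (exp (\<mu> x))\<^sup>2 = of_real b * (exp (\<mu> (of_real b)))\<^sup>2 + (x - of_real b) * \<rho> x"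
    and y_inj: "inj_on (\<lambda>x. x * (exp (\<mu> x))\<^sup>2) S"
    and \<rho>_b: "(\<rho> (of_real b))\<^sup>2 = exp (\<kappa> (of_real b)) * exp (\<mu> (of_real b))"
    and F: "F holomorphic_on {\<tau>. \<tau>\<^sup>2 \<in> S}" "F 0 = 0"
    and F_deriv: "\<And>\<tau>. \<tau>\<^sup>2 \<in> S \<Longrightarrow> deriv F \<tau> = of_real \<sigma> * (\<tau>\<^sup>2 - of_real b) * exp (\<kappa> (\<tau>\<^sup>2))"
begin

definition V :: "complex set" where "V = {\<tau>. \<tau>\<^sup>2 \<in> S}"

definition u :: "complex \<Rightarrow> complex" where "u \<tau> = of_real \<sigma> * \<tau> * exp (\<mu> (\<tau>\<^sup>2))"

text \<open>As \<open>\<mu>\<close> is real at the real point \<open>b\<close>, taking the real part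
  loses nothing. The sign of \<open>\<xi>\<close> is that of \<open>b\<close>, hence negative for
  imaginary stationary points away from \<open>0\<close>.\<close>

definition \<xi> :: real where "\<xi> = b * (exp (Re (\<mu> (of_real b))))\<^sup>2"

lemma \<sigma>_simps [simp]: "\<sigma> * \<sigma> = 1" "\<sigma>\<^sup>2 = 1" "\<sigma> \<noteq> 0" "\<bar>\<sigma>\<bar> = 1"
  using \<sigma> by auto

lemma \<rho>_nz: "x \<in> S \<Longrightarrow> \<rho> x \<noteq> 0"
  using \<rho>_bound[of x] by (metis exp_gt_zero norm_zero not_less)

lemma open_V: "open V"
  unfolding V_def by (rule open_sqrt_preimage[OF S(2)])

lemma V_scale: "\<tau> \<in> V \<Longrightarrow> 0 \<le> s \<Longrightarrow> s \<le> 1 \<Longrightarrow> of_real s * \<tau> \<in> V"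
  using segment_in_convex[OF S(1,3), of "\<tau>\<^sup>2" "s\<^sup>2"]
  by (simp add: V_def power_mult_distrib power_le_one)

lemma V_uminus: "- \<tau> \<in> V \<longleftrightarrow> \<tau> \<in> V"
  by (simp add: V_def)

lemma comp_square_holomorphic: "f holomorphic_on S \<Longrightarrow> (\<lambda>\<tau>. f (\<tau>\<^sup>2)) holomorphic_on V"
  by (rule holomorphic_on_compose_gen[of "\<lambda>\<tau>. \<tau>\<^sup>2" V f S, unfolded o_def])
    (auto simp: V_def intro!: holomorphic_intros)

lemma u_holomorphic: "u holomorphic_on V"
  unfolding u_def[abs_def] by (intro holomorphic_intros comp_square_holomorphic hol)

lemma u_uminus: "u (- \<tau>) = - u \<tau>"
  by (simp add: u_def)

lemma u_square: "(u \<tau>)\<^sup>2 = \<tau>\<^sup>2 * (exp (\<mu> (\<tau>\<^sup>2)))\<^sup>2"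
  by (simp add: u_def power_mult_distrib flip: of_real_power)

lemma \<xi>_eq: "of_real \<xi> = of_real b * (exp (\<mu> (of_real b)))\<^sup>2"
proof -
  have "\<mu> (of_real b) = of_real (Re (\<mu> (of_real b)))"
    using \<mu>_real[OF S(4)] by simp
  then have "exp (\<mu> (of_real b)) = of_real (exp (Re (\<mu> (of_real b))))"
    by (metis exp_of_real)
  then show ?thesis by (simp add: \<xi>_def)
qed

text \<open>Injectivity of \<open>y\<close> determines \<open>\<tau>\<close> up to sign, and the odd
  factor \<open>\<tau>\<close> of \<open>u\<close> fixes the sign.\<close>

lemma u_inj: "inj_on u V"
proof (rule inj_onI)
  fix \<tau> \<tau>' assume V: "\<tau> \<in> V" "\<tau>' \<in> V" and e: "u \<tau> = u \<tau>'"
  then have "\<tau>\<^sup>2 = \<tau>'\<^sup>2"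
    using inj_onD[OF y_inj, of "\<tau>\<^sup>2" "\<tau>'\<^sup>2"] u_square[of \<tau>] u_square[of \<tau>'] by (simp add: V_def)
  with e show "\<tau> = \<tau>'" by (simp add: u_def)
qed

text \<open>The product rule gives \<open>y' = m (m + 2 x m \<mu>')\<close> and
  \<open>u' = \<sigma> (m + 2 x m \<mu>')\<close>. So \<open>y'\<close> is divided by
  \<open>m\<close> and never by \<open>\<tau>\<close>, and the origin needs no separate
  case.\<close>

lemma u_deriv:
  assumes \<tau>: "\<tau> \<in> V"
  shows "(u has_field_derivative of_real \<sigma> * exp (\<kappa> (\<tau>\<^sup>2)) / \<rho> (\<tau>\<^sup>2)) (at \<tau>)"
proof -
  have x: "\<tau>\<^sup>2 \<in> S" using \<tau> by (simp add: V_def)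
  have D\<mu>: "(\<mu> has_field_derivative deriv \<mu> (\<tau>\<^sup>2)) (at (\<tau>\<^sup>2))"
    using hol(1) S(2) x holomorphic_derivI by blast
  let ?m = "exp (\<mu> (\<tau>\<^sup>2))"
  have "((\<lambda>x. x * (exp (\<mu> x))\<^sup>2) has_field_derivative ?m * (?m + 2 * \<tau>\<^sup>2 * (?m * deriv \<mu> (\<tau>\<^sup>2)))) (at (\<tau>\<^sup>2))"
    by (rule derivative_eq_intros D\<mu> refl)+ (simp add: power2_eq_square algebra_simps)
  from DERIV_unique[OF this y_deriv[OF x]]
  have "?m * (?m + 2 * \<tau>\<^sup>2 * (?m * deriv \<mu> (\<tau>\<^sup>2))) = ?m * (exp (\<kappa> (\<tau>\<^sup>2)) / \<rho> (\<tau>\<^sup>2))"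
    by (simp add: mult_ac)
  then have e: "?m + 2 * \<tau>\<^sup>2 * (?m * deriv \<mu> (\<tau>\<^sup>2)) = exp (\<kappa> (\<tau>\<^sup>2)) / \<rho> (\<tau>\<^sup>2)"
    by (metis exp_not_eq_zero mult_left_cancel)
  have "((\<lambda>\<tau>. \<mu> (\<tau>\<^sup>2)) has_field_derivative deriv \<mu> (\<tau>\<^sup>2) * (2 * \<tau>)) (at \<tau>)"
    by (rule DERIV_chain2[where g="\<lambda>\<tau>. \<tau>\<^sup>2", OF D\<mu>]) (auto intro!: derivative_eq_intros)
  then have "(u has_field_derivative of_real \<sigma> * (?m + 2 * \<tau>\<^sup>2 * (?m * deriv \<mu> (\<tau>\<^sup>2)))) (at \<tau>)"
    unfolding u_def[abs_def]
    by (auto intro!: derivative_eq_intros simp: power2_eq_square algebra_simps)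
  then show ?thesis unfolding e by simp
qed

lemma F_has_deriv:
  assumes "\<tau> \<in> V"
  shows "(F has_field_derivative of_real \<sigma> * (\<tau>\<^sup>2 - of_real b) * exp (\<kappa> (\<tau>\<^sup>2))) (at \<tau>)"
proof -
  have "(F has_field_derivative deriv F \<tau>) (at \<tau>)"
    using F(1) open_V assms holomorphic_derivI unfolding V_def by blast
  then show ?thesis using F_deriv assms by (simp add: V_def)
qed

lemma u_square_minus_\<xi>: "\<tau> \<in> V \<Longrightarrow> (u \<tau>)\<^sup>2 - of_real \<xi> = (\<tau>\<^sup>2 - of_real b) * \<rho> (\<tau>\<^sup>2)"
  using y_eq[of "\<tau>\<^sup>2"] unfolding u_square \<xi>_eq by (simp add: V_def)

text \<open>Both sides vanish at \<open>0\<close> and have the same derivative, as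
  \<open>(u^2 - \<xi>) u' = (x - b) \<rho> * \<sigma> k / \<rho>\<close>. The comparison runs along
  the segment from \<open>0\<close>, since \<open>V\<close> is starlike about \<open>0\<close> but
  may fail to be convex.\<close>

lemma cubic:
  assumes \<tau>: "\<tau> \<in> V"
  shows "F \<tau> = u \<tau> ^ 3 / 3 - of_real \<xi> * u \<tau>"
proof -
  have seg: "closed_segment 0 \<tau> \<subseteq> V"
    using V_scale[OF \<tau>] by (auto simp: closed_segment_def scaleR_conv_of_real)
  have "\<exists>c. \<forall>z\<in>closed_segment 0 \<tau>. u z ^ 3 / 3 - of_real \<xi> * u z - F z = c"
  proof (rule has_field_derivative_zero_constant)
    fix z assume "z \<in> closed_segment 0 \<tau>"
    then have z: "z \<in> V" using seg by blast
    have zS: "z\<^sup>2 \<in> S" using z by (simp add: V_def)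
    have "((\<lambda>z. u z ^ 3 / 3 - of_real \<xi> * u z - F z) has_field_derivative
        ((u z)\<^sup>2 - of_real \<xi>) * (of_real \<sigma> * exp (\<kappa> (z\<^sup>2)) / \<rho> (z\<^sup>2)) - of_real \<sigma> * (z\<^sup>2 - of_real b) * exp (\<kappa> (z\<^sup>2))) (at z)"
      by (auto intro!: derivative_eq_intros u_deriv[OF z] F_has_deriv[OF z] simp: algebra_simps diff_divide_distrib)
    then have "((\<lambda>z. u z ^ 3 / 3 - of_real \<xi> * u z - F z) has_field_derivative 0) (at z)"
      unfolding u_square_minus_\<xi>[OF z] using \<rho>_nz[OF zS] by (simp add: algebra_simps)
    then show "((\<lambda>z. u z ^ 3 / 3 - of_real \<xi> * u z - F z) has_field_derivative 0) (at z within closed_segment 0 \<tau>)"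
      by (rule has_field_derivative_at_within)
  qed simp
  then obtain c where c: "\<And>z. z \<in> closed_segment 0 \<tau> \<Longrightarrow> u z ^ 3 / 3 - of_real \<xi> * u z - F z = c" by blast
  have "c = 0" using c[of 0] F(2) by (simp add: u_def)
  then show ?thesis using c[of \<tau>] by simp
qed

lemma u_real:
  assumes "\<tau> \<in> V" "\<tau> \<in> \<real>" shows "u \<tau> \<in> \<real>"
proof -
  have "\<mu> (\<tau>\<^sup>2) \<in> \<real>" using assms by (intro \<mu>_real) (auto simp: V_def intro: Reals_power)
  then have "exp (\<mu> (\<tau>\<^sup>2)) \<in> \<real>" by (auto simp: exp_of_real elim!: Reals_cases)
  then show ?thesis unfolding u_def using assms by (intro Reals_mult) auto
qed

text \<open>The orientation \<open>\<sigma>\<close> becomes visible as the sign of \<open>q\<close>,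
  in terms of which the leading coefficient is stated.\<close>

lemma sgn_u:
  assumes "of_real T \<in> V" "0 < T" shows "sgn (Re (u (of_real T))) = \<sigma>"
proof -
  have "\<mu> (of_real (T\<^sup>2)) \<in> \<real>" using assms by (intro \<mu>_real) (auto simp: V_def)
  then obtain r where "\<mu> (of_real (T\<^sup>2)) = of_real r" by (auto elim: Reals_cases)
  then have "u (of_real T) = of_real (\<sigma> * T * exp r)" by (simp add: u_def exp_of_real)
  then show ?thesis using assms \<sigma> by (auto simp: sgn_mult)
qed

lemma sqrt_b_in_V: "ts\<^sup>2 = of_real b \<Longrightarrow> ts \<in> V"
  using S by (simp add: V_def)

lemma u_ts: "ts\<^sup>2 = of_real b \<Longrightarrow> (u ts)\<^sup>2 = of_real \<xi>"
  by (simp add: u_square \<xi>_eq)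

text \<open>At a stationary point \<open>u^2 = \<xi>\<close>, so \<open>3/2 F = - \<xi> u\<close>,
  with square \<open>\<xi>^3\<close>; the odd cube root recovers \<open>\<xi>\<close> for either
  sign.\<close>

lemma pw_xi_eq:
  assumes "ts\<^sup>2 = of_real b" shows "pw_xi F ts = \<xi>"
proof -
  have "F ts = u ts * ((u ts)\<^sup>2 / 3 - of_real \<xi>)"
    using cubic[OF sqrt_b_in_V[OF assms]] by (simp add: power2_eq_square power3_eq_cube algebra_simps)
  then have "3 / 2 * F ts = - of_real \<xi> * u ts" unfolding u_ts[OF assms] by simp
  then have "(3 / 2 * F ts)\<^sup>2 = of_real (\<xi> ^ 3)"
    using u_ts[OF assms] by (simp add: power_mult_distrib power2_eq_square power3_eq_cube)
  then show ?thesis by (simp add: pw_xi_def odd_real_root_power_cancel del: of_real_power)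
qed

lemma inverse_exists:
  obtains g where "g holomorphic_on u ` V" "open (u ` V)" "\<And>\<tau>. \<tau> \<in> V \<Longrightarrow> g (u \<tau>) = \<tau>"
    "\<And>\<tau>. \<tau> \<in> V \<Longrightarrow> deriv g (u \<tau>) = of_real \<sigma> * \<rho> (\<tau>\<^sup>2) / exp (\<kappa> (\<tau>\<^sup>2))"
proof -
  obtain g where g: "g holomorphic_on u ` V" "\<And>z. z \<in> V \<Longrightarrow> deriv u z * deriv g (u z) = 1" "\<And>z. z \<in> V \<Longrightarrow> g (u z) = z"
    using holomorphic_has_inverse[OF u_holomorphic open_V u_inj] by blast
  have "open (u ` V)" using open_mapping_thm3[OF u_holomorphic open_V u_inj] .
  moreover have "deriv g (u \<tau>) = of_real \<sigma> * \<rho> (\<tau>\<^sup>2) / exp (\<kappa> (\<tau>\<^sup>2))" if \<tau>: "\<tau> \<in> V" for \<tau>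
  proof -
    have "\<rho> (\<tau>\<^sup>2) \<noteq> 0" using \<tau> \<rho>_nz by (simp add: V_def)
    moreover have "of_real \<sigma> * (of_real \<sigma> :: complex) = 1" by (simp flip: of_real_mult)
    ultimately show ?thesis
      using g(2)[OF \<tau>] DERIV_imp_deriv[OF u_deriv[OF \<tau>]]
      by (simp add: field_simps) (metis mult.assoc mult.commute mult.left_neutral)
  qed
  ultimately show thesis using that g by blast
qed

end

text \<open>The jump of \<open>csqrt\<close> across the negative axis only swaps the two roots,
  which an even \<open>A\<close> cannot see.\<close>

lemma even_holomorphic_descends:
  assumes S: "open S" and A: "A holomorphic_on {\<tau>. \<tau>\<^sup>2 \<in> S}"
    and even: "\<And>\<tau>. \<tau>\<^sup>2 \<in> S \<Longrightarrow> A (- \<tau>) = A \<tau>"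
  shows "(\<lambda>x. A (csqrt x)) holomorphic_on S" and "\<And>\<tau>. \<tau>\<^sup>2 \<in> S \<Longrightarrow> A (csqrt (\<tau>\<^sup>2)) = A \<tau>"
proof -
  have eq: "A \<tau> = A \<tau>'" if "\<tau>\<^sup>2 = \<tau>'\<^sup>2" "\<tau>\<^sup>2 \<in> S" for \<tau> \<tau>'
    using that even[of \<tau>'] by (auto simp: power2_eq_iff)
  show "\<And>\<tau>. \<tau>\<^sup>2 \<in> S \<Longrightarrow> A (csqrt (\<tau>\<^sup>2)) = A \<tau>" by (rule eq) auto
  have openV: "open {\<tau>::complex. \<tau>\<^sup>2 \<in> S}" by (rule open_sqrt_preimage[OF S])
  \<comment> \<open>Only the branch point \<open>0\<close> has no local branch of the root;
    continuity makes it a removable singularity.\<close>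
  show "(\<lambda>x. A (csqrt x)) holomorphic_on S"
  proof (rule no_isolated_singularity'[where K="{0} \<inter> S"])
    fix z assume "z \<in> {0} \<inter> S"
    then have z: "z = 0" "0 \<in> S" by auto
    have "((\<lambda>x. cmod (csqrt x)) \<longlongrightarrow> 0) (at 0 within S)"
      by (auto intro!: tendsto_eq_intros)
    then have "((\<lambda>x. csqrt x) \<longlongrightarrow> 0) (at 0 within S)"
      by (rule tendsto_norm_zero_cancel)
    moreover have "isCont A 0"
      by (rule continuous_on_interior[OF holomorphic_on_imp_continuous_on[OF A]])
        (use openV z in \<open>simp add: interior_open\<close>)
    ultimately have "((\<lambda>x. A (csqrt x)) \<longlongrightarrow> A 0) (at 0 within S)"
      by (rule isCont_tendsto_compose[rotated])
    then show "((\<lambda>x. A (csqrt x)) \<longlongrightarrow> A (csqrt z)) (at z within S)" using z by simp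
  next
    show "(\<lambda>x. A (csqrt x)) holomorphic_on S - {0} \<inter> S"
    proof (rule holomorphic_onI)
      fix x0 assume "x0 \<in> S - {0} \<inter> S"
      then have x0: "x0 \<in> S" "x0 \<noteq> 0" by auto
      \<comment> \<open>Near \<open>x0\<close> the product \<open>csqrt x0 * csqrt (x / x0)\<close>
        is a holomorphic branch of the root, with its cut rotated away from
        \<open>x0\<close>.\<close>
      define N where "N = S \<inter> (\<lambda>x. x / x0) -` (- \<real>\<^sub>\<le>\<^sub>0)"
      have "open ((\<lambda>x. x / x0) -` (- \<real>\<^sub>\<le>\<^sub>0))"
        using x0 by (intro open_vimage continuous_intros) auto
      then have N: "open N" "x0 \<in> N"
        using x0 S by (auto simp: N_def)
      have sq: "(csqrt x0 * csqrt (x / x0))\<^sup>2 = x" for x using x0 by (simp add: power_mult_distrib)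
      have "(\<lambda>x. A (csqrt x0 * csqrt (x / x0))) holomorphic_on N"
      proof (rule holomorphic_on_compose_gen[OF _ A, unfolded o_def])
        show "(\<lambda>x. csqrt x0 * csqrt (x / x0)) holomorphic_on N"
          unfolding N_def using x0 by (intro holomorphic_intros) auto
      qed (auto simp: sq N_def)
      then have "(\<lambda>x. A (csqrt x0 * csqrt (x / x0))) field_differentiable (at x0)"
        by (rule holomorphic_on_imp_differentiable_at) (use N in auto)
      then obtain D where "((\<lambda>x. A (csqrt x0 * csqrt (x / x0))) has_field_derivative D) (at x0)"
        unfolding field_differentiable_def by blast
      then have "((\<lambda>x. A (csqrt x)) has_field_derivative D) (at x0)"
      proof (rule has_field_derivative_transform_within_open[OF _ N])
        fix x assume "x \<in> N"
        then show "A (csqrt x0 * csqrt (x / x0)) = A (csqrt x)"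
          by (intro eq) (simp_all add: sq N_def)
      qed
      then show "(\<lambda>x. A (csqrt x)) field_differentiable (at x0 within S - {0} \<inter> S)"
        unfolding field_differentiable_def by (metis has_field_derivative_at_within)
    qed
  qed (simp_all add: S)
qed

subsection \<open>The remainder\<close>

text \<open>The last factor bounds \<open>h\<close>, the amplitude divided by \<open>F'\<close>.
  Integration by parts costs two boundary values and an interior term
  \<open>2 |\<tau>| |h'|\<close>, where \<open>|h'|\<close> is at most that bound over
  \<open>\<delta>\<close>, integrated over length \<open>2 T\<close>. Only bounds enter, so nearby
  points can share the constant.\<close>

definition remainder_const :: "real \<Rightarrow> real \<Rightarrow> real \<Rightarrow> real \<Rightarrow> real" where
  "remainder_const T \<delta> L M = (2 + 4 * T\<^sup>2 / \<delta>) * ((M + M * exp (7 * L) * exp (7 * L)) / \<delta> * exp L)"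

context cubic_chart
begin

lemma F_real:
  assumes "\<tau> \<in> V" "\<tau> \<in> \<real>" shows "F \<tau> \<in> \<real>"
  unfolding cubic[OF assms(1)] using u_real[OF assms] by (intro Reals_diff Reals_mult Reals_divide Reals_power) auto

lemma exp_F_norm:
  assumes "\<tau> \<in> V" "\<tau> \<in> \<real>" shows "cmod (exp (\<i> * of_real chi * F \<tau>)) = 1"
proof -
  obtain r where "F \<tau> = of_real r" using F_real[OF assms] by (rule Reals_cases)
  then show ?thesis by simp
qed

lemma exp_\<kappa>_bound: "x \<in> S \<Longrightarrow> exp (- L) \<le> cmod (exp (\<kappa> x)) \<and> cmod (exp (\<kappa> x)) \<le> exp L"
  using \<kappa>_bound[of x] abs_Re_le_cmod[of "\<kappa> x"] by auto

lemma real_interval_in_V: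
  assumes "\<And>r. 0 \<le> r \<Longrightarrow> r \<le> T\<^sup>2 \<Longrightarrow> of_real r \<in> S" "t \<in> {-T..T}"
  shows "complex_of_real t \<in> V"
proof -
  have "t\<^sup>2 \<le> T\<^sup>2" using assms(2) by (auto simp: abs_le_square_iff[symmetric])
  then show ?thesis using assms(1)[of "t\<^sup>2"] by (simp add: V_def)
qed

text \<open>The choice of \<open>A0\<close> makes \<open>A - A0 u'\<close>, as a function of
  \<open>x = \<tau>^2\<close>, vanish at the single point \<open>b\<close>. Dividing by
  \<open>x - b\<close> removes both stationary points at once, also when they coincide, and the
  quotient by \<open>F'\<close> is holomorphic with explicit bounds.\<close>

lemma remainder_bound:
  assumes T: "0 < T" and \<delta>: "0 < \<delta>"
    and A: "A holomorphic_on V" "\<And>\<tau>. \<tau> \<in> V \<Longrightarrow> A (- \<tau>) = A \<tau>" "\<And>\<tau>. \<tau> \<in> V \<Longrightarrow> cmod (A \<tau>) \<le> M"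
    and room: "\<And>r. 0 \<le> r \<Longrightarrow> r \<le> T\<^sup>2 \<Longrightarrow> cball (of_real r) \<delta> \<subseteq> S" "cball (of_real b) \<delta> \<subseteq> S"
    and ts: "ts\<^sup>2 = of_real b" and chi: "0 < chi"
  defines "A0 \<equiv> A ts * (of_real \<sigma> * \<rho> (of_real b) / exp (\<kappa> (of_real b)))"
  shows "cmod (integral {-T..T} (\<lambda>t. (A (of_real t) - A0 * (of_real \<sigma> * exp (\<kappa> ((of_real t)\<^sup>2)) / \<rho> ((of_real t)\<^sup>2)))
      * exp (\<i> * of_real chi * F (of_real t)))) \<le> remainder_const T \<delta> L M / chi"
proof -
  let ?b = "complex_of_real b"
  have \<sigma>1: "of_real \<sigma> * (of_real \<sigma> :: complex) = 1" by (simp flip: of_real_mult)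
  have rS: "of_real r \<in> S" if "0 \<le> r" "r \<le> T\<^sup>2" for r
    using room(1)[OF that] \<delta> by (meson centre_in_cball less_imp_le subsetD)
  have tV: "complex_of_real t \<in> V" if "t \<in> {-T..T}" for t
    using real_interval_in_V[OF rS that] .
  define A' where "A' = (\<lambda>x. A (csqrt x))"
  have A': "A' holomorphic_on S" "\<And>\<tau>. \<tau> \<in> V \<Longrightarrow> A' (\<tau>\<^sup>2) = A \<tau>"
    using even_holomorphic_descends[OF S(2), of A] A unfolding V_def A'_def by auto
  have A'_le: "cmod (A' x) \<le> M" if "x \<in> S" for x
    using A(3)[of "csqrt x"] that by (simp add: A'_def V_def)
  have M0: "0 \<le> M" using A'_le[OF S(3)] norm_ge_zero order_trans by blast
  \<comment> \<open>\<open>K (\<tau>^2)\<close> is \<open>u'\<close>, so \<open>1 / K\<close> at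
    \<open>b\<close> is the derivative of the inverse map at the stationary values.\<close>
  define K where "K = (\<lambda>x. of_real \<sigma> * exp (\<kappa> x) / \<rho> x)"
  define B where "B = (\<lambda>x. A' x - A0 * K x)"
  have Bhol: "B holomorphic_on S"
    unfolding B_def K_def using A'(1) \<kappa>(1) hol(2) \<rho>_nz by (intro holomorphic_intros) auto
  have Bb: "B ?b = 0"
  proof -
    have "A0 * K ?b = A ts * (of_real \<sigma> * of_real \<sigma>)"
      using \<rho>_nz[OF S(4)] by (simp add: A0_def K_def)
    also have "\<dots> = A' ?b" using A'(2)[OF sqrt_b_in_V[OF ts]] ts \<sigma>1 by simp
    finally show ?thesis by (simp add: B_def)
  qed
  have Kle: "cmod (K x) \<le> exp (7 * L)" and Kge: "cmod (1 / K x) \<le> exp (7 * L)" if x: "x \<in> S" for x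
  proof -
    have "cmod (K x) = cmod (exp (\<kappa> x)) / cmod (\<rho> x)" by (simp add: K_def norm_mult norm_divide)
    also have "\<dots> \<le> exp L / exp (- (6 * L))"
      using exp_\<kappa>_bound[OF x] \<rho>_bound[OF x] by (intro frac_le) auto
    also have "\<dots> = exp (7 * L)" by (simp flip: exp_diff)
    finally show "cmod (K x) \<le> exp (7 * L)" .
    have "cmod (1 / K x) = cmod (\<rho> x) / cmod (exp (\<kappa> x))" by (simp add: K_def norm_mult norm_divide)
    also have "\<dots> \<le> exp (6 * L) / exp (- L)"
      using exp_\<kappa>_bound[OF x] \<rho>_bound[OF x] by (intro frac_le) auto
    also have "\<dots> = exp (7 * L)" by (simp flip: exp_diff)
    finally show "cmod (1 / K x) \<le> exp (7 * L)" .
  qed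
  have A0_le: "cmod A0 \<le> M * exp (7 * L)"
  proof -
    have "A0 = A ts * (1 / K ?b)"
      unfolding A0_def K_def using \<sigma> by auto
    then have "cmod A0 = cmod (A ts) * cmod (1 / K ?b)" by (simp only: norm_mult)
    also have "\<dots> \<le> M * exp (7 * L)"
      using A(3)[OF sqrt_b_in_V[OF ts]] Kge[OF S(4)] M0 by (intro mult_mono) auto
    finally show ?thesis .
  qed
  define MB where "MB = M + M * exp (7 * L) * exp (7 * L)"
  have Ble: "cmod (B x) \<le> MB" if x: "x \<in> S" for x
  proof -
    have "cmod (A0 * K x) \<le> M * exp (7 * L) * exp (7 * L)"
      unfolding norm_mult using A0_le Kle[OF x] M0 by (intro mult_mono) auto
    then show ?thesis
      using norm_triangle_ineq4[of "A' x" "A0 * K x"] A'_le[OF x] by (simp add: B_def MB_def)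
  qed
  obtain l where l: "l holomorphic_on S" "\<And>x. x \<in> S \<Longrightarrow> B x = (x - ?b) * l x" "\<And>x. x \<in> S \<Longrightarrow> cmod (l x) \<le> MB / \<delta>"
    using holomorphic_division[OF S(2) Bhol Bb Ble \<delta> room(2)] by blast
  \<comment> \<open>With this \<open>h\<close> the product \<open>h (\<tau>^2) * F' \<tau>\<close>
    is the amplitude \<open>B (\<tau>^2)\<close>; dividing by \<open>\<sigma>\<close> is the same as
    multiplying by it.\<close>
  define h where "h = (\<lambda>x. of_real \<sigma> * l x / exp (\<kappa> x))"
  have hhol: "h holomorphic_on S" unfolding h_def using l(1) \<kappa>(1) by (intro holomorphic_intros) auto
  define Mh where "Mh = MB / \<delta> * exp L"
  have hle: "cmod (h x) \<le> Mh" if x: "x \<in> S" for x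
  proof -
    have "cmod (h x) = cmod (l x) / cmod (exp (\<kappa> x))"
      by (simp add: h_def norm_mult norm_divide)
    also have "\<dots> \<le> (MB / \<delta>) / exp (- L)"
      using exp_\<kappa>_bound[OF x] l(3)[OF x] order_trans[OF norm_ge_zero l(3)[OF x]]
      by (intro frac_le) auto
    also have "\<dots> = MB / \<delta> * exp L" by (simp add: exp_minus field_simps)
    finally show ?thesis by (simp add: Mh_def)
  qed
  have Mh0: "0 \<le> Mh" using hle[OF S(3)] norm_ge_zero order_trans by blast
  \<comment> \<open>The Cauchy inequality is the reason why \<open>S\<close> has to contain discs of
    a fixed radius around the real interval.\<close>
  have h'le: "cmod (deriv h (of_real r)) \<le> Mh / \<delta>" if r: "0 \<le> r" "r \<le> T\<^sup>2" for r
  proof -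
    have "cmod ((deriv ^^ 1) h (of_real r)) \<le> fact 1 * Mh / \<delta> ^ 1"
    proof (rule Cauchy_inequality[OF _ _ \<delta>])
      show "h holomorphic_on ball (of_real r) \<delta>"
        using room(1)[OF r] ball_subset_cball by (blast intro: holomorphic_on_subset[OF hhol])
      show "continuous_on (cball (of_real r) \<delta>) h"
        using room(1)[OF r] by (blast intro: holomorphic_on_imp_continuous_on holomorphic_on_subset[OF hhol])
      show "cmod (h x) \<le> Mh" if "cmod (of_real r - x) = \<delta>" for x
        using room(1)[OF r] that by (intro hle) (auto simp: dist_norm)
    qed
    then show ?thesis by simp
  qed
  define c where "c = \<i> * complex_of_real chi"
  have c0: "c \<noteq> 0" "cmod c = chi" using chi by (auto simp: c_def norm_mult)
  define e where "e = (\<lambda>\<tau>. exp (\<i> * of_real chi * F \<tau>))"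
  define p where "p = (\<lambda>\<tau>. B (\<tau>\<^sup>2) * e \<tau>)"
  define r where "r = (\<lambda>\<tau>. deriv h (\<tau>\<^sup>2) * (2 * \<tau>) * e \<tau> / c)"
  \<comment> \<open>The boundary term of the integration by parts: \<open>H' = p + r\<close>, where
    \<open>p\<close> is the given integrand and \<open>r\<close> carries the gain
    \<open>1 / chi\<close>.\<close>
  define H where "H = (\<lambda>\<tau>. h (\<tau>\<^sup>2) * e \<tau> / c)"
  have DH: "(H has_field_derivative p \<tau> + r \<tau>) (at \<tau>)" if \<tau>: "\<tau> \<in> V" for \<tau>
  proof -
    have x: "\<tau>\<^sup>2 \<in> S" using \<tau> by (simp add: V_def)
    have Dh: "(h has_field_derivative deriv h (\<tau>\<^sup>2)) (at (\<tau>\<^sup>2))"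
      using hhol S(2) x holomorphic_derivI by blast
    have D1: "((\<lambda>\<tau>. h (\<tau>\<^sup>2)) has_field_derivative deriv h (\<tau>\<^sup>2) * (2 * \<tau>)) (at \<tau>)"
      by (rule DERIV_chain2[where g="\<lambda>\<tau>. \<tau>\<^sup>2", OF Dh]) (auto intro!: derivative_eq_intros)
    let ?F' = "of_real \<sigma> * (\<tau>\<^sup>2 - ?b) * exp (\<kappa> (\<tau>\<^sup>2))"
    have D2: "(e has_field_derivative e \<tau> * (c * ?F')) (at \<tau>)"
      unfolding e_def c_def
      by (rule DERIV_fun_exp) (intro DERIV_cmult F_has_deriv \<tau>)
    have hF: "h (\<tau>\<^sup>2) * ?F' = B (\<tau>\<^sup>2)"
    proof -
      have "h (\<tau>\<^sup>2) * ?F' = (of_real \<sigma> * of_real \<sigma>) * B (\<tau>\<^sup>2)"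
        unfolding h_def l(2)[OF x] by simp
      then show ?thesis by (simp add: \<sigma>1)
    qed
    have "(deriv h (\<tau>\<^sup>2) * (2 * \<tau>) * e \<tau> + e \<tau> * (c * ?F') * h (\<tau>\<^sup>2)) / c = p \<tau> + r \<tau>"
      unfolding p_def r_def hF[symmetric] using c0 by (simp add: field_simps)
    then show ?thesis
      using DERIV_cdivide[OF DERIV_mult[OF D1 D2], of c] unfolding H_def by simp
  qed
  have cont: "continuous_on {-T..T} (\<lambda>t. f (complex_of_real t))" if "f holomorphic_on V" for f
    by (rule continuous_on_compose2[OF holomorphic_on_imp_continuous_on[OF that]]) (auto intro!: continuous_intros tV)
  have ehol: "e holomorphic_on V"
    unfolding e_def using F(1) by (intro holomorphic_intros) (simp add: V_def)
  have phol: "p holomorphic_on V"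
    unfolding p_def by (intro holomorphic_on_mult comp_square_holomorphic Bhol ehol)
  have "(\<lambda>\<tau>. deriv h (\<tau>\<^sup>2) * (2 * \<tau>) * e \<tau> * inverse c) holomorphic_on V"
    by (intro holomorphic_on_mult comp_square_holomorphic holomorphic_deriv hhol S ehol
      holomorphic_on_const holomorphic_on_ident)
  then have rhol: "r holomorphic_on V" by (simp add: r_def[abs_def] divide_inverse)
  have int: "((\<lambda>t. p (of_real t) + r (of_real t)) has_integral H (of_real T) - H (of_real (-T))) {-T..T}"
  proof (rule fundamental_theorem_of_calculus[where f="\<lambda>t. H (of_real t)"])
    fix t assume "t \<in> {-T..T}"
    then show "((\<lambda>t. H (of_real t)) has_vector_derivative p (of_real t) + r (of_real t)) (at t within {-T..T})"
      using has_vector_derivative_real_field[OF DH[OF tV]] has_vector_derivative_at_within by blast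
  qed (use T in auto)
  have ip: "(\<lambda>t. p (of_real t)) integrable_on {-T..T}" and ir: "(\<lambda>t. r (of_real t)) integrable_on {-T..T}"
    by (intro integrable_continuous_interval cont phol rhol)+
  have I: "integral {-T..T} (\<lambda>t. p (of_real t)) = H (of_real T) - H (of_real (-T)) - integral {-T..T} (\<lambda>t. r (of_real t))"
    using integral_unique[OF int] integral_add[OF ip ir] by (simp add: algebra_simps)
  have Hle: "cmod (H (of_real t)) \<le> Mh / chi" if t: "t \<in> {-T..T}" for t
  proof -
    have "cmod (H (of_real t)) = cmod (h ((of_real t)\<^sup>2)) / chi"
      using exp_F_norm[OF tV[OF t]] c0 by (simp add: H_def e_def norm_mult norm_divide)
    then show ?thesis using hle[of "(of_real t)\<^sup>2"] tV[OF t] chi by (simp add: V_def divide_right_mono)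
  qed
  have R: "cmod (integral {-T..T} (\<lambda>t. r (of_real t))) \<le> (2 * T * Mh / (\<delta> * chi)) * (T - - T)"
  proof (rule integral_bound)
    fix t assume t: "t \<in> {-T..T}"
    have t2: "t\<^sup>2 \<le> T\<^sup>2" "\<bar>t\<bar> \<le> T" using t by (auto simp: abs_le_square_iff[symmetric])
    have "cmod (r (of_real t)) = cmod (deriv h ((of_real t)\<^sup>2)) * (2 * \<bar>t\<bar>) / chi"
      using exp_F_norm[OF tV[OF t]] c0 by (simp add: r_def e_def norm_mult norm_divide)
    also have "\<dots> \<le> (Mh / \<delta>) * (2 * T) / chi"
      using h'le[of "t\<^sup>2"] t2 chi Mh0 \<delta> by (intro divide_right_mono mult_mono) auto
    finally show "cmod (r (of_real t)) \<le> 2 * T * Mh / (\<delta> * chi)" by (simp add: field_simps)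
  qed (use T in \<open>auto intro!: cont rhol\<close>)
  have "cmod (integral {-T..T} (\<lambda>t. p (of_real t))) \<le> cmod (H (of_real T)) + cmod (H (of_real (- T)))
      + cmod (integral {-T..T} (\<lambda>t. r (of_real t)))"
    unfolding I by (intro order_trans[OF norm_triangle_ineq4] add_right_mono norm_triangle_ineq4)
  also have "\<dots> \<le> (Mh / chi + Mh / chi) + (2 * T * Mh / (\<delta> * chi)) * (T - - T)"
    using T by (intro add_mono R Hle) auto
  also have "\<dots> = remainder_const T \<delta> L M / chi"
  proof -
    have e: "(Mh / chi + Mh / chi) + (2 * T * Mh / (\<delta> * chi)) * (T - - T) = (2 + 4 * T\<^sup>2 / \<delta>) * Mh / chi"
      using chi \<delta> by (simp add: field_simps power2_eq_square)
    show ?thesis unfolding e by (simp add: remainder_const_def Mh_def MB_def)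
  qed
  finally have "cmod (integral {-T..T} (\<lambda>t. p (of_real t))) \<le> remainder_const T \<delta> L M / chi" .
  moreover have "integral {-T..T} (\<lambda>t. p (of_real t)) = integral {-T..T} (\<lambda>t. (A (of_real t) - A0 * (of_real \<sigma> * exp (\<kappa> ((of_real t)\<^sup>2)) / \<rho> ((of_real t)\<^sup>2)))
      * exp (\<i> * of_real chi * F (of_real t)))"
  proof (rule integral_cong)
    fix t assume "t \<in> {-T..T}"
    then show "p (of_real t) = (A (of_real t) - A0 * (of_real \<sigma> * exp (\<kappa> ((of_real t)\<^sup>2)) / \<rho> ((of_real t)\<^sup>2)))
      * exp (\<i> * of_real chi * F (of_real t))"
      using A'(2)[OF tV] by (simp add: p_def B_def K_def e_def)
  qed
  ultimately show ?thesis by simp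
qed

text \<open>This part of the integral is exact: \<open>y = chi^(1/3) u(\<tau>)\<close> turns
  \<open>chi F\<close> into \<open>y^3/3 + p y\<close>. Evaluating by a primitive instead of
  substituting also covers the orientation-reversing case, where \<open>q\<close> is
  negative.\<close>

lemma Phi_inc_eq:
  assumes T: "0 < T" and rS: "\<And>r. 0 \<le> r \<Longrightarrow> r \<le> T\<^sup>2 \<Longrightarrow> of_real r \<in> S" and chi: "0 < chi"
  shows "((\<lambda>t. of_real \<sigma> * exp (\<kappa> ((of_real t)\<^sup>2)) / \<rho> ((of_real t)\<^sup>2) * exp (\<i> * of_real chi * F (of_real t)))
     has_integral of_real (2 * pi / chi powr (1/3)) *
       Phi_inc (- (chi powr (2/3)) * \<xi>) (chi powr (1/3) * Re (u (of_real T)))) {-T..T}"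
proof -
  have tV: "complex_of_real t \<in> V" if "t \<in> {-T..T}" for t
    using real_interval_in_V[OF rS that] .
  define c where "c = chi powr (1/3)"
  define p where "p = - (chi powr (2/3)) * \<xi>"
  define q where "q = Re (u (of_real T))"
  have c: "c > 0" using chi by (simp add: c_def)
  have c3: "c ^ 3 = chi"
    using c chi powr_realpow[of c 3] by (simp add: c_def powr_powr)
  have "c * chi powr (2/3) = chi powr (1/3 + 2/3)" unfolding c_def by (rule powr_add[symmetric])
  then have cp: "c * p = - (chi * \<xi>)" using chi by (simp add: p_def)
  \<comment> \<open>The integrand is entire, so a single primitive \<open>\<Psi>\<close> evaluates
    the integrals in \<open>y\<close> and in \<open>\<tau>\<close>.\<close>
  define f where "f = (\<lambda>y. exp (\<i> * (y ^ 3 / 3 + of_real p * y)))"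
  have "f holomorphic_on UNIV" unfolding f_def by (intro holomorphic_intros) auto
  then obtain \<Psi> where \<Psi>: "\<And>y. (\<Psi> has_field_derivative f y) (at y)"
    using holomorphic_convex_primitive'[of UNIV f] by auto
  have uT: "u (of_real T) = of_real q"
    using u_real[of "of_real T"] tV[of T] T by (simp add: q_def)
  have "(LBINT y=ereal (- (c * q))..ereal (c * q). exp (\<i> * of_real (y ^ 3 / 3 + p * y))) =
      \<Psi> (of_real (c * q)) - \<Psi> (of_real (- (c * q)))"
  proof (rule interval_integral_FTC_finite)
    show "continuous_on {min (- (c * q)) (c * q)..max (- (c * q)) (c * q)} (\<lambda>y. exp (\<i> * of_real (y ^ 3 / 3 + p * y)))"
      by (intro continuous_intros) auto
    fix y
    have "f (of_real y) = exp (\<i> * of_real (y ^ 3 / 3 + p * y))" by (simp add: f_def)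
    then show "((\<lambda>y. \<Psi> (of_real y)) has_vector_derivative exp (\<i> * of_real (y ^ 3 / 3 + p * y)))
        (at y within {min (- (c * q)) (c * q)..max (- (c * q)) (c * q)})"
      using has_vector_derivative_real_field[OF \<Psi>] has_vector_derivative_at_within by metis
  qed
  then have Phi: "of_real (2 * pi / c) * Phi_inc p (c * q) = (\<Psi> (of_real (c * q)) - \<Psi> (of_real (- (c * q)))) / of_real c"
    by (simp add: Phi_inc_def)
  let ?v = "\<lambda>\<tau>. of_real \<sigma> * exp (\<kappa> (\<tau>\<^sup>2)) / \<rho> (\<tau>\<^sup>2) * exp (\<i> * of_real chi * F \<tau>)"
  have "((\<lambda>t. ?v (of_real t)) has_integral \<Psi> (of_real c * u (of_real T)) / of_real c - \<Psi> (of_real c * u (of_real (- T))) / of_real c) {-T..T}"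
  proof (rule fundamental_theorem_of_calculus[where f="\<lambda>t. \<Psi> (of_real c * u (of_real t)) / of_real c"])
    fix t assume t: "t \<in> {-T..T}"
    let ?\<tau> = "complex_of_real t"
    have "f (of_real c * u ?\<tau>) = exp (\<i> * (of_real (c ^ 3) * u ?\<tau> ^ 3 / 3 + of_real (c * p) * u ?\<tau>))"
      by (simp add: f_def power_mult_distrib mult_ac)
    also have "\<dots> = exp (\<i> * of_real chi * F ?\<tau>)"
      unfolding c3 cp cubic[OF tV[OF t]] by (simp add: algebra_simps)
    finally have e: "f (of_real c * u ?\<tau>) = exp (\<i> * of_real chi * F ?\<tau>)" .
    have "((\<lambda>\<tau>. \<Psi> (of_real c * u \<tau>)) has_field_derivative
        f (of_real c * u ?\<tau>) * (of_real c * (of_real \<sigma> * exp (\<kappa> (?\<tau>\<^sup>2)) / \<rho> (?\<tau>\<^sup>2)))) (at ?\<tau>)"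
      by (rule DERIV_chain2[where g="\<lambda>\<tau>. of_real c * u \<tau>", OF \<Psi>]) (intro DERIV_cmult u_deriv tV t)
    from DERIV_cdivide[OF this, of "of_real c"]
    have "((\<lambda>\<tau>. \<Psi> (of_real c * u \<tau>) / of_real c) has_field_derivative ?v ?\<tau>) (at ?\<tau>)"
      unfolding e using c by (simp add: mult_ac)
    then show "((\<lambda>t. \<Psi> (of_real c * u (of_real t)) / of_real c) has_vector_derivative ?v ?\<tau>) (at t within {-T..T})"
      using has_vector_derivative_real_field has_vector_derivative_at_within by blast
  qed (use T in auto)
  also have "\<Psi> (of_real c * u (of_real T)) / of_real c - \<Psi> (of_real c * u (of_real (- T))) / of_real c =
     of_real (2 * pi / c) * Phi_inc p (c * q)"
    unfolding Phi using u_uminus[of "of_real T"] uT by (simp add: diff_divide_distrib)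
  finally show ?thesis by (simp add: c_def p_def q_def)
qed

end

subsection \<open>The expansion at one point\<close>

text \<open>The conclusion at one point, with the map, its inverse and the constant as arguments, so
  that the constants possible at that point form a set with an infimum.\<close>

definition pw_expansion ::
  "(real \<Rightarrow> real) \<Rightarrow> (real \<Rightarrow> real) \<Rightarrow> (real \<Rightarrow> real) \<Rightarrow> (complex \<Rightarrow> complex) \<Rightarrow> (complex \<Rightarrow> complex) \<Rightarrow>
     (complex \<Rightarrow> complex) \<Rightarrow> real \<Rightarrow> real \<Rightarrow> real \<Rightarrow> complex \<Rightarrow> (complex \<Rightarrow> complex) \<Rightarrow> (complex \<Rightarrow> complex) \<Rightarrow> real \<Rightarrow> bool"
where
  "pw_expansion w a \<psi> wC aC \<psi>C T t fb ts u g C \<longleftrightarrow>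
    (let F = pw_phase \<psi>C t fb; A = pw_amp wC aC t; \<xi> = pw_xi F ts;
         q = pw_q T u; A0 = pw_A0 A g \<xi>
     in canonical_map T F ts u g \<and>
        u (of_real T) = of_real q \<and> u (- of_real T) = - of_real q \<and>
        pw_phase \<psi> t fb T = q ^ 3 / 3 - \<xi> * q \<and>
        u ` {ts, - ts} = {csqrt (of_real \<xi>), - csqrt (of_real \<xi>)} \<and>
        A0 = pw_G A g (- csqrt (of_real \<xi>)) \<and>
        (\<xi> \<noteq> 0 \<longrightarrow>
           A0 = of_real (sgn q * \<bar>\<xi>\<bar> powr (1 / 4)) * A ts * of_real (sqrt (cmod (2 / deriv (deriv F) ts)))) \<and>
        (\<forall>chi\<ge>1.
           pwvd w T (signal a \<psi> chi) t (chi * fb) =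
             (LBINT \<tau>=-T..T. of_real (pw_amp w a t \<tau>) * exp (\<i> * of_real (chi * pw_phase \<psi> t fb \<tau>))) \<and>
           cmod (pwvd w T (signal a \<psi> chi) t (chi * fb) -
                 of_real (2 * pi / chi powr (1 / 3)) * A0 *
                   Phi_inc (- (chi powr (2 / 3)) * \<xi>) (chi powr (1 / 3) * q))
             \<le> C / chi))"

lemma pwvd_eq:
  "pwvd w T (signal a \<psi> chi) t (chi * fb) =
     (LBINT \<tau>=-T..T. of_real (pw_amp w a t \<tau>) * exp (\<i> * of_real (chi * pw_phase \<psi> t fb \<tau>)))"
proof -
  have "of_real (w (\<tau> / 2) * w (- (\<tau> / 2))) * signal a \<psi> chi (t + \<tau> / 2) * cnj (signal a \<psi> chi (t - \<tau> / 2))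
        * exp (- \<i> * of_real (2 * pi * (chi * fb) * \<tau>)) =
      of_real (pw_amp w a t \<tau>) * exp (\<i> * of_real (chi * pw_phase \<psi> t fb \<tau>))" for \<tau>
  proof -
    have e: "\<i> * of_real (chi * pw_phase \<psi> t fb \<tau>) =
        \<i> * of_real (chi * \<psi> (t + \<tau> / 2)) + (- (\<i> * of_real (chi * \<psi> (t - \<tau> / 2)))
        + - \<i> * of_real (2 * pi * (chi * fb) * \<tau>))"
      by (simp add: pw_phase_def algebra_simps)
    show ?thesis
      unfolding e exp_add by (simp add: signal_def pw_amp_def exp_cnj)
  qed
  then show ?thesis unfolding pwvd_def by (simp only:)
qed

lemma pw_amp_even: "pw_amp w a t (- \<tau>) = pw_amp w a t \<tau>"
  by (simp add: pw_amp_def mult_ac)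

lemma pw_phase_0: "pw_phase \<psi> t fb 0 = 0"
  by (simp add: pw_phase_def)

lemma holomorphic_on_compose_image:
  assumes "f holomorphic_on D" "g holomorphic_on V" "\<And>\<tau>. \<tau> \<in> V \<Longrightarrow> g \<tau> \<in> D"
  shows "(\<lambda>\<tau>. f (g \<tau>)) holomorphic_on V"
  using holomorphic_on_compose_gen[OF assms(2,1)] assms(3) by (auto simp: o_def)

lemma pw_amp_holomorphic:
  assumes "aC holomorphic_on D" "wC holomorphic_on Dw"
    and "\<And>\<tau>. \<tau> \<in> V \<Longrightarrow> of_real t + \<tau> / 2 \<in> D \<and> of_real t - \<tau> / 2 \<in> D \<and> \<tau> / 2 \<in> Dw \<and> - (\<tau> / 2) \<in> Dw"
  shows "pw_amp wC aC t holomorphic_on V"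
  unfolding pw_amp_def[abs_def] using assms(3)
  by (intro holomorphic_on_mult holomorphic_on_compose_image[OF assms(1)] holomorphic_on_compose_image[OF assms(2)])
    (simp_all add: holomorphic_intros)

lemma pw_phase_holomorphic:
  assumes "\<psi>C holomorphic_on D" and "\<And>\<tau>. \<tau> \<in> V \<Longrightarrow> of_real t + \<tau> / 2 \<in> D \<and> of_real t - \<tau> / 2 \<in> D"
  shows "pw_phase \<psi>C t fb holomorphic_on V"
  unfolding pw_phase_def[abs_def] using assms(2)
  by (intro holomorphic_on_diff holomorphic_on_compose_image[OF assms(1)])
    (simp_all add: holomorphic_intros)

text \<open>Squaring carries the cross into the real points between \<open>0\<close> and
  \<open>T^2\<close> and between \<open>0\<close> and \<open>b\<close>, all of which lie in
  \<open>S\<close>.\<close>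

lemma (in cubic_chart) cross_subset_V:
  assumes "\<And>r. 0 \<le> r \<Longrightarrow> r \<le> T\<^sup>2 \<Longrightarrow> of_real r \<in> S" "0 < T" "ts\<^sup>2 = of_real b"
  shows "pw_cross T ts \<subseteq> V"
proof -
  have "\<tau> \<in> V" if seg: "\<tau> \<in> closed_segment (- of_real T) (of_real T)" for \<tau>
  proof -
    obtain s where s: "0 \<le> s" "s \<le> 1" "\<tau> = (1 - s) *\<^sub>R (- of_real T) + s *\<^sub>R of_real T"
      using seg unfolding closed_segment_def by blast
    have \<tau>: "\<tau> = of_real ((2 * s - 1) * T)" unfolding s(3) by (simp add: scaleR_conv_of_real algebra_simps)
    have "\<bar>2 * s - 1\<bar> * T \<le> 1 * T" using s assms(2) by (intro mult_right_mono) auto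
    then have "\<bar>(2 * s - 1) * T\<bar> \<le> T" using assms(2) by (simp add: abs_mult)
    then have sT: "(2 * s - 1) * T \<in> {-T..T}" unfolding abs_le_iff by simp
    show ?thesis unfolding \<tau> using real_interval_in_V[OF assms(1) sT] .
  qed
  moreover have "\<tau> \<in> V" if seg: "\<tau> \<in> closed_segment (- ts) ts" for \<tau>
  proof -
    obtain s where s: "0 \<le> s" "s \<le> 1" "\<tau> = (1 - s) *\<^sub>R (- ts) + s *\<^sub>R ts"
      using seg unfolding closed_segment_def by blast
    have \<tau>: "\<tau> = of_real (2 * s - 1) * ts" unfolding s(3) by (simp add: scaleR_conv_of_real algebra_simps)
    show ?thesis
    proof (cases "0 \<le> 2 * s - 1")
      case True
      then show ?thesis unfolding \<tau> using s V_scale[OF sqrt_b_in_V[OF assms(3)], of "2 * s - 1"] by simp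
    next
      case False
      then have "of_real (1 - 2 * s) * ts \<in> V"
        using s V_scale[OF sqrt_b_in_V[OF assms(3)], of "1 - 2 * s"] by simp
      then have "- (of_real (1 - 2 * s) * ts) \<in> V" by (simp only: V_uminus)
      moreover have "- (of_real (1 - 2 * s) * ts) = \<tau>" unfolding \<tau> by (simp add: algebra_simps)
      ultimately show ?thesis by simp
    qed
  qed
  ultimately show ?thesis unfolding pw_cross_def by blast
qed

text \<open>With \<open>F''(ts) = 2 \<sigma> ts k(b)\<close>, \<open>|ts|^2 = |b|\<close> and
  \<open>\<xi> = b m(b)^2\<close>, the square of the claimed modulus is \<open>m(b) / k(b)\<close>.
  This equals \<open>(\<rho>(b) / k(b))^2\<close> because
  \<open>\<rho>(b)^2 = k(b) m(b)\<close>.\<close>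

lemma (in cubic_chart) leading_coefficient:
  assumes ts: "ts\<^sup>2 = of_real b" and nz: "\<xi> \<noteq> 0"
  shows "of_real \<sigma> * \<rho> (of_real b) / exp (\<kappa> (of_real b)) =
    of_real (\<sigma> * \<bar>\<xi>\<bar> powr (1/4) * sqrt (cmod (2 / deriv (deriv F) ts)))"
proof -
  let ?b = "complex_of_real b"
  obtain kr where kr: "\<kappa> ?b = of_real kr" using \<kappa>(2)[OF S(4)] by (auto elim: Reals_cases)
  obtain mr where mr: "\<mu> ?b = of_real mr" using \<mu>_real[OF S(4)] by (auto elim: Reals_cases)
  obtain r where r: "\<rho> ?b = of_real r" "0 < r" using \<rho>_pos[OF S(4)] by (auto elim!: Reals_cases)
  have r2: "r\<^sup>2 = exp kr * exp mr"
  proof -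
    have "complex_of_real (r\<^sup>2) = of_real (exp kr * exp mr)"
      using \<rho>_b unfolding r kr mr by (simp add: exp_of_real)
    then show ?thesis by (simp only: of_real_eq_iff)
  qed
  have tsV: "ts \<in> V" by (rule sqrt_b_in_V[OF ts])
  have "deriv (deriv F) ts = of_real \<sigma> * (2 * ts) * exp (\<kappa> ?b)"
  proof -
    have D\<kappa>: "(\<kappa> has_field_derivative deriv \<kappa> ?b) (at (ts\<^sup>2))"
      using \<kappa>(1) S(2,4) holomorphic_derivI unfolding ts by blast
    have D1: "((\<lambda>\<tau>. \<kappa> (\<tau>\<^sup>2)) has_field_derivative deriv \<kappa> ?b * (2 * ts)) (at ts)"
      by (rule DERIV_chain2[where g="\<lambda>\<tau>. \<tau>\<^sup>2", OF D\<kappa>]) (auto intro!: derivative_eq_intros)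
    have "((\<lambda>\<tau>. of_real \<sigma> * (\<tau>\<^sup>2 - ?b) * exp (\<kappa> (\<tau>\<^sup>2))) has_field_derivative of_real \<sigma> * (2 * ts) * exp (\<kappa> ?b)) (at ts)"
      by (rule derivative_eq_intros D1 refl)+ (simp add: ts)
    then have "(deriv F has_field_derivative of_real \<sigma> * (2 * ts) * exp (\<kappa> ?b)) (at ts)"
      by (rule has_field_derivative_transform_within_open[OF _ open_V tsV]) (simp add: F_deriv V_def)
    then show ?thesis by (rule DERIV_imp_deriv)
  qed
  then have "cmod (2 / deriv (deriv F) ts) = 1 / (cmod ts * exp kr)"
    unfolding kr by (simp add: norm_mult norm_divide)
  moreover have "cmod ts = sqrt \<bar>b\<bar>"
  proof -
    have "(cmod ts)\<^sup>2 = \<bar>b\<bar>" using ts by (metis norm_of_real norm_power)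
    then show ?thesis by (metis norm_ge_zero real_sqrt_unique)
  qed
  ultimately have F'': "cmod (2 / deriv (deriv F) ts) = 1 / (sqrt \<bar>b\<bar> * exp kr)" by simp
  have \<xi>: "\<xi> = b * (exp mr)\<^sup>2" by (simp add: \<xi>_def mr)
  then have b0: "\<bar>b\<bar> > 0" using nz by auto
  have "\<bar>\<xi>\<bar> powr (1/4) * sqrt (1 / (sqrt \<bar>b\<bar> * exp kr)) = r / exp kr"
  proof (rule power2_eq_imp_eq)
    have "(\<bar>\<xi>\<bar> powr (1/4))\<^sup>2 = \<bar>\<xi>\<bar> powr (1/4 + 1/4)"
      unfolding power2_eq_square by (rule powr_add[symmetric])
    also have "\<dots> = sqrt \<bar>\<xi>\<bar>" by (simp add: powr_half_sqrt)
    also have "\<dots> = sqrt \<bar>b\<bar> * exp mr" by (simp add: \<xi> abs_mult real_sqrt_mult)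
    finally have "(\<bar>\<xi>\<bar> powr (1/4) * sqrt (1 / (sqrt \<bar>b\<bar> * exp kr)))\<^sup>2 = sqrt \<bar>b\<bar> * exp mr * (1 / (sqrt \<bar>b\<bar> * exp kr))"
      by (simp add: power_mult_distrib)
    also have "\<dots> = (r / exp kr)\<^sup>2"
      using b0 by (simp add: power_divide r2) (simp add: power2_eq_square)
    finally show "(\<bar>\<xi>\<bar> powr (1/4) * sqrt (1 / (sqrt \<bar>b\<bar> * exp kr)))\<^sup>2 = (r / exp kr)\<^sup>2" .
  qed (use r in auto)
  then have "of_real (\<sigma> * \<bar>\<xi>\<bar> powr (1/4) * sqrt (cmod (2 / deriv (deriv F) ts))) = complex_of_real (\<sigma> * (r / exp kr))"
    unfolding F'' by (simp only: mult.assoc)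
  then show ?thesis by (simp add: r kr exp_of_real)
qed

text \<open>All dependence on \<open>(t, fb)\<close> is pushed into \<open>S\<close>,
  \<open>\<kappa>\<close>, \<open>\<delta>\<close>, \<open>L\<close> and \<open>M\<close>; whenever
  these fit, the constant is explicit. It then remains to find data that serve a whole
  neighbourhood.\<close>

lemma pw_expansion_of_chart:
  fixes wC aC \<psi>C :: "complex \<Rightarrow> complex"
  assumes T: "0 < T"
    and a: "continuation_on aC a I D" and \<psi>: "continuation_on \<psi>C \<psi> I D"
    and w: "continuation_on wC w {- T / 2..T / 2} Dw"
    and tI: "{t - T / 2..t + T / 2} \<subseteq> I"
    and ts: "ts\<^sup>2 = of_real b"
    and S: "convex S" "open S" "0 \<in> S" "of_real b \<in> S"
    and dom: "\<And>\<tau>. \<tau>\<^sup>2 \<in> S \<Longrightarrow> of_real t + \<tau> / 2 \<in> D \<and> of_real t - \<tau> / 2 \<in> D \<and> \<tau> / 2 \<in> Dw \<and> - (\<tau> / 2) \<in> Dw"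
    and L: "0 \<le> L"
    and \<kappa>: "\<kappa> holomorphic_on S" "\<And>x. x \<in> S \<Longrightarrow> \<bar>Im (\<kappa> x)\<bar> \<le> 1/40" "\<And>x. x \<in> S \<Longrightarrow> cmod (\<kappa> x) \<le> L"
      "\<And>x. x \<in> S \<Longrightarrow> x \<in> \<real> \<Longrightarrow> \<kappa> x \<in> \<real>"
    and \<sigma>: "\<sigma> = 1 \<or> \<sigma> = - 1"
    and F_deriv: "\<And>\<tau>. \<tau>\<^sup>2 \<in> S \<Longrightarrow> deriv (pw_phase \<psi>C t fb) \<tau> = of_real \<sigma> * (\<tau>\<^sup>2 - of_real b) * exp (\<kappa> (\<tau>\<^sup>2))"
    and \<delta>: "0 < \<delta>"
    and room: "\<And>r. 0 \<le> r \<Longrightarrow> r \<le> T\<^sup>2 \<Longrightarrow> cball (of_real r) \<delta> \<subseteq> S" "cball (of_real b) \<delta> \<subseteq> S"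
    and M: "\<And>\<tau>. \<tau>\<^sup>2 \<in> S \<Longrightarrow> cmod (pw_amp wC aC t \<tau>) \<le> M"
  shows "\<exists>u g. pw_expansion w a \<psi> wC aC \<psi>C T t fb ts u g (remainder_const T \<delta> L M)"
proof -
  let ?F = "pw_phase \<psi>C t fb" and ?A = "pw_amp wC aC t"
  obtain \<mu> \<rho> where chart: "\<mu> holomorphic_on S" "\<rho> holomorphic_on S"
    "\<And>x. x \<in> S \<Longrightarrow> x \<in> \<real> \<Longrightarrow> \<mu> x \<in> \<real>"
    "\<And>x. x \<in> S \<Longrightarrow> x \<in> \<real> \<Longrightarrow> \<rho> x \<in> \<real> \<and> 0 < Re (\<rho> x)"
    "\<And>x. x \<in> S \<Longrightarrow> exp (- (6 * L)) \<le> cmod (\<rho> x) \<and> cmod (\<rho> x) \<le> exp (6 * L)"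
    "\<And>x. x \<in> S \<Longrightarrow> ((\<lambda>x. x * (exp (\<mu> x))\<^sup>2) has_field_derivative exp (\<kappa> x) * exp (\<mu> x) / \<rho> x) (at x)"
    "\<And>x. x \<in> S \<Longrightarrow> x * (exp (\<mu> x))\<^sup>2 = of_real b * (exp (\<mu> (of_real b)))\<^sup>2 + (x - of_real b) * \<rho> x"
    "inj_on (\<lambda>x. x * (exp (\<mu> x))\<^sup>2) S"
    "(\<rho> (of_real b))\<^sup>2 = exp (\<kappa> (of_real b)) * exp (\<mu> (of_real b))"
    using canonical_pair[OF S Reals_of_real L \<kappa>] by blast
  have Fhol: "?F holomorphic_on {\<tau>. \<tau>\<^sup>2 \<in> S}"
    using \<psi> dom by (intro pw_phase_holomorphic[where D=D]) (auto simp: continuation_on_def)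
  interpret cubic_chart S b \<sigma> L \<kappa> \<mu> \<rho> ?F
    by unfold_locales (fact S \<sigma> \<kappa> chart Fhol F_deriv pw_phase_0)+
  obtain g where g: "g holomorphic_on u ` V" "open (u ` V)" "\<And>\<tau>. \<tau> \<in> V \<Longrightarrow> g (u \<tau>) = \<tau>"
    "\<And>\<tau>. \<tau> \<in> V \<Longrightarrow> deriv g (u \<tau>) = of_real \<sigma> * \<rho> (\<tau>\<^sup>2) / exp (\<kappa> (\<tau>\<^sup>2))"
    using inverse_exists by blast
  have rS: "of_real r \<in> S" if "0 \<le> r" "r \<le> T\<^sup>2" for r
    using room(1)[OF that] \<delta> by (meson centre_in_cball less_imp_le subsetD)
  have tV: "complex_of_real s \<in> V" if "s \<in> {-T..T}" for s
    using real_interval_in_V[OF rS that] .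
  have cross: "pw_cross T ts \<subseteq> V" by (rule cross_subset_V[OF rS T ts])
  have \<xi>: "pw_xi ?F ts = \<xi>" by (rule pw_xi_eq[OF ts])
  define q where "q = pw_q T u"
  have uT: "u (of_real T) = of_real q"
    using u_real[of "of_real T"] tV[of T] T by (simp add: q_def pw_q_def)
  have tsV: "ts \<in> V" "- ts \<in> V" using sqrt_b_in_V[OF ts] V_uminus by auto
  \<comment> \<open>Which root is met depends on \<open>\<sigma>\<close> and on the choice between
    \<open>ts\<close> and \<open>- ts\<close>. Both cases are kept, because \<open>G\<close> takes
    the same value at the two roots.\<close>
  have uts: "u ts = csqrt (of_real \<xi>) \<or> u ts = - csqrt (of_real \<xi>)"
    using u_ts[OF ts] power2_eq_iff[of "u ts" "csqrt (of_real \<xi>)"] by simp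
  have canon: "canonical_map T ?F ts u g"
    unfolding canonical_map_def
  proof (intro conjI ballI impI)
    show "u analytic_on pw_cross T ts"
      using analytic_on_subset[OF iffD2[OF analytic_on_open[OF open_V] u_holomorphic] cross] .
    show "g analytic_on u ` pw_cross T ts"
      using analytic_on_subset[OF iffD2[OF analytic_on_open[OF g(2)] g(1)] image_mono[OF cross]] .
    fix \<tau> assume "\<tau> \<in> pw_cross T ts"
    then have \<tau>: "\<tau> \<in> V" using cross by blast
    show "g (u \<tau>) = \<tau>" "?F \<tau> = u \<tau> ^ 3 / 3 - of_real (pw_xi ?F ts) * u \<tau>"
      unfolding \<xi> by (rule g(3)[OF \<tau>] cubic[OF \<tau>])+
    show "u \<tau> \<in> \<real>" if "\<tau> \<in> \<real>" using u_real[OF \<tau> that] .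
  qed
  have cont_eq: "\<And>x. x \<in> I \<Longrightarrow> \<psi>C (of_real x) = of_real (\<psi> x)" "\<And>x. x \<in> I \<Longrightarrow> aC (of_real x) = of_real (a x)"
    "\<And>x. x \<in> {- T / 2..T / 2} \<Longrightarrow> wC (of_real x) = of_real (w x)"
    using a \<psi> w by (simp_all add: continuation_on_def)
  have phase: "of_real (pw_phase \<psi> t fb s) = ?F (of_real s)" and amp: "of_real (pw_amp w a t s) = ?A (of_real s)"
    if s: "s \<in> {-T..T}" for s
  proof -
    have I: "t + s / 2 \<in> I" "t - s / 2 \<in> I" using s tI by (auto simp: subset_iff field_simps)
    have W: "s / 2 \<in> {- T / 2..T / 2}" "- (s / 2) \<in> {- T / 2..T / 2}" using s by auto
    have "\<psi>C (of_real (t + s / 2)) = of_real (\<psi> (t + s / 2))" "\<psi>C (of_real (t - s / 2)) = of_real (\<psi> (t - s / 2))"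
      "aC (of_real (t + s / 2)) = of_real (a (t + s / 2))" "aC (of_real (t - s / 2)) = of_real (a (t - s / 2))"
      "wC (of_real (s / 2)) = of_real (w (s / 2))" "wC (of_real (- (s / 2))) = of_real (w (- (s / 2)))"
      using cont_eq(1)[OF I(1)] cont_eq(1)[OF I(2)] cont_eq(2)[OF I(1)] cont_eq(2)[OF I(2)]
        cont_eq(3)[OF W(1)] cont_eq(3)[OF W(2)] by (simp_all only:)
    then show "of_real (pw_phase \<psi> t fb s) = ?F (of_real s)" "of_real (pw_amp w a t s) = ?A (of_real s)"
      by (simp_all add: pw_phase_def pw_amp_def)
  qed
  have qF: "pw_phase \<psi> t fb T = q ^ 3 / 3 - \<xi> * q"
  proof -
    have "complex_of_real (pw_phase \<psi> t fb T) = of_real (q ^ 3 / 3 - \<xi> * q)"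
      using phase[of T] cubic[OF tV[of T]] uT T by simp
    then show ?thesis by (simp only: of_real_eq_iff)
  qed
  define A0 where "A0 = ?A ts * (of_real \<sigma> * \<rho> (of_real b) / exp (\<kappa> (of_real b)))"
  \<comment> \<open>\<open>A\<close> is even and the derivative of the inverse depends on
    \<open>\<tau>\<close> only through \<open>\<tau>^2\<close>, so one coefficient serves both
    stationary points and no second Airy-type term arises.\<close>
  have G: "pw_G ?A g (u \<tau>) = A0" if "\<tau> = ts \<or> \<tau> = - ts" for \<tau>
    using that g(3,4)[OF tsV(1)] g(3,4)[OF tsV(2)] ts by (elim disjE) (simp_all add: pw_G_def A0_def pw_amp_even)
  have G': "pw_G ?A g (csqrt (of_real \<xi>)) = A0" "pw_G ?A g (- csqrt (of_real \<xi>)) = A0"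
    using uts G[of ts] G[of "- ts"] u_uminus[of ts] by auto
  have A0: "pw_A0 ?A g \<xi> = A0" using G'(1) by (simp add: pw_A0_def)
  have est: "cmod (pwvd w T (signal a \<psi> chi) t (chi * fb) -
       of_real (2 * pi / chi powr (1/3)) * A0 * Phi_inc (- (chi powr (2/3)) * \<xi>) (chi powr (1/3) * q))
       \<le> remainder_const T \<delta> L M / chi" if chi: "1 \<le> chi" for chi
  proof -
    let ?e = "\<lambda>s. exp (\<i> * of_real chi * ?F (of_real s))"
    let ?u' = "\<lambda>s. of_real \<sigma> * exp (\<kappa> ((of_real s)\<^sup>2)) / \<rho> ((of_real s)\<^sup>2)"
    have Ahol: "?A holomorphic_on V"
      using a w dom by (intro pw_amp_holomorphic[where D=D and Dw=Dw]) (auto simp: continuation_on_def V_def)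
    have "(\<lambda>\<tau>. ?A \<tau> * exp (\<i> * of_real chi * ?F \<tau>)) holomorphic_on V"
      using F(1) by (intro holomorphic_intros Ahol) (simp add: V_def)
    from holomorphic_on_imp_continuous_on[OF this]
    have cont: "continuous_on {-T..T} (\<lambda>s. ?A (of_real s) * ?e s)"
      by (rule continuous_on_compose2) (auto intro!: continuous_intros tV)
    have "pwvd w T (signal a \<psi> chi) t (chi * fb) = (LBINT s=-T..T. ?A (of_real s) * ?e s)"
      unfolding pwvd_eq
    proof (rule interval_integral_cong)
      fix s assume "s \<in> einterval (min (ereal (- T)) (ereal T)) (max (ereal (- T)) (ereal T))"
      then have "s \<in> {-T..T}" using T by (auto simp: einterval_eq min_def max_def)
      then show "of_real (pw_amp w a t s) * exp (\<i> * of_real (chi * pw_phase \<psi> t fb s)) = ?A (of_real s) * ?e s"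
        using phase amp by (simp add: mult.assoc)
    qed
    also have "\<dots> = integral {-T..T} (\<lambda>s. ?A (of_real s) * ?e s)"
      using T by (intro interval_integral_eq_integral borel_integrable_atLeastAtMost' cont) auto
    finally have P: "pwvd w T (signal a \<psi> chi) t (chi * fb) = integral {-T..T} (\<lambda>s. ?A (of_real s) * ?e s)" .
    have chi0: "0 < chi" using chi by simp
    have Phi: "((\<lambda>s. ?u' s * ?e s) has_integral of_real (2 * pi / chi powr (1/3)) *
       Phi_inc (- (chi powr (2/3)) * \<xi>) (chi powr (1/3) * q)) {-T..T}"
      using Phi_inc_eq[OF T rS chi0] by (simp add: q_def pw_q_def)
    \<comment> \<open>Subtracting \<open>A0 u'\<close> from the amplitude splits off the exact
      incomplete Airy term and leaves the integral estimated by
      \<open>remainder_bound\<close>.\<close>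
    have "((\<lambda>s. ?A (of_real s) * ?e s - A0 * (?u' s * ?e s)) has_integral
        pwvd w T (signal a \<psi> chi) t (chi * fb) - A0 * (of_real (2 * pi / chi powr (1/3)) *
       Phi_inc (- (chi powr (2/3)) * \<xi>) (chi powr (1/3) * q))) {-T..T}"
      unfolding P by (intro has_integral_diff has_integral_mult_right Phi integrable_integral integrable_continuous_interval cont)
    then have "integral {-T..T} (\<lambda>s. (?A (of_real s) - A0 * ?u' s) * ?e s) =
        pwvd w T (signal a \<psi> chi) t (chi * fb) - of_real (2 * pi / chi powr (1/3)) * A0 *
       Phi_inc (- (chi powr (2/3)) * \<xi>) (chi powr (1/3) * q)"
      by (intro integral_unique) (simp add: algebra_simps)
    moreover have "cmod (integral {-T..T} (\<lambda>s. (?A (of_real s) - A0 * ?u' s) * ?e s)) \<le> remainder_const T \<delta> L M / chi"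
      unfolding A0_def
      by (rule remainder_bound[OF T \<delta> Ahol _ _ room ts chi0]) (auto simp: pw_amp_even V_def intro: M)
    ultimately show ?thesis by simp
  qed
  have "pw_expansion w a \<psi> wC aC \<psi>C T t fb ts u g (remainder_const T \<delta> L M)"
    unfolding pw_expansion_def Let_def \<xi> A0 G'(2) q_def[symmetric]
  proof (intro conjI impI allI canon uT qF est pwvd_eq refl)
    show "u (- of_real T) = - of_real q" using uT by (simp add: u_uminus)
    show "u ` {ts, - ts} = {csqrt (of_real \<xi>), - csqrt (of_real \<xi>)}"
      using uts by (auto simp: u_uminus)
    assume nz: "\<xi> \<noteq> 0"
    have "sgn q = \<sigma>" using sgn_u[OF tV[of T] T] T by (simp add: q_def pw_q_def)
    then show "A0 = of_real (sgn q * \<bar>\<xi>\<bar> powr (1 / 4)) * ?A ts * of_real (sqrt (cmod (2 / deriv (deriv ?F) ts)))"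
      unfolding A0_def leading_coefficient[OF ts nz] by simp
  qed
  then show ?thesis by blast
qed

subsection \<open>Dependence on time and frequency\<close>

text \<open>With \<open>\<alpha> = min 0 b\<close> and \<open>\<beta> = max T^2 b\<close> the
  interval is the image of the cross under squaring. A neighbourhood of this shape is convex, as the
  fixed point requires, and closed under conjugation, as reflection requires.\<close>

definition tube :: "real \<Rightarrow> real \<Rightarrow> real \<Rightarrow> complex set" where
  "tube \<alpha> \<beta> e = (\<Union>x\<in>{\<alpha>..\<beta>}. ball (complex_of_real x) e)"

lemma open_tube: "open (tube \<alpha> \<beta> e)"
  by (auto simp: tube_def)

lemma in_tube_iff: "z \<in> tube \<alpha> \<beta> e \<longleftrightarrow> (\<exists>x\<in>{\<alpha>..\<beta>}. cmod (z - of_real x) < e)"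
  by (auto simp: tube_def dist_norm norm_minus_commute)

lemma convex_tube: "convex (tube \<alpha> \<beta> e)"
proof (rule convexI)
  fix y z and r s :: real
  assume "y \<in> tube \<alpha> \<beta> e" "z \<in> tube \<alpha> \<beta> e" and rs: "0 \<le> r" "0 \<le> s" "r + s = 1"
  then obtain y' z' where y': "y' \<in> {\<alpha>..\<beta>}" "y - of_real y' \<in> ball 0 e" and z': "z' \<in> {\<alpha>..\<beta>}" "z - of_real z' \<in> ball 0 e"
    unfolding in_tube_iff by auto
  have "r *\<^sub>R y' + s *\<^sub>R z' \<in> {\<alpha>..\<beta>}" using y' z' rs by (intro convexD) auto
  moreover have "r *\<^sub>R (y - of_real y') + s *\<^sub>R (z - of_real z') \<in> ball 0 e"
    using y' z' rs by (intro convexD) auto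
  moreover have "r *\<^sub>R (y - of_real y') + s *\<^sub>R (z - of_real z') =
      r *\<^sub>R y + s *\<^sub>R z - complex_of_real (r *\<^sub>R y' + s *\<^sub>R z')"
    by (simp add: scaleR_conv_of_real algebra_simps)
  ultimately show "r *\<^sub>R y + s *\<^sub>R z \<in> tube \<alpha> \<beta> e"
    unfolding in_tube_iff by (intro bexI[of _ "r *\<^sub>R y' + s *\<^sub>R z'"]) auto
qed

lemma compact_UN_cball:
  fixes K :: "complex set"
  assumes "compact K" shows "compact (\<Union>x\<in>K. cball x e)"
proof -
  have "(\<Union>x\<in>K. cball x e) = (\<lambda>p. fst p + snd p) ` (K \<times> cball 0 e)"
  proof (intro equalityI subsetI)
    fix z assume "z \<in> (\<Union>x\<in>K. cball x e)"
    then obtain x where "x \<in> K" "cmod (z - x) \<le> e" by (auto simp: dist_norm norm_minus_commute)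
    then show "z \<in> (\<lambda>p. fst p + snd p) ` (K \<times> cball 0 e)"
      by (intro image_eqI[of _ _ "(x, z - x)"]) auto
  next
    fix z assume "z \<in> (\<lambda>p. fst p + snd p) ` (K \<times> cball 0 e)"
    then obtain a b where "a \<in> K" "cmod b \<le> e" "z = a + b" by auto
    then show "z \<in> (\<Union>x\<in>K. cball x e)" by (intro UN_I[of a]) (auto simp: dist_norm)
  qed
  also have "compact \<dots>"
    by (intro compact_continuous_image compact_Times assms continuous_intros) auto
  finally show ?thesis .
qed

text \<open>Time enters phase and amplitude through translations of the argument, so continuity in
  \<open>t\<close> reduces to uniform continuity on a compact neighbourhood of \<open>K\<close>
  inside \<open>D\<close>.\<close>

lemma uniform_translation:
  fixes f :: "complex \<Rightarrow> complex"
  assumes D: "open D" and f: "continuous_on D f" and K: "compact K" "K \<subseteq> D" and \<eta>: "0 < \<eta>"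
  obtains r where "0 < r" "\<And>z h. z \<in> K \<Longrightarrow> cmod h < r \<Longrightarrow> z + h \<in> D \<and> cmod (f (z + h) - f z) < \<eta>"
proof -
  obtain e where e: "0 < e" "(\<Union>x\<in>K. cball x e) \<subseteq> D"
    by (rule compact_subset_open_imp_cball_epsilon_subset[OF K(1) D K(2)])
  have "uniformly_continuous_on (\<Union>x\<in>K. cball x e) f"
    using compact_uniformly_continuous[OF continuous_on_subset[OF f e(2)] compact_UN_cball[OF K(1)]] .
  then obtain d where d: "0 < d" "\<And>x x'. x \<in> (\<Union>x\<in>K. cball x e) \<Longrightarrow> x' \<in> (\<Union>x\<in>K. cball x e) \<Longrightarrow> dist x' x < d \<Longrightarrow> dist (f x') (f x) < \<eta>"
    unfolding uniformly_continuous_on_def using \<eta> by metis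
  show thesis
  proof (rule that[of "min d e"])
    fix z h assume z: "z \<in> K" and h: "cmod h < min d e"
    have 1: "z \<in> (\<Union>x\<in>K. cball x e)" using z e by force
    have 2: "z + h \<in> (\<Union>x\<in>K. cball x e)" using z h by (auto intro!: bexI[of _ z] simp: dist_norm)
    show "z + h \<in> D \<and> cmod (f (z + h) - f z) < \<eta>"
      using d(2)[OF 1 2] subsetD[OF e(2) 2] h by (simp add: dist_norm)
  qed (use d e in auto)
qed

text \<open>Meant for quotients by \<open>x - b\<close>, which are visibly real except at
  \<open>b\<close> itself.\<close>

lemma real_at_limit:
  fixes f :: "complex \<Rightarrow> complex"
  assumes S: "open S" "complex_of_real b \<in> S" and f: "continuous_on S f"
    and re: "\<And>x. of_real x \<in> S \<Longrightarrow> x \<noteq> b \<Longrightarrow> f (of_real x) \<in> \<real>"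
  shows "f (of_real b) \<in> \<real>"
proof -
  have "isCont f (of_real b)"
    by (rule continuous_on_interior[OF f]) (use S in \<open>simp add: interior_open\<close>)
  then have "isCont (\<lambda>x. f (complex_of_real x)) b"
    by (rule isCont_o2[rotated]) (intro continuous_intros)
  then have lim: "((\<lambda>x. f (complex_of_real x)) \<longlongrightarrow> f (of_real b)) (at b)"
    by (simp add: isCont_def)
  have "open ((\<lambda>x. complex_of_real x) -` S)" by (intro open_vimage S continuous_intros)
  then have "\<forall>\<^sub>F x in at b. x \<in> (\<lambda>x. complex_of_real x) -` S \<and> x \<noteq> b"
    using S(2) by (intro eventually_conj eventually_neq_at_within eventually_at_in_open') auto
  then have ev: "\<forall>\<^sub>F x in at b. f (complex_of_real x) \<in> \<real>"
    by eventually_elim (use re in auto)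
  show ?thesis
    using Lim_in_closed_set[where f="\<lambda>x. f (complex_of_real x)" and F="at b", OF closed_complex_Reals ev _ lim] by simp
qed

text \<open>The reflected function agrees with \<open>f\<close> on a real interval around
  \<open>0\<close>, hence on the connected domain by the identity theorem.\<close>

lemma cnj_symmetric_of_real_on_interval:
  assumes V: "open V" "connected V" "\<And>z. z \<in> V \<Longrightarrow> cnj z \<in> V" and f: "f holomorphic_on V"
    and T: "0 < T" "\<And>s. s \<in> {-T..T} \<Longrightarrow> of_real s \<in> V \<and> f (of_real s) \<in> \<real>" and z: "z \<in> V"
  shows "cnj (f (cnj z)) = f z"
proof -
  have im: "cnj ` V = V"
  proof (intro equalityI subsetI)
    fix z assume "z \<in> V"
    then show "z \<in> cnj ` V" using V(3)[of z] by (intro image_eqI[of _ _ "cnj z"]) auto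
  qed (use V(3) in auto)
  have "cnj \<circ> f \<circ> cnj holomorphic_on V"
    using f im V(1) by (intro holomorphic_on_compose_cnj_cnj) auto
  then have hol: "(\<lambda>z. cnj (f (cnj z)) - f z) holomorphic_on V"
    using f by (intro holomorphic_intros) (simp add: o_def)
  have "cnj (f (cnj z)) - f z = 0"
  proof (rule analytic_continuation[OF hol V(1,2), of "of_real ` {-T..T}" 0])
    show "complex_of_real ` {-T..T} \<subseteq> V" using T by auto
    show "0 \<in> V" using T(2)[of 0] T(1) by simp
    show "(0::complex) islimpt of_real ` {-T..T}"
      unfolding islimpt_approachable
    proof (intro allI impI)
      fix e :: real assume e: "0 < e"
      show "\<exists>x'\<in>complex_of_real ` {-T..T}. x' \<noteq> 0 \<and> dist x' 0 < e"
        using T(1) e by (intro bexI[of _ "of_real (min T (e/2))"] imageI) auto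
    qed
    show "cnj (f (cnj x)) - f x = 0" if x: "x \<in> complex_of_real ` {-T..T}" for x
      using x T(2) by (auto simp: Reals_cnj_iff)
  qed (rule z)
  then show ?thesis by simp
qed

lemma deriv_cnj_symmetric:
  assumes V: "open V" "z \<in> V" "cnj z \<in> V" and f: "f holomorphic_on V"
    and sym: "\<And>z. z \<in> V \<Longrightarrow> cnj (f (cnj z)) = f z"
  shows "cnj (deriv f (cnj z)) = deriv f z"
proof -
  have "(f has_field_derivative deriv f (cnj z)) (at (cnj z))"
    using f V holomorphic_derivI by blast
  then have "((cnj \<circ> f \<circ> cnj) has_field_derivative cnj (deriv f (cnj z))) (at z)"
    by (rule has_field_derivative_cnj_cnj)
  then have "(f has_field_derivative cnj (deriv f (cnj z))) (at z)"
    by (rule has_field_derivative_transform_within_open[OF _ V(1,2)]) (simp add: sym)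
  then show ?thesis by (simp add: DERIV_imp_deriv)
qed

lemma square_scaled_in_segment:
  fixes \<tau> z :: complex
  assumes c: "0 \<le> c" "c \<le> 1" and e: "\<tau>\<^sup>2 = of_real c * z\<^sup>2"
  shows "\<tau> \<in> closed_segment (- z) z"
proof -
  have seg: "of_real s * z \<in> closed_segment (- z) z" if s: "\<bar>s\<bar> \<le> 1" for s
    unfolding closed_segment_def mem_Collect_eq
    using s by (intro exI[of _ "(1 + s) / 2"]) (auto simp: complex_eq_iff field_simps abs_le_iff)
  have "\<tau>\<^sup>2 = (of_real (sqrt c) * z)\<^sup>2"
    unfolding e power_mult_distrib using c by (simp flip: of_real_power)
  then have "\<tau> = of_real (sqrt c) * z \<or> \<tau> = of_real (- sqrt c) * z"
    by (simp add: power2_eq_iff)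
  then show ?thesis using seg[of "sqrt c"] seg[of "- sqrt c"] c by auto
qed

text \<open>A converse to \<open>cross_subset_V\<close>: it turns a zero of the phase derivative in
  the variable \<open>x\<close> into a stationary point on the cross, where uniqueness is
  available.\<close>

lemma csqrt_in_cross:
  assumes ts: "ts\<^sup>2 = of_real b" and T: "0 < T" and x: "min 0 b \<le> x" "x \<le> max (T\<^sup>2) b"
  shows "csqrt (of_real x) \<in> pw_cross T ts"
proof -
  have "(0 \<le> x \<and> x \<le> T\<^sup>2) \<or> (0 \<le> x / b \<and> x / b \<le> 1 \<and> b \<noteq> 0)"
    using x T by (auto simp: divide_simps min_def max_def split: if_splits)
  then show ?thesis
  proof
    assume x: "0 \<le> x \<and> x \<le> T\<^sup>2"
    have "(csqrt (of_real x))\<^sup>2 = of_real (x / T\<^sup>2) * (of_real T)\<^sup>2"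
      unfolding power2_csqrt using T by simp
    then have "csqrt (of_real x) \<in> closed_segment (- of_real T) (of_real T)"
      using x T by (intro square_scaled_in_segment[of "x / T\<^sup>2"]) auto
    then show ?thesis by (simp add: pw_cross_def)
  next
    assume x: "0 \<le> x / b \<and> x / b \<le> 1 \<and> b \<noteq> 0"
    have "(csqrt (of_real x))\<^sup>2 = of_real (x / b) * ts\<^sup>2"
      unfolding power2_csqrt ts using x by simp
    then have "csqrt (of_real x) \<in> closed_segment (- ts) ts"
      using x by (intro square_scaled_in_segment[of "x / b"]) auto
    then show ?thesis by (simp add: pw_cross_def)
  qed
qed

lemma abs_Im_Ln_le:
  assumes "0 < r" "r \<le> Re z" "\<bar>Im z\<bar> \<le> c * r"
  shows "\<bar>Im (Ln z)\<bar> \<le> c"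
proof -
  have "z \<noteq> 0" "0 < Re z" using assms by auto
  then have "Im (Ln z) = arctan (Im z / Re z)" by (simp add: Im_Ln_eq)
  moreover have "\<bar>arctan y\<bar> \<le> \<bar>y\<bar>" for y :: real
  proof -
    have "norm (arctan y - arctan 0) \<le> 1 * norm (y - 0)"
    proof (rule field_differentiable_bound[of UNIV _ "\<lambda>x. inverse (1 + x\<^sup>2)"])
      show "norm (inverse (1 + x\<^sup>2)) \<le> 1" for x :: real
        using inverse_le_1_iff[of "1 + x\<^sup>2"] by (simp add: add_nonneg_nonneg)
    qed (auto intro: DERIV_arctan)
    then show ?thesis by simp
  qed
  moreover have "\<bar>Im z / Re z\<bar> \<le> c"
  proof -
    have "0 \<le> c * r" using assms(3) abs_ge_zero order_trans by blast
    then have c: "0 \<le> c" using assms(1) by (simp add: zero_le_mult_iff)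
    have "\<bar>Im z\<bar> \<le> c * Re z" using assms mult_left_mono[OF assms(2) c] by linarith
    then show ?thesis using assms by (simp add: abs_divide divide_le_eq)
  qed
  ultimately show ?thesis using order_trans by metis
qed

text \<open>The real part of the complex derivative is the real derivative, and its imaginary part
  is the derivative of the constant \<open>0\<close>. The interval is open so that two-sided
  derivatives can be compared.\<close>

lemma real_continuation_deriv:
  fixes f :: "real \<Rightarrow> real"
  assumes fC: "fC holomorphic_on D" "open D"
    and eq: "\<And>s. s \<in> {l<..<r} \<Longrightarrow> of_real s \<in> D \<and> fC (of_real s) = of_real (f s)" and s: "s \<in> {l<..<r}"
  shows "deriv fC (of_real s) = of_real (deriv f s)"
proof -
  have "(fC has_field_derivative deriv fC (of_real s)) (at (of_real s))"
    using fC eq[OF s] holomorphic_derivI by blast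
  then have "((\<lambda>s. fC (of_real s)) has_vector_derivative deriv fC (of_real s)) (at s)"
    by (rule has_vector_derivative_real_field)
  then have D: "((\<lambda>s. complex_of_real (f s)) has_vector_derivative deriv fC (of_real s)) (at s)"
    by (rule has_vector_derivative_transform_within_open[where S="{l<..<r}"]) (use eq s in auto)
  have "((\<lambda>s. Re (complex_of_real (f s))) has_vector_derivative Re (deriv fC (of_real s))) (at s)"
    using bounded_linear.has_vector_derivative[OF bounded_linear_Re D] .
  then have "(f has_real_derivative Re (deriv fC (of_real s))) (at s)"
    by (simp add: has_real_derivative_iff_has_vector_derivative)
  then have 1: "deriv f s = Re (deriv fC (of_real s))" by (rule DERIV_imp_deriv)
  have "((\<lambda>s. Im (complex_of_real (f s))) has_vector_derivative Im (deriv fC (of_real s))) (at s)"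
    using bounded_linear.has_vector_derivative[OF bounded_linear_Im D] .
  then have "((\<lambda>s::real. 0::real) has_vector_derivative Im (deriv fC (of_real s))) (at s)" by simp
  then have "Im (deriv fC (of_real s)) = 0"
    using vector_derivative_unique_at[OF _ has_vector_derivative_const] by blast
  with 1 show ?thesis by (simp add: complex_eq_iff)
qed

section \<open>The phase derivative in the variable \<open>x = \<tau>^2\<close>\<close>

locale pw_data =
  fixes w a \<psi> :: "real \<Rightarrow> real" and wC aC \<psi>C :: "complex \<Rightarrow> complex"
    and I :: "real set" and D Dw :: "complex set" and T :: real
  assumes T: "0 < T"
    and a: "continuation_on aC a I D" and \<psi>: "continuation_on \<psi>C \<psi> I D"
    and w: "continuation_on wC w {- T / 2..T / 2} Dw"
begin

definition dom :: "real \<Rightarrow> complex set" where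
  "dom t = {\<tau>. of_real t + \<tau> / 2 \<in> D \<and> of_real t - \<tau> / 2 \<in> D \<and> \<tau> / 2 \<in> Dw \<and> - (\<tau> / 2) \<in> Dw}"

text \<open>Any square root would do, since the phase derivative is even; \<open>csqrt\<close>
  merely fixes one.\<close>

definition E :: "real \<Rightarrow> real \<Rightarrow> complex \<Rightarrow> complex" where
  "E t fb x = deriv (pw_phase \<psi>C t fb) (csqrt x)"

abbreviation adm :: "real \<Rightarrow> real \<Rightarrow> complex \<Rightarrow> bool" where
  "adm \<equiv> admissible I D Dw T \<psi> \<psi>C"

lemma open_D: "open D" and open_Dw: "open Dw"
  using a w by (auto simp: continuation_on_def)

lemma hol: "aC holomorphic_on D" "\<psi>C holomorphic_on D" "wC holomorphic_on Dw"
  using a \<psi> w by (auto simp: continuation_on_def)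

lemma dom_uminus: "- \<tau> \<in> dom t \<longleftrightarrow> \<tau> \<in> dom t"
  by (auto simp: dom_def)

lemma dom_square: "\<tau>\<^sup>2 = \<tau>'\<^sup>2 \<Longrightarrow> \<tau> \<in> dom t \<longleftrightarrow> \<tau>' \<in> dom t"
  using dom_uminus[of \<tau>' t] by (auto simp: power2_eq_iff)

lemma open_dom: "open (dom t)"
proof -
  have "dom t = (\<lambda>\<tau>. of_real t + \<tau> / 2) -` D \<inter> (\<lambda>\<tau>. of_real t - \<tau> / 2) -` D \<inter>
      (\<lambda>\<tau>. \<tau> / 2) -` Dw \<inter> (\<lambda>\<tau>. - (\<tau> / 2)) -` Dw"
    by (auto simp: dom_def)
  then show ?thesis
    by (simp only:) (intro open_Int open_vimage open_D open_Dw continuous_intros; simp)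
qed

lemma has_field_derivative_shifts:
  assumes f: "f holomorphic_on D" and \<tau>: "\<tau> \<in> dom t"
  shows "((\<lambda>\<tau>. f (of_real t + \<tau> / 2)) has_field_derivative deriv f (of_real t + \<tau> / 2) * (1/2)) (at \<tau>)"
    and "((\<lambda>\<tau>. f (of_real t - \<tau> / 2)) has_field_derivative deriv f (of_real t - \<tau> / 2) * - (1/2)) (at \<tau>)"
proof -
  have Df: "(f has_field_derivative deriv f (of_real t + \<tau> / 2)) (at (of_real t + \<tau> / 2))"
    "(f has_field_derivative deriv f (of_real t - \<tau> / 2)) (at (of_real t - \<tau> / 2))"
    using \<tau> f open_D holomorphic_derivI unfolding dom_def by blast+
  show "((\<lambda>\<tau>. f (of_real t + \<tau> / 2)) has_field_derivative deriv f (of_real t + \<tau> / 2) * (1/2)) (at \<tau>)"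
    by (rule DERIV_chain2[where g="\<lambda>\<tau>. of_real t + \<tau> / 2", OF Df(1)]) (auto intro!: derivative_eq_intros)
  show "((\<lambda>\<tau>. f (of_real t - \<tau> / 2)) has_field_derivative deriv f (of_real t - \<tau> / 2) * - (1/2)) (at \<tau>)"
    by (rule DERIV_chain2[where g="\<lambda>\<tau>. of_real t - \<tau> / 2", OF Df(2)]) (auto intro!: derivative_eq_intros)
qed

lemma deriv_phase:
  assumes "\<tau> \<in> dom t"
  shows "deriv (pw_phase \<psi>C t fb) \<tau> =
    (deriv \<psi>C (of_real t + \<tau> / 2) + deriv \<psi>C (of_real t - \<tau> / 2)) / 2 - of_real (2 * pi * fb)"
proof -
  have 3: "((\<lambda>\<tau>. of_real (2 * pi * fb) * \<tau>) has_field_derivative of_real (2 * pi * fb)) (at \<tau>)"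
    by (auto intro!: derivative_eq_intros)
  have "(pw_phase \<psi>C t fb has_field_derivative deriv \<psi>C (of_real t + \<tau> / 2) * (1/2) -
      deriv \<psi>C (of_real t - \<tau> / 2) * - (1/2) - of_real (2 * pi * fb)) (at \<tau>)"
    unfolding pw_phase_def[abs_def] by (intro DERIV_diff 3 has_field_derivative_shifts hol assms)
  from DERIV_imp_deriv[OF this] show ?thesis by (simp add: field_simps)
qed

lemma phase_holomorphic: "V \<subseteq> dom t \<Longrightarrow> pw_phase \<psi>C t fb holomorphic_on V"
  by (rule pw_phase_holomorphic[OF hol(2)]) (auto simp: dom_def)

lemma E_props:
  assumes S: "open S" and dom: "\<And>\<tau>. \<tau>\<^sup>2 \<in> S \<Longrightarrow> \<tau> \<in> dom t"
  shows "E t fb holomorphic_on S" and "\<And>\<tau>. \<tau>\<^sup>2 \<in> S \<Longrightarrow> E t fb (\<tau>\<^sup>2) = deriv (pw_phase \<psi>C t fb) \<tau>"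
proof -
  have hol: "deriv (pw_phase \<psi>C t fb) holomorphic_on {\<tau>. \<tau>\<^sup>2 \<in> S}"
    using dom by (intro holomorphic_deriv open_sqrt_preimage S phase_holomorphic) auto
  have even: "deriv (pw_phase \<psi>C t fb) (- \<tau>) = deriv (pw_phase \<psi>C t fb) \<tau>" if \<tau>: "\<tau>\<^sup>2 \<in> S" for \<tau>
    using deriv_phase[OF dom[OF \<tau>], of fb] deriv_phase[of "- \<tau>" t fb] dom_uminus[of \<tau> t] dom[OF \<tau>]
    by (simp add: add.commute)
  show "E t fb holomorphic_on S"
    unfolding E_def[abs_def] by (rule even_holomorphic_descends(1)[OF S hol even])
  show "\<And>\<tau>. \<tau>\<^sup>2 \<in> S \<Longrightarrow> E t fb (\<tau>\<^sup>2) = deriv (pw_phase \<psi>C t fb) \<tau>"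
    unfolding E_def by (rule even_holomorphic_descends(2)[OF S hol even])
qed

text \<open>For negative \<open>x\<close> the root is imaginary and reality cannot be read off from
  the real data. Reflection gives \<open>F'(cnj \<tau>) = cnj (F' \<tau>)\<close>, and
  \<open>cnj \<tau>\<close> has the same real square \<open>x\<close> as \<open>\<tau>\<close>, so
  the value of \<open>E\<close> is its own conjugate.\<close>

lemma E_real:
  assumes S: "S = tube \<alpha> \<beta> e" and ab: "\<alpha> \<le> 0" "T\<^sup>2 \<le> \<beta>" "0 < e"
    and dom: "\<And>\<tau>. \<tau>\<^sup>2 \<in> S \<Longrightarrow> \<tau> \<in> dom t"
    and tI: "{t - T / 2..t + T / 2} \<subseteq> I" and x: "of_real x \<in> S"
  shows "E t fb (of_real x) \<in> \<real>"
proof -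
  let ?F = "pw_phase \<psi>C t fb"
  define V where "V = {\<tau>::complex. \<tau>\<^sup>2 \<in> S}"
  have oS: "open S" unfolding S by (rule open_tube)
  have rS: "of_real r \<in> S" if "\<alpha> \<le> r" "r \<le> \<beta>" for r
    unfolding S in_tube_iff using that ab(3) by (intro bexI[of _ r]) auto
  have oV: "open V" unfolding V_def by (rule open_sqrt_preimage[OF oS])
  have S0: "0 \<in> S" using rS[of 0] ab(1) order_trans[OF zero_le_power2 ab(2)] by simp
  have "closed_segment 0 \<tau> \<subseteq> V" if \<tau>: "\<tau> \<in> V" for \<tau>
  proof
    fix z assume "z \<in> closed_segment 0 \<tau>"
    then obtain s where s: "0 \<le> s" "s \<le> 1" "z = of_real s * \<tau>"
      by (auto simp: closed_segment_def scaleR_conv_of_real)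
    have "0 + of_real (s\<^sup>2) * (\<tau>\<^sup>2 - 0) \<in> S"
      using \<tau> s by (intro segment_in_convex S0) (auto simp: S convex_tube V_def power_le_one)
    then show "z \<in> V" by (simp add: V_def s(3) power_mult_distrib)
  qed
  then have "starlike V" unfolding starlike_def using S0 by (intro bexI[of _ 0]) (auto simp: V_def)
  then have cV: "connected V" by (rule starlike_imp_connected)
  have cnjV: "cnj z \<in> V" if z: "z \<in> V" for z
  proof -
    obtain r where r: "r \<in> {\<alpha>..\<beta>}" "cmod (z\<^sup>2 - of_real r) < e"
      using z by (auto simp: V_def S in_tube_iff)
    have "cmod ((cnj z)\<^sup>2 - of_real r) = cmod (cnj (z\<^sup>2 - of_real r))" by simp
    also have "\<dots> = cmod (z\<^sup>2 - of_real r)" by (rule complex_mod_cnj)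
    finally show ?thesis using r unfolding V_def S in_tube_iff mem_Collect_eq by (intro bexI[of _ r]) auto
  qed
  have Fhol: "?F holomorphic_on V" using dom by (intro phase_holomorphic) (auto simp: V_def)
  have Freal: "of_real s \<in> V \<and> ?F (of_real s) \<in> \<real>" if s: "s \<in> {-T..T}" for s
  proof
    have "s\<^sup>2 \<le> T\<^sup>2" using s by (auto simp: abs_le_square_iff[symmetric])
    then have "s\<^sup>2 \<le> \<beta>" "\<alpha> \<le> s\<^sup>2" using ab by (auto intro: order_trans[OF _ zero_le_power2])
    then show "of_real s \<in> V" using rS[of "s\<^sup>2"] by (simp add: V_def)
    have I: "t + s / 2 \<in> I" "t - s / 2 \<in> I" using s tI by (auto simp: subset_iff field_simps)
    have "\<psi>C (of_real (t + s / 2)) = of_real (\<psi> (t + s / 2))" "\<psi>C (of_real (t - s / 2)) = of_real (\<psi> (t - s / 2))"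
      using \<psi> I by (auto simp: continuation_on_def)
    then have "?F (of_real s) = of_real (\<psi> (t + s / 2) - \<psi> (t - s / 2) - 2 * pi * fb * s)"
      by (simp add: pw_phase_def)
    then show "?F (of_real s) \<in> \<real>" by simp
  qed
  define \<tau> where "\<tau> = csqrt (of_real x)"
  have \<tau>: "\<tau> \<in> V" "cnj \<tau> \<in> V" "\<tau>\<^sup>2 = of_real x" using x cnjV by (auto simp: \<tau>_def V_def)
  have "cnj (deriv ?F (cnj \<tau>)) = deriv ?F \<tau>"
    by (rule deriv_cnj_symmetric[OF oV \<tau>(1,2) Fhol])
      (rule cnj_symmetric_of_real_on_interval[OF oV cV cnjV Fhol T Freal])
  moreover have "deriv ?F (cnj \<tau>) = E t fb ((cnj \<tau>)\<^sup>2)"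
    using E_props(2)[OF oS dom, of "cnj \<tau>"] \<tau>(2) by (simp add: V_def)
  moreover have "(cnj \<tau>)\<^sup>2 = of_real x" using \<tau>(3) by (metis complex_cnj_complex_of_real complex_cnj_power)
  ultimately show ?thesis
    by (simp add: E_def \<tau>_def Reals_cnj_iff)
qed

lemma admD:
  assumes "adm t fb ts"
  shows "{t - T / 2..t + T / 2} \<subseteq> I" "ts\<^sup>2 = of_real (Re (ts\<^sup>2))" "ts \<in> pw_cross T ts"
    "deriv (pw_phase \<psi>C t fb) ts = 0"
    "\<And>\<tau>. \<tau> \<in> pw_cross T ts \<Longrightarrow> \<tau> \<in> dom t"
    "\<And>\<tau>. \<tau> \<in> pw_cross T ts \<Longrightarrow> deriv (pw_phase \<psi>C t fb) \<tau> = 0 \<Longrightarrow> \<tau>\<^sup>2 = ts\<^sup>2"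
    "ts \<noteq> 0 \<Longrightarrow> deriv (deriv (pw_phase \<psi>C t fb)) ts \<noteq> 0"
proof -
  have "stationary_pair D Dw T \<psi>C t fb ts" using assms by (simp add: admissible_def)
  note st = this[unfolded stationary_pair_def]
  note ri = conjunct1[OF st] and cross = conjunct1[OF conjunct2[OF st]]
    and * = conjunct1[OF conjunct2[OF conjunct2[OF st]]] and simple = conjunct2[OF conjunct2[OF conjunct2[OF st]]]
  show "{t - T / 2..t + T / 2} \<subseteq> I" using assms by (simp add: admissible_def)
  have "ts\<^sup>2 \<in> \<real>"
  proof (cases "ts \<in> \<real>")
    case True then show ?thesis by (rule Reals_power)
  next
    case False
    then have "(\<i> * ts)\<^sup>2 \<in> \<real>" using ri by (intro Reals_power) blast
    then show ?thesis by (simp add: power_mult_distrib)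
  qed
  then show "ts\<^sup>2 = of_real (Re (ts\<^sup>2))" by simp
  show "ts \<in> pw_cross T ts" "deriv (pw_phase \<psi>C t fb) ts = 0" using * by blast+
  show "\<And>\<tau>. \<tau> \<in> pw_cross T ts \<Longrightarrow> \<tau> \<in> dom t" using cross by (simp add: dom_def)
  show "\<tau>\<^sup>2 = ts\<^sup>2" if "\<tau> \<in> pw_cross T ts" "deriv (pw_phase \<psi>C t fb) \<tau> = 0" for \<tau>
  proof -
    have "\<tau> \<in> {ts, - ts}" unfolding *[symmetric] using that by simp
    then show ?thesis by auto
  qed
  show "ts \<noteq> 0 \<Longrightarrow> deriv (deriv (pw_phase \<psi>C t fb)) ts \<noteq> 0" using simple by simp
qed

text \<open>Transfers the curvature hypothesis from iterated real derivatives of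
  \<open>inst_freq\<close> to the holomorphic continuation, read off at
  \<open>chi = 1\<close>.\<close>

lemma third_derivative_nonzero:
  assumes "adm t fb ts" shows "deriv (deriv (deriv \<psi>C)) (of_real t) \<noteq> 0"
proof
  assume 0: "deriv (deriv (deriv \<psi>C)) (of_real t) = 0"
  define c where "c = 1 / (2 * pi)"
  let ?J = "{t - T / 2<..<t + T / 2}"
  have tJ: "t \<in> ?J" using T by auto
  have J: "of_real s \<in> D \<and> \<psi>C (of_real s) = of_real (\<psi> s)" if s: "s \<in> ?J" for s
  proof -
    have "s \<in> I" using admD(1)[OF assms] s by auto
    then show ?thesis using \<psi> by (auto simp: continuation_on_def)
  qed
  have hols: "deriv \<psi>C holomorphic_on D" "deriv (deriv \<psi>C) holomorphic_on D"
    using hol open_D by (auto intro!: holomorphic_deriv)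
  have 1: "of_real s \<in> D \<and> of_real c * deriv \<psi>C (of_real s) = of_real (inst_freq 1 \<psi> s)" if s: "s \<in> ?J" for s
    using real_continuation_deriv[OF hol(2) open_D J s] J[OF s] by (simp add: inst_freq_def c_def)
  have cd: "deriv (\<lambda>z. of_real c * g z) z = of_real c * deriv g z" if "g holomorphic_on D" "z \<in> D" for g z
    using that open_D holomorphic_on_imp_differentiable_at by (intro deriv_cmult) blast
  have h1: "(\<lambda>z. of_real c * deriv \<psi>C z) holomorphic_on D"
    and h2: "(\<lambda>z. of_real c * deriv (deriv \<psi>C) z) holomorphic_on D"
    by (intro holomorphic_on_mult holomorphic_on_const hols)+
  have 2: "of_real s \<in> D \<and> of_real c * deriv (deriv \<psi>C) (of_real s) = of_real (deriv (inst_freq 1 \<psi>) s)" if s: "s \<in> ?J" for s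
    using real_continuation_deriv[OF h1 open_D 1 s] cd[OF hols(1)] J[OF s] by simp
  have "of_real c * deriv (deriv (deriv \<psi>C)) (of_real t) = of_real (deriv (deriv (inst_freq 1 \<psi>)) t)"
    using real_continuation_deriv[OF h2 open_D 2 tJ] cd[OF hols(2)] J[OF tJ] by simp
  then have "(deriv ^^ 2) (inst_freq 1 \<psi>) t = 0" using 0 by (simp add: numeral_2_eq_2)
  then show False using assms by (auto simp: admissible_def)
qed

end

section \<open>Simplicity of the zero and the sign of the cofactor\<close>

lemma holomorphic_factor_zero:
  assumes "open S" "f holomorphic_on S" "f z = 0"
  obtains l where "l holomorphic_on S" "\<And>x. f x = (x - z) * l x"
proof
  show "(\<lambda>x. if x = z then deriv f z else (f x - f z) / (x - z)) holomorphic_on S"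
    by (rule pole_lemma_open[OF assms(2,1)])
  show "f x = (x - z) * (if x = z then deriv f z else (f x - f z) / (x - z))" for x
    using assms(3) by simp
qed

lemma compact_sqrt_preimage:
  assumes "compact K" shows "compact {\<tau>::complex. \<tau>\<^sup>2 \<in> K}"
proof -
  have "closed ((\<lambda>\<tau>::complex. \<tau>\<^sup>2) -` K)"
    by (intro closed_vimage compact_imp_closed[OF assms] continuous_intros)
  then have "closed {\<tau>::complex. \<tau>\<^sup>2 \<in> K}" by (simp add: vimage_def)
  moreover have "bounded {\<tau>::complex. \<tau>\<^sup>2 \<in> K}"
  proof -
    obtain B where B: "\<And>x. x \<in> K \<Longrightarrow> cmod x \<le> B"
      using compact_imp_bounded[OF assms] by (auto simp: bounded_iff)
    have "cmod \<tau> \<le> B + 1" if "\<tau>\<^sup>2 \<in> K" for \<tau>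
    proof -
      have 1: "(cmod \<tau>)\<^sup>2 \<le> B" using B[OF that] by (simp add: norm_power)
      have "2 * cmod \<tau> \<le> (cmod \<tau>)\<^sup>2 + 1"
        using zero_le_power2[of "cmod \<tau> - 1"] unfolding power2_diff by simp
      with 1 norm_ge_zero[of \<tau>] show ?thesis by linarith
    qed
    then show ?thesis unfolding bounded_iff by blast
  qed
  ultimately show ?thesis using compact_eq_bounded_closed by blast
qed

context pw_data
begin

text \<open>At separate stationary points \<open>F''(ts) = 2 ts k(b)\<close>, and simplicity
  applies. At coalescence this carries no information and the next derivative decides:
  \<open>F'''(0)\<close> is \<open>2 k(0)\<close> on one side and \<open>\<psi>'''(t) / 4\<close> on
  the other. This is where the curvature of the instantaneous frequency curve enters.\<close>

lemma factor_nonzero: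
  assumes adm: "adm t fb ts" and ts: "ts\<^sup>2 = of_real b"
    and S: "open S" "of_real b \<in> S" and dom: "\<And>\<tau>. \<tau>\<^sup>2 \<in> S \<Longrightarrow> \<tau> \<in> dom t"
    and k: "k holomorphic_on S" "\<And>x. x \<in> S \<Longrightarrow> E t fb x = (x - of_real b) * k x"
  shows "k (of_real b) \<noteq> 0"
proof
  assume k0: "k (of_real b) = 0"
  let ?F = "pw_phase \<psi>C t fb"
  define V where "V = {\<tau>::complex. \<tau>\<^sup>2 \<in> S}"
  have oV: "open V" unfolding V_def by (rule open_sqrt_preimage[OF S(1)])
  have tsV: "ts \<in> V" using S(2) ts by (simp add: V_def)
  have Dk: "((\<lambda>\<tau>. k (\<tau>\<^sup>2)) has_field_derivative deriv k (\<tau>\<^sup>2) * (2 * \<tau>)) (at \<tau>)" if \<tau>: "\<tau> \<in> V" for \<tau>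
  proof (rule DERIV_chain2[where g="\<lambda>\<tau>. \<tau>\<^sup>2"])
    show "(k has_field_derivative deriv k (\<tau>\<^sup>2)) (at (\<tau>\<^sup>2))"
      using k(1) S(1) \<tau> holomorphic_derivI unfolding V_def by blast
  qed (auto intro!: derivative_eq_intros)
  have D2: "(deriv ?F has_field_derivative 2 * \<tau> * k (\<tau>\<^sup>2) + (\<tau>\<^sup>2 - of_real b) * (deriv k (\<tau>\<^sup>2) * (2 * \<tau>))) (at \<tau>)"
    if \<tau>: "\<tau> \<in> V" for \<tau>
  proof -
    have "((\<lambda>\<tau>. (\<tau>\<^sup>2 - of_real b) * k (\<tau>\<^sup>2)) has_field_derivative
        2 * \<tau> * k (\<tau>\<^sup>2) + (\<tau>\<^sup>2 - of_real b) * (deriv k (\<tau>\<^sup>2) * (2 * \<tau>))) (at \<tau>)"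
      by (rule derivative_eq_intros Dk[OF \<tau>] refl)+ (simp add: algebra_simps)
    then show ?thesis
    proof (rule has_field_derivative_transform_within_open[OF _ oV \<tau>])
      fix x assume "x \<in> V"
      then show "(x\<^sup>2 - of_real b) * k (x\<^sup>2) = deriv ?F x"
        using E_props(2)[OF S(1) dom, of x fb] k(2)[of "x\<^sup>2"] by (simp add: V_def)
    qed
  qed
  show False
  proof (cases "ts = 0")
    case False
    have "deriv (deriv ?F) ts = 0"
      using DERIV_imp_deriv[OF D2[OF tsV]] k0 by (simp add: ts)
    then show False using admD(7)[OF adm False] by simp
  next
    case True
    then have b0: "b = 0" using ts by simp
    have V0: "0 \<in> V" using tsV True by simp
    let ?p = "deriv (deriv \<psi>C)"
    have hols: "deriv \<psi>C holomorphic_on D" "?p holomorphic_on D"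
      using hol open_D by (auto intro!: holomorphic_deriv)
    have eq: "(?p (of_real t + \<tau> / 2) - ?p (of_real t - \<tau> / 2)) / 4 = 2 * \<tau> * k (\<tau>\<^sup>2) + (\<tau>\<^sup>2 - of_real b) * (deriv k (\<tau>\<^sup>2) * (2 * \<tau>))"
      if \<tau>: "\<tau> \<in> V" for \<tau>
    proof -
      have d: "\<tau> \<in> dom t" using \<tau> dom by (simp add: V_def)
      have "((\<lambda>\<tau>. (deriv \<psi>C (of_real t + \<tau> / 2) + deriv \<psi>C (of_real t - \<tau> / 2)) / 2 - of_real (2 * pi * fb))
          has_field_derivative (?p (of_real t + \<tau> / 2) * (1/2) + ?p (of_real t - \<tau> / 2) * - (1/2)) / 2 - 0) (at \<tau>)"
        by (intro DERIV_diff DERIV_cdivide DERIV_add has_field_derivative_shifts hols d DERIV_const)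
      then have "(deriv ?F has_field_derivative (?p (of_real t + \<tau> / 2) * (1/2) + ?p (of_real t - \<tau> / 2) * - (1/2)) / 2 - 0) (at \<tau>)"
        by (rule has_field_derivative_transform_within_open[OF _ open_dom d]) (simp add: deriv_phase)
      from DERIV_unique[OF this D2[OF \<tau>]] show ?thesis by (simp add: field_simps)
    qed
    have "((\<lambda>\<tau>. (?p (of_real t + \<tau> / 2) - ?p (of_real t - \<tau> / 2)) / 4)
        has_field_derivative (deriv ?p (of_real t + 0 / 2) * (1/2) - deriv ?p (of_real t - 0 / 2) * - (1/2)) / 4) (at 0)"
      using V0 dom by (intro DERIV_cdivide DERIV_diff has_field_derivative_shifts hols) (auto simp: V_def)
    then have 1: "((\<lambda>\<tau>. (?p (of_real t + \<tau> / 2) - ?p (of_real t - \<tau> / 2)) / 4)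
        has_field_derivative deriv ?p (of_real t) / 4) (at 0)" by simp
    have hk': "(\<lambda>\<tau>. deriv k (\<tau>\<^sup>2)) holomorphic_on V"
      by (rule holomorphic_on_compose_image[OF holomorphic_deriv[OF k(1) S(1)]]) (auto simp: V_def intro!: holomorphic_intros)
    have Dk': "((\<lambda>\<tau>. deriv k (\<tau>\<^sup>2)) has_field_derivative deriv (\<lambda>\<tau>. deriv k (\<tau>\<^sup>2)) 0) (at 0)"
      by (rule holomorphic_derivI[OF hk' oV V0])
    have "((\<lambda>\<tau>. 2 * \<tau> * k (\<tau>\<^sup>2) + (\<tau>\<^sup>2 - of_real b) * (deriv k (\<tau>\<^sup>2) * (2 * \<tau>))) has_field_derivative 2 * k 0) (at 0)"
      by (rule derivative_eq_intros Dk[OF V0] Dk' refl)+ (simp add: b0)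
    then have "((\<lambda>\<tau>. (?p (of_real t + \<tau> / 2) - ?p (of_real t - \<tau> / 2)) / 4) has_field_derivative 2 * k 0) (at 0)"
      by (rule has_field_derivative_transform_within_open[OF _ oV V0]) (simp add: eq)
    from DERIV_unique[OF 1 this] have "deriv ?p (of_real t) = 0" using k0 b0 by simp
    then show False using third_derivative_nonzero[OF adm] by simp
  qed
qed

text \<open>The bad points, with square within \<open>1\<close> of \<open>J\<close> but outside
  \<open>dom t\<close>, form a compact set on which the distance of the square to \<open>J\<close>
  has a positive minimum; half of it is a safe margin.\<close>

lemma sqrt_preimage_margin:
  assumes J: "compact J" "J \<noteq> {}" and dom: "\<And>\<tau>. \<tau>\<^sup>2 \<in> J \<Longrightarrow> \<tau> \<in> dom t"
  obtains e where "0 < e" "\<And>\<tau>. \<tau>\<^sup>2 \<in> (\<Union>x\<in>J. cball x e) \<Longrightarrow> \<tau> \<in> dom t"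
proof -
  define C where "C = {\<tau>. \<tau>\<^sup>2 \<in> (\<Union>x\<in>J. cball x 1)} - dom t"
  have C: "compact C"
    unfolding C_def by (intro compact_diff compact_sqrt_preimage compact_UN_cball J open_dom)
  show thesis
  proof (cases "C = {}")
    case True
    then show thesis by (intro that[of 1]) (auto simp: C_def)
  next
    case False
    have "continuous_on C (\<lambda>\<tau>. infdist (\<tau>\<^sup>2) J)" by (intro continuous_intros)
    then obtain \<tau>0 where \<tau>0: "\<tau>0 \<in> C" "\<And>\<tau>. \<tau> \<in> C \<Longrightarrow> infdist (\<tau>0\<^sup>2) J \<le> infdist (\<tau>\<^sup>2) J"
      using continuous_attains_inf[OF C False] by blast
    define m where "m = infdist (\<tau>0\<^sup>2) J"
    have "\<tau>0\<^sup>2 \<notin> J" using \<tau>0(1) dom by (auto simp: C_def)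
    then have m: "0 < m"
      unfolding m_def using J compact_imp_closed by (intro infdist_pos_not_in_closed) auto
    show thesis
    proof (rule that[of "min 1 (m/2)"])
      fix \<tau> assume "\<tau>\<^sup>2 \<in> (\<Union>x\<in>J. cball x (min 1 (m/2)))"
      then obtain x where x: "x \<in> J" "dist (\<tau>\<^sup>2) x \<le> 1" "dist (\<tau>\<^sup>2) x \<le> m/2" by (auto simp: dist_commute)
      show "\<tau> \<in> dom t"
      proof (rule ccontr)
        assume "\<tau> \<notin> dom t"
        then have "\<tau> \<in> C" using x by (auto simp: C_def dist_commute)
        then have "m \<le> infdist (\<tau>\<^sup>2) J" using \<tau>0(2) by (simp add: m_def)
        also have "\<dots> \<le> dist (\<tau>\<^sup>2) x" using x(1) by (rule infdist_le)
        finally show False using x(3) m by simp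
      qed
    qed (use m in auto)
  qed
qed

lemma tube_subset_UN_cball:
  assumes "e \<le> d" shows "tube \<alpha> \<beta> e \<subseteq> (\<Union>x\<in>complex_of_real ` {\<alpha>..\<beta>}. cball x d)"
proof
  fix z assume "z \<in> tube \<alpha> \<beta> e"
  then obtain x where x: "x \<in> {\<alpha>..\<beta>}" "z \<in> ball (of_real x) e" unfolding tube_def by blast
  then have "z \<in> cball (of_real x) d" using assms by simp
  then show "z \<in> (\<Union>x\<in>complex_of_real ` {\<alpha>..\<beta>}. cball x d)" using x(1) by blast
qed

text \<open>On the real interval the cofactor \<open>k\<close> is real and never zero: a zero away
  from \<open>b\<close> would be another stationary point on the cross, and at \<open>b\<close> the
  zero of \<open>E\<close> is simple. So \<open>k\<close> has one sign \<open>\<sigma>\<close>, and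
  a thin tube keeps it in a narrow sector around that sign.\<close>

lemma base_point:
  assumes adm: "adm t fb ts"
  defines "b \<equiv> Re (ts\<^sup>2)"
  defines "\<alpha> \<equiv> min 0 b" and "\<beta> \<equiv> max (T\<^sup>2) b"
  obtains \<delta> \<sigma> c k B where "0 < \<delta>" "\<sigma> = 1 \<or> \<sigma> = - (1::real)" "0 < c"
    "\<And>\<tau>. \<tau>\<^sup>2 \<in> (\<Union>x\<in>complex_of_real ` {\<alpha>..\<beta>}. cball x \<delta>) \<Longrightarrow> \<tau> \<in> dom t"
    "k holomorphic_on tube \<alpha> \<beta> \<delta>"
    "\<And>x. x \<in> tube \<alpha> \<beta> \<delta> \<Longrightarrow> E t fb x = (x - of_real b) * k x"
    "\<And>x. x \<in> tube \<alpha> \<beta> \<delta> \<Longrightarrow> 2 * c < \<sigma> * Re (k x) \<and> \<bar>Im (k x)\<bar> < c / 80 \<and> cmod (k x) < B"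
proof -
  let ?F = "pw_phase \<psi>C t fb"
  have ts: "ts\<^sup>2 = of_real b" using admD(2)[OF adm] by (simp add: b_def)
  have ab: "\<alpha> \<le> 0" "T\<^sup>2 \<le> \<beta>" "\<alpha> \<le> b" "b \<le> \<beta>" by (auto simp: \<alpha>_def \<beta>_def)
  have "0 \<le> \<beta>" using order_trans[OF zero_le_power2 ab(2)] .
  define J where "J = complex_of_real ` {\<alpha>..\<beta>}"
  have J: "compact J" "J \<noteq> {}"
    using ab \<open>0 \<le> \<beta>\<close> unfolding J_def by (auto intro!: compact_continuous_image continuous_intros)
  have cross: "csqrt (of_real x) \<in> pw_cross T ts" if "x \<in> {\<alpha>..\<beta>}" for x
    using that by (intro csqrt_in_cross[OF ts T]) (auto simp: \<alpha>_def \<beta>_def)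
  have domJ: "\<tau> \<in> dom t" if J': "\<tau>\<^sup>2 \<in> J" for \<tau>
  proof -
    obtain x where x: "x \<in> {\<alpha>..\<beta>}" "\<tau>\<^sup>2 = of_real x" using J' by (auto simp: J_def)
    have "csqrt (of_real x) \<in> dom t" using admD(5)[OF adm cross[OF x(1)]] .
    moreover have "\<tau>\<^sup>2 = (csqrt (of_real x))\<^sup>2" unfolding power2_csqrt by (rule x(2))
    ultimately show ?thesis using dom_square by blast
  qed
  obtain e0 where e0: "0 < e0" "\<And>\<tau>. \<tau>\<^sup>2 \<in> (\<Union>x\<in>J. cball x e0) \<Longrightarrow> \<tau> \<in> dom t"
    using sqrt_preimage_margin[OF J domJ] by blast
  define S where "S = tube \<alpha> \<beta> e0"
  have oS: "open S" unfolding S_def by (rule open_tube)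
  have domS: "\<tau> \<in> dom t" if "\<tau>\<^sup>2 \<in> S" for \<tau>
    using that e0(2) tube_subset_UN_cball[of e0 e0 \<alpha> \<beta>] unfolding S_def J_def by blast
  have rS: "of_real x \<in> S" if "x \<in> {\<alpha>..\<beta>}" for x
    unfolding S_def in_tube_iff using that e0 by (intro bexI[of _ x]) auto
  have bS: "of_real b \<in> S" using ab by (intro rS) auto
  have Eb: "E t fb (of_real b) = 0"
    using E_props(2)[OF oS domS, of ts fb] bS admD(4)[OF adm] by (simp add: ts)
  obtain k where k: "k holomorphic_on S" "\<And>x. E t fb x = (x - of_real b) * k x"
    using holomorphic_factor_zero[OF oS E_props(1)[OF oS domS] Eb] by blast
  have kb: "k (of_real b) \<noteq> 0"
    by (rule factor_nonzero[OF adm ts oS bS domS k])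
  have contk: "continuous_on S k" using k(1) by (rule holomorphic_on_imp_continuous_on)
  have Ereal: "E t fb (of_real x) \<in> \<real>" if "of_real x \<in> S" for x
    by (rule E_real[OF S_def ab(1,2) e0(1) domS admD(1)[OF adm] that])
  have kreal0: "k (of_real x) \<in> \<real>" if x: "of_real x \<in> S" "x \<noteq> b" for x
  proof -
    have "k (of_real x) = E t fb (of_real x) / of_real (x - b)" using k(2)[of "of_real x"] x(2) by simp
    then show ?thesis using Ereal[OF x(1)] by (simp add: Reals_divide)
  qed
  have kreal: "k (of_real x) \<in> \<real>" if x: "of_real x \<in> S" for x
    using kreal0[OF x] real_at_limit[OF oS bS contk kreal0] by (cases "x = b") auto
  have knz: "k (of_real x) \<noteq> 0" if x: "x \<in> {\<alpha>..\<beta>}" for x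
  proof (cases "x = b")
    case False
    show ?thesis
    proof
      assume "k (of_real x) = 0"
      then have "deriv ?F (csqrt (of_real x)) = 0" using k(2)[of "of_real x"] by (simp add: E_def)
      from admD(6)[OF adm cross[OF x] this] have "complex_of_real x = of_real b" unfolding ts power2_csqrt .
      then show False using False by simp
    qed
  qed (use kb in simp)
  define \<phi> where "\<phi> = (\<lambda>x. Re (k (complex_of_real x)))"
  have \<phi>nz: "\<phi> x \<noteq> 0" if x: "x \<in> {\<alpha>..\<beta>}" for x
    using knz[OF x] kreal[OF rS[OF x]] by (auto simp: \<phi>_def elim!: Reals_cases)
  have cont\<phi>: "continuous_on {\<alpha>..\<beta>} \<phi>"
    unfolding \<phi>_def
    by (intro continuous_on_Re continuous_on_compose2[OF contk]) (auto intro!: continuous_intros rS)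
  define \<sigma> where "\<sigma> = sgn (\<phi> 0)"
  have 0: "0 \<in> {\<alpha>..\<beta>}" using ab \<open>0 \<le> \<beta>\<close> by simp
  have \<sigma>: "\<sigma> = 1 \<or> \<sigma> = - 1" using \<phi>nz[OF 0] by (auto simp: \<sigma>_def sgn_real_def)
  have pos: "0 < \<sigma> * \<phi> x" if x: "x \<in> {\<alpha>..\<beta>}" for x
  proof (rule ccontr)
    assume "\<not> 0 < \<sigma> * \<phi> x"
    have "connected ((\<lambda>x. \<sigma> * \<phi> x) ` {\<alpha>..\<beta>})"
      by (intro connected_continuous_image continuous_intros cont\<phi>) auto
    moreover have "\<sigma> * \<phi> 0 > 0" using \<phi>nz[OF 0] by (simp add: \<sigma>_def sgn_real_def)
    moreover have "0 \<in> {\<sigma> * \<phi> x..\<sigma> * \<phi> 0}" using calculation(2) \<open>\<not> 0 < \<sigma> * \<phi> x\<close> by simp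
    ultimately have "0 \<in> (\<lambda>x. \<sigma> * \<phi> x) ` {\<alpha>..\<beta>}"
      using connected_contains_Icc[OF _ imageI[OF x] imageI[OF 0]] by blast
    then show False using \<phi>nz \<sigma> by auto
  qed
  have ne: "{\<alpha>..\<beta>} \<noteq> {}" using 0 by blast
  have "continuous_on {\<alpha>..\<beta>} (\<lambda>x. \<sigma> * \<phi> x)" by (intro continuous_on_mult_left cont\<phi>)
  then obtain x0 where x0: "x0 \<in> {\<alpha>..\<beta>}" "\<And>x. x \<in> {\<alpha>..\<beta>} \<Longrightarrow> \<sigma> * \<phi> x0 \<le> \<sigma> * \<phi> x"
    using continuous_attains_inf[OF compact_Icc ne] by blast
  \<comment> \<open>The minimum is \<open>4 c\<close>, so \<open>2 c\<close> is a strict bound that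
    persists nearby. The bounds \<open>2 c\<close> and \<open>c / 80\<close> are in turn twice as
    good as the \<open>c\<close> and \<open>c / 40\<close> wanted after perturbation.\<close>
  define c where "c = \<sigma> * \<phi> x0 / 4"
  have c: "0 < c" using pos[OF x0(1)] by (simp add: c_def)
  have "J \<subseteq> S" using rS by (auto simp: J_def)
  then have "compact (k ` J)" by (intro compact_continuous_image continuous_on_subset[OF contk] J(1))
  then obtain B where B: "\<And>x. x \<in> J \<Longrightarrow> cmod (k x) \<le> B"
    by (meson bounded_iff compact_imp_bounded image_eqI)
  \<comment> \<open>An open condition on the values of \<open>k\<close>; it holds on the compact
    interval, hence on a tube around it.\<close>
  define U where "U = {z. 2 * c < \<sigma> * Re z \<and> \<bar>Im z\<bar> < c / 80 \<and> cmod z < B + 1}"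
  have "open U" unfolding U_def by (intro open_Collect_conj open_Collect_less continuous_intros)
  then have "open (S \<inter> k -` U)" using continuous_open_preimage[OF contk oS] by blast
  moreover have "J \<subseteq> S \<inter> k -` U"
  proof
    fix z assume z: "z \<in> J"
    then obtain x where x: "x \<in> {\<alpha>..\<beta>}" "z = of_real x" by (auto simp: J_def)
    have "2 * c < \<sigma> * Re (k z)" using x0(2)[OF x(1)] c by (simp add: x(2) \<phi>_def c_def)
    moreover have "Im (k z) = 0" using kreal[OF rS[OF x(1)]] by (simp add: x(2) complex_is_Real_iff)
    ultimately show "z \<in> S \<inter> k -` U" using c B[OF z] rS[OF x(1)] by (simp add: U_def x(2))
  qed
  ultimately obtain e1 where e1: "0 < e1" "(\<Union>x\<in>J. ball x e1) \<subseteq> S \<inter> k -` U"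
    using compact_subset_open_imp_ball_epsilon_subset[OF J(1)] by metis
  define \<delta> where "\<delta> = min e0 e1"
  have \<delta>: "0 < \<delta>" "\<delta> \<le> e0" "\<delta> \<le> e1" using e0 e1 by (auto simp: \<delta>_def)
  have tube: "tube \<alpha> \<beta> \<delta> \<subseteq> S \<inter> k -` U"
  proof
    fix z assume "z \<in> tube \<alpha> \<beta> \<delta>"
    then obtain x where x: "x \<in> {\<alpha>..\<beta>}" "z \<in> ball (of_real x) \<delta>" unfolding tube_def by blast
    have "z \<in> (\<Union>x\<in>J. ball x e1)"
      by (rule UN_I[of "of_real x"]) (use x \<delta>(3) in \<open>auto simp: J_def\<close>)
    then show "z \<in> S \<inter> k -` U" using e1(2) by blast
  qed
  show thesis
  proof (rule that[of \<delta> \<sigma> c k "B + 1"])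
    show "\<tau> \<in> dom t" if \<tau>: "\<tau>\<^sup>2 \<in> (\<Union>x\<in>complex_of_real ` {\<alpha>..\<beta>}. cball x \<delta>)" for \<tau>
    proof (rule e0(2))
      show "\<tau>\<^sup>2 \<in> (\<Union>x\<in>J. cball x e0)"
      proof -
        obtain x where x: "x \<in> J" "\<tau>\<^sup>2 \<in> cball x \<delta>" using \<tau> unfolding J_def by blast
        then have "\<tau>\<^sup>2 \<in> cball x e0" using \<delta>(2) by simp
        then show ?thesis using x(1) by blast
      qed
    qed
    show "k holomorphic_on tube \<alpha> \<beta> \<delta>" using k(1) tube by (blast intro: holomorphic_on_subset)
    show "2 * c < \<sigma> * Re (k x) \<and> \<bar>Im (k x)\<bar> < c / 80 \<and> cmod (k x) < B + 1" if "x \<in> tube \<alpha> \<beta> \<delta>" for x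
      using that tube by (auto simp: U_def)
  qed (use \<delta>(1) \<sigma> c k(2) in auto)
qed

section \<open>Nearby times and frequencies\<close>

lemma perturbation:
  assumes M: "compact M" "M \<subseteq> dom t0" and \<eta>: "0 < \<eta>"
  obtains r MA where "0 < r"
    "\<And>t fb \<tau>. \<bar>t - t0\<bar> < r \<Longrightarrow> \<bar>fb - fb0\<bar> < r \<Longrightarrow> \<tau> \<in> M \<Longrightarrow>
       \<tau> \<in> dom t \<and> cmod (deriv (pw_phase \<psi>C t fb) \<tau> - deriv (pw_phase \<psi>C t0 fb0) \<tau>) < \<eta> \<and>
       cmod (pw_amp wC aC t \<tau>) \<le> MA"
proof -
  define K where "K = (\<lambda>\<tau>. of_real t0 + \<tau> / 2) ` M \<union> (\<lambda>\<tau>. of_real t0 - \<tau> / 2) ` M"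
  have K: "compact K" "K \<subseteq> D"
    using M unfolding K_def dom_def
    by (auto intro!: compact_Un compact_continuous_image continuous_intros)
  define Kw where "Kw = (\<lambda>\<tau>. \<tau> / 2) ` M \<union> (\<lambda>\<tau>. - (\<tau> / 2)) ` M"
  have Kw: "compact Kw" "Kw \<subseteq> Dw"
    using M unfolding Kw_def dom_def
    by (auto intro!: compact_Un compact_continuous_image continuous_intros)
  have "continuous_on D (deriv \<psi>C)" "continuous_on D aC" "continuous_on Dw wC"
    using hol open_D by (auto intro!: holomorphic_on_imp_continuous_on holomorphic_deriv)
  note cont = this
  obtain r1 where r1: "0 < r1" "\<And>z h. z \<in> K \<Longrightarrow> cmod h < r1 \<Longrightarrow> z + h \<in> D \<and> cmod (deriv \<psi>C (z + h) - deriv \<psi>C z) < \<eta> / 2"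
    using uniform_translation[OF open_D cont(1) K, of "\<eta> / 2"] \<eta> by auto
  obtain r2 where r2: "0 < r2" "\<And>z h. z \<in> K \<Longrightarrow> cmod h < r2 \<Longrightarrow> z + h \<in> D \<and> cmod (aC (z + h) - aC z) < 1"
    using uniform_translation[OF open_D cont(2) K, of 1] by auto
  have "compact (aC ` K)" by (intro compact_continuous_image continuous_on_subset[OF cont(2)] K)
  from compact_imp_bounded[OF this] obtain Ba where "\<forall>y\<in>aC ` K. cmod y \<le> Ba" unfolding bounded_iff by blast
  then have Ba: "\<And>z. z \<in> K \<Longrightarrow> cmod (aC z) \<le> Ba" by blast
  have "compact (wC ` Kw)" by (intro compact_continuous_image continuous_on_subset[OF cont(3)] Kw)
  from compact_imp_bounded[OF this] obtain Bw where "\<forall>y\<in>wC ` Kw. cmod y \<le> Bw" unfolding bounded_iff by blast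
  then have Bw: "\<And>z. z \<in> Kw \<Longrightarrow> cmod (wC z) \<le> Bw" by blast
  \<comment> \<open>The last entry keeps the frequency term \<open>2 pi |fb - fb0|\<close> below
    \<open>\<eta> / 2\<close>; the two translated derivatives share the other half.\<close>
  define r where "r = min (min r1 r2) (\<eta> / (4 * pi))"
  have r: "0 < r" "r \<le> r1" "r \<le> r2" "r \<le> \<eta> / (4 * pi)" using r1 r2 \<eta> by (auto simp: r_def)
  show thesis
  proof (rule that[of r "\<bar>Bw\<bar> * \<bar>Bw\<bar> * (\<bar>Ba\<bar> + 1) * (\<bar>Ba\<bar> + 1)"])
    fix t fb \<tau> assume t: "\<bar>t - t0\<bar> < r" and fb: "\<bar>fb - fb0\<bar> < r" and \<tau>: "\<tau> \<in> M"
    define h where "h = complex_of_real (t - t0)"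
    have h: "cmod h < r1" "cmod h < r2" using t r by (auto simp: h_def simp del: of_real_diff)
    define p m where "p = of_real t0 + \<tau> / 2" and "m = of_real t0 - \<tau> / 2"
    have pm: "p \<in> K" "m \<in> K" "of_real t + \<tau> / 2 = p + h" "of_real t - \<tau> / 2 = m + h"
      using \<tau> by (auto simp: K_def p_def m_def h_def)
    have wm: "\<tau> / 2 \<in> Kw" "- (\<tau> / 2) \<in> Kw" using \<tau> by (auto simp: Kw_def)
    have d: "\<tau> \<in> dom t" using r1(2)[OF pm(1) h(1)] r1(2)[OF pm(2) h(1)] wm Kw(2) by (auto simp: dom_def pm(3,4))
    have d0: "\<tau> \<in> dom t0" using M \<tau> by blast
    have "deriv (pw_phase \<psi>C t fb) \<tau> - deriv (pw_phase \<psi>C t0 fb0) \<tau> =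
       ((deriv \<psi>C (p + h) - deriv \<psi>C p) / 2 + (deriv \<psi>C (m + h) - deriv \<psi>C m) / 2) - of_real (2 * pi * (fb - fb0))"
      unfolding deriv_phase[OF d] deriv_phase[OF d0] pm(3,4) p_def[symmetric] m_def[symmetric]
      by (simp add: field_simps)
    also have "cmod \<dots> \<le> cmod (deriv \<psi>C (p + h) - deriv \<psi>C p) / 2 + cmod (deriv \<psi>C (m + h) - deriv \<psi>C m) / 2 + 2 * pi * \<bar>fb - fb0\<bar>"
      by (intro order_trans[OF norm_triangle_ineq4] add_mono order_trans[OF norm_triangle_ineq])
        (simp_all add: norm_divide norm_mult abs_mult del: of_real_mult of_real_diff)
    also have "\<dots> < \<eta> / 4 + \<eta> / 4 + \<eta> / 2"
    proof (intro add_strict_mono)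
      have "\<bar>fb - fb0\<bar> < \<eta> / (4 * pi)" using fb r(4) by linarith
      then show "2 * pi * \<bar>fb - fb0\<bar> < \<eta> / 2" by (simp add: field_simps)
    qed (use r1(2)[OF pm(1) h(1)] r1(2)[OF pm(2) h(1)] in auto)
    finally have 1: "cmod (deriv (pw_phase \<psi>C t fb) \<tau> - deriv (pw_phase \<psi>C t0 fb0) \<tau>) < \<eta>" by simp
    \<comment> \<open>The signal amplitude moves with \<open>t\<close> and picks up the
      \<open>1\<close> provided by \<open>r2\<close>; the window is evaluated at points that do not
      depend on \<open>t\<close>.\<close>
    have ale: "cmod (aC (z + h)) \<le> \<bar>Ba\<bar> + 1" if "z \<in> K" for z
      using norm_triangle_sub[of "aC (z + h)" "aC z"] r2(2)[OF that h(2)] Ba[OF that] by linarith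
    have wle: "cmod (wC z) \<le> \<bar>Bw\<bar>" if "z \<in> Kw" for z using Bw[OF that] by linarith
    have "cmod (pw_amp wC aC t \<tau>) = cmod (wC (\<tau> / 2)) * cmod (wC (- (\<tau> / 2))) * cmod (aC (p + h)) * cmod (aC (m + h))"
      unfolding pw_amp_def pm(3,4) by (simp only: norm_mult)
    also have "\<dots> \<le> \<bar>Bw\<bar> * \<bar>Bw\<bar> * (\<bar>Ba\<bar> + 1) * (\<bar>Ba\<bar> + 1)"
      by (intro mult_mono wle ale pm wm mult_nonneg_nonneg) auto
    finally show "\<tau> \<in> dom t \<and> cmod (deriv (pw_phase \<psi>C t fb) \<tau> - deriv (pw_phase \<psi>C t0 fb0) \<tau>) < \<eta> \<and>
       cmod (pw_amp wC aC t \<tau>) \<le> \<bar>Bw\<bar> * \<bar>Bw\<bar> * (\<bar>Ba\<bar> + 1) * (\<bar>Ba\<bar> + 1)"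
      using d 1 by blast
  qed (rule r(1))
qed

text \<open>One domain \<open>S\<close> serves all nearby points. The new cofactor is not built
  afresh: \<open>E - (x - b) k\<close> is small and vanishes at the new \<open>b\<close>, so its
  quotient by \<open>x - b\<close> is a small correction to the old \<open>k\<close>. Closeness of
  \<open>b\<close> is assumed here; its continuity is a separate matter.\<close>

lemma local_expansion:
  assumes adm0: "adm t0 fb0 ts0"
  obtains r C where "0 < r"
    "\<And>t fb ts. \<bar>t - t0\<bar> < r \<Longrightarrow> \<bar>fb - fb0\<bar> < r \<Longrightarrow> \<bar>Re (ts\<^sup>2) - Re (ts0\<^sup>2)\<bar> < r \<Longrightarrow> adm t fb ts \<Longrightarrow>
       \<exists>u g. pw_expansion w a \<psi> wC aC \<psi>C T t fb ts u g C"
proof -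
  define b0 where "b0 = Re (ts0\<^sup>2)"
  define \<alpha> where "\<alpha> = min 0 b0"
  define \<beta> where "\<beta> = max (T\<^sup>2) b0"
  obtain \<delta> \<sigma> c k B where \<delta>: "0 < \<delta>" and \<sigma>: "\<sigma> = 1 \<or> \<sigma> = - (1::real)" and c: "0 < c"
    and dom0: "\<And>\<tau>. \<tau>\<^sup>2 \<in> (\<Union>x\<in>complex_of_real ` {\<alpha>..\<beta>}. cball x \<delta>) \<Longrightarrow> \<tau> \<in> dom t0"
    and k: "k holomorphic_on tube \<alpha> \<beta> \<delta>"
    and Ek: "\<And>x. x \<in> tube \<alpha> \<beta> \<delta> \<Longrightarrow> E t0 fb0 x = (x - of_real b0) * k x"
    and kb: "\<And>x. x \<in> tube \<alpha> \<beta> \<delta> \<Longrightarrow> 2 * c < \<sigma> * Re (k x) \<and> \<bar>Im (k x)\<bar> < c / 80 \<and> cmod (k x) < B"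
    by (rule base_point[OF adm0, folded b0_def, folded \<alpha>_def \<beta>_def]) blast
  define S where "S = tube \<alpha> \<beta> \<delta>"
  have ab: "\<alpha> \<le> 0" "T\<^sup>2 \<le> \<beta>" "\<alpha> \<le> b0" "b0 \<le> \<beta>" by (auto simp: \<alpha>_def \<beta>_def)
  have \<beta>0: "0 \<le> \<beta>" using order_trans[OF zero_le_power2 ab(2)] .
  have oS: "open S" and cS: "convex S" unfolding S_def by (rule open_tube convex_tube)+
  \<comment> \<open>Since \<open>\<delta>/2 + \<delta>/3 < \<delta>\<close>, discs of radius
    \<open>\<delta>/3\<close> fit around every real point within \<open>\<delta>/2\<close> of the
    interval, in particular around the moved \<open>b\<close>.\<close>
  have near: "cball (of_real r) (\<delta>/3) \<subseteq> S" if r: "x \<in> {\<alpha>..\<beta>}" "\<bar>r - x\<bar> < \<delta> / 2" for r x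
  proof
    fix z assume z: "z \<in> cball (complex_of_real r) (\<delta>/3)"
    have "z - of_real x = (z - of_real r) + of_real (r - x)" by simp
    then have "cmod (z - of_real x) \<le> cmod (z - of_real r) + \<bar>r - x\<bar>"
      by (metis norm_of_real norm_triangle_ineq)
    also have "cmod (z - of_real r) \<le> \<delta>/3" using z by (simp add: dist_norm norm_minus_commute)
    finally show "z \<in> S" unfolding S_def in_tube_iff using r \<delta> by (intro bexI[OF _ r(1)]) linarith
  qed
  have S0: "0 \<in> S" unfolding S_def in_tube_iff using ab(1) \<beta>0 \<delta> by (intro bexI[of _ 0]) auto
  have B: "0 < B" using kb[of 0] S0 norm_ge_zero[of "k 0"] unfolding S_def by linarith
  define M where "M = {\<tau>. \<tau>\<^sup>2 \<in> (\<Union>x\<in>complex_of_real ` {\<alpha>..\<beta>}. cball x \<delta>)}"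
  have "compact (complex_of_real ` {\<alpha>..\<beta>})"
    by (intro compact_continuous_image continuous_intros) auto
  then have M: "compact M" unfolding M_def by (intro compact_sqrt_preimage compact_UN_cball)
  have M0: "M \<subseteq> dom t0" using dom0 by (auto simp: M_def)
  have SM: "\<tau> \<in> M" if "\<tau>\<^sup>2 \<in> S" for \<tau>
    using that tube_subset_UN_cball[of \<delta> \<delta> \<alpha> \<beta>] unfolding S_def M_def by blast
  \<comment> \<open>Worked out backwards: \<open>G\<close> is at most \<open>2 \<eta>\<close>, half
    from the phase and half from \<open>|b - b0| B\<close>, and division by \<open>x - b\<close>
    with room \<open>\<delta>/3\<close> must leave \<open>c / 80\<close>.\<close>
  define \<eta> where "\<eta> = c * \<delta> / 480"
  have \<eta>: "0 < \<eta>" using c \<delta> by (simp add: \<eta>_def)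
  obtain r1 MA where r1: "0 < r1" and pert: "\<And>t fb \<tau>. \<bar>t - t0\<bar> < r1 \<Longrightarrow> \<bar>fb - fb0\<bar> < r1 \<Longrightarrow> \<tau> \<in> M \<Longrightarrow>
       \<tau> \<in> dom t \<and> cmod (deriv (pw_phase \<psi>C t fb) \<tau> - deriv (pw_phase \<psi>C t0 fb0) \<tau>) < \<eta> \<and>
       cmod (pw_amp wC aC t \<tau>) \<le> MA"
    by (rule perturbation[where ?fb0.0 = fb0, OF M M0 \<eta>]) blast
  define r where "r = min r1 (min (\<delta> / 2) (\<eta> / B))"
  have r: "0 < r" "r \<le> r1" using r1 \<delta> \<eta> B by (auto simp: r_def)
  have r': "r \<le> \<delta> / 2" "r \<le> \<eta> / B"
    unfolding r_def by (meson min.cobounded1 min.cobounded2 order_trans)+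
  define L where "L = \<bar>ln c\<bar> + \<bar>ln (B + c)\<bar> + 1"
  show thesis
  proof (rule that[OF r(1)])
    fix t fb ts
    assume t: "\<bar>t - t0\<bar> < r" and fb: "\<bar>fb - fb0\<bar> < r" and bb: "\<bar>Re (ts\<^sup>2) - Re (ts0\<^sup>2)\<bar> < r" and adm: "adm t fb ts"
    have pert: "\<tau> \<in> dom t \<and> cmod (deriv (pw_phase \<psi>C t fb) \<tau> - deriv (pw_phase \<psi>C t0 fb0) \<tau>) < \<eta> \<and>
       cmod (pw_amp wC aC t \<tau>) \<le> MA" if "\<tau>\<^sup>2 \<in> S" for \<tau>
    proof -
      have "\<bar>t - t0\<bar> < r1" "\<bar>fb - fb0\<bar> < r1" using t fb r(2) by linarith+
      from pert[OF this SM[OF that]] show ?thesis .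
    qed
    then have domS: "\<And>\<tau>. \<tau>\<^sup>2 \<in> S \<Longrightarrow> \<tau> \<in> dom t" by blast
    define b where "b = Re (ts\<^sup>2)"
    have ts: "ts\<^sup>2 = of_real b" using admD(2)[OF adm] by (simp add: b_def)
    have b: "\<bar>b - b0\<bar> < r" using bb by (simp add: b_def b0_def)
    have cb: "cball (of_real b) (\<delta>/3) \<subseteq> S" using b r'(1) ab by (intro near[of b0]) auto
    then have bS: "of_real b \<in> S" using \<delta> by auto
    have Eb: "E t fb (of_real b) = 0"
      using E_props(2)[OF oS domS, of ts fb] bS admD(4)[OF adm] by (simp add: ts)
    have Ehol: "E t fb holomorphic_on S" by (rule E_props(1)[OF oS domS])
    define G where "G = (\<lambda>x. E t fb x - (x - of_real b) * k x)"
    have khol: "k holomorphic_on S" using k by (simp add: S_def)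
    have Ghol: "G holomorphic_on S" unfolding G_def by (intro holomorphic_intros Ehol khol)
    have Gle: "cmod (G x) \<le> c * \<delta> / 240" if x: "x \<in> S" for x
    proof -
      have "G x = (E t fb x - E t0 fb0 x) + of_real (b - b0) * k x"
        using Ek[of x] x by (simp add: G_def S_def algebra_simps)
      then have "cmod (G x) \<le> cmod (E t fb x - E t0 fb0 x) + cmod (of_real (b - b0) * k x)"
        by (simp only: norm_triangle_ineq)
      also have "cmod (E t fb x - E t0 fb0 x) \<le> \<eta>"
        using pert[of "csqrt x"] x by (simp add: E_def)
      also have "cmod (of_real (b - b0) * k x) \<le> (\<eta> / B) * B"
        unfolding norm_mult norm_of_real using b r'(2) kb[of x] x B by (intro mult_mono) (auto simp: S_def)
      finally show ?thesis using B by (simp add: \<eta>_def mult.commute)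
    qed
    have "0 < \<delta> / 3" using \<delta> by simp
    then obtain l where l: "l holomorphic_on S" "\<And>x. x \<in> S \<Longrightarrow> G x = (x - of_real b) * l x"
        "\<And>x. x \<in> S \<Longrightarrow> cmod (l x) \<le> (c * \<delta> / 240) / (\<delta> / 3)"
      using holomorphic_division[OF oS Ghol _ Gle _ cb] Eb unfolding G_def by auto
    have lle: "cmod (l x) \<le> c / 80" if "x \<in> S" for x using l(3)[OF that] \<delta> by (simp add: field_simps)
    define k1 where "k1 = (\<lambda>x. k x + l x)"
    have k1hol: "k1 holomorphic_on S" unfolding k1_def by (intro holomorphic_intros khol l(1))
    have Ek1: "E t fb x = (x - of_real b) * k1 x" if "x \<in> S" for x
      using l(2)[OF that] by (simp add: G_def k1_def algebra_simps)
    have k1: "c \<le> \<sigma> * Re (k1 x)" "\<bar>Im (k1 x)\<bar> \<le> 1/40 * c" "cmod (k1 x) \<le> B + c" if x: "x \<in> S" for x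
    proof -
      have kx: "2 * c < \<sigma> * Re (k x)" "\<bar>Im (k x)\<bar> < c / 80" "cmod (k x) < B" using kb[of x] x by (auto simp: S_def)
      have lx: "\<bar>Re (l x)\<bar> \<le> c / 80" "\<bar>Im (l x)\<bar> \<le> c / 80"
        using lle[OF x] abs_Re_le_cmod[of "l x"] abs_Im_le_cmod[of "l x"] by linarith+
      show "c \<le> \<sigma> * Re (k1 x)" using \<sigma> kx(1) lx(1) c by (auto simp: k1_def)
      show "\<bar>Im (k1 x)\<bar> \<le> 1/40 * c"
        using kx(2) lx(2) abs_triangle_ineq[of "Im (k x)" "Im (l x)"] unfolding k1_def plus_complex.sel by linarith
      show "cmod (k1 x) \<le> B + c"
        using norm_triangle_ineq[of "k x" "l x"] kx(3) lle[OF x] c by (simp add: k1_def)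
    qed
    define z where "z = (\<lambda>x. of_real \<sigma> * k1 x)"
    have z: "c \<le> Re (z x)" "\<bar>Im (z x)\<bar> \<le> 1/40 * c" "cmod (z x) \<le> B + c" if "x \<in> S" for x
      using k1[OF that] \<sigma> by (auto simp: z_def norm_mult)
    define \<kappa> where "\<kappa> = (\<lambda>x. Ln (z x))"
    have znz: "z x \<noteq> 0" if "x \<in> S" for x using z(1)[OF that] c by auto
    have \<kappa>hol: "\<kappa> holomorphic_on S"
      unfolding \<kappa>_def
    proof (rule holomorphic_on_Ln')
      show "z holomorphic_on S" unfolding z_def by (intro holomorphic_intros k1hol)
      show "z x \<notin> \<real>\<^sub>\<le>\<^sub>0" if "x \<in> S" for x using z(1)[OF that] c by (auto simp: complex_nonpos_Reals_iff)
    qed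
    have Im\<kappa>: "\<bar>Im (\<kappa> x)\<bar> \<le> 1/40" if x: "x \<in> S" for x
      unfolding \<kappa>_def by (rule abs_Im_Ln_le[OF c z(1,2)[OF x]])
    have \<kappa>le: "cmod (\<kappa> x) \<le> L" if x: "x \<in> S" for x
    proof -
      have n: "c \<le> cmod (z x)" using z(1)[OF x] complex_Re_le_cmod order_trans by blast
      have "ln c \<le> ln (cmod (z x))" "ln (cmod (z x)) \<le> ln (B + c)"
        using n z(3)[OF x] c by (auto intro!: ln_mono)
      then have "\<bar>Re (\<kappa> x)\<bar> \<le> \<bar>ln c\<bar> + \<bar>ln (B + c)\<bar>" using znz[OF x] by (auto simp: \<kappa>_def)
      then show ?thesis using cmod_le[of "\<kappa> x"] Im\<kappa>[OF x] by (simp add: L_def)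
    qed
    have k1real0: "k1 (of_real x) \<in> \<real>" if x: "of_real x \<in> S" "x \<noteq> b" for x
    proof -
      have "k1 (of_real x) = E t fb (of_real x) / of_real (x - b)" using Ek1[OF x(1)] x(2) by simp
      moreover have "E t fb (of_real x) \<in> \<real>"
        by (rule E_real[OF S_def ab(1,2) \<delta> domS admD(1)[OF adm] x(1)])
      ultimately show ?thesis by (simp add: Reals_divide)
    qed
    have k1real: "k1 (of_real x) \<in> \<real>" if x: "of_real x \<in> S" for x
      using k1real0[OF x] real_at_limit[OF oS bS holomorphic_on_imp_continuous_on[OF k1hol] k1real0] by (cases "x = b") auto
    have \<kappa>real: "\<kappa> x \<in> \<real>" if x: "x \<in> S" "x \<in> \<real>" for x
    proof -
      have "z x \<in> \<real>" using x k1real unfolding z_def by (auto elim!: Reals_cases)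
      moreover have "0 < Re (z x)" using z(1)[OF x(1)] c by linarith
      ultimately obtain y where "z x = of_real y" "0 < y" by (auto elim!: Reals_cases)
      then show ?thesis by (simp add: \<kappa>_def Ln_of_real)
    qed
    have \<sigma>2: "complex_of_real \<sigma> * of_real \<sigma> = 1" using \<sigma> by auto
    have F_deriv: "deriv (pw_phase \<psi>C t fb) \<tau> = of_real \<sigma> * (\<tau>\<^sup>2 - of_real b) * exp (\<kappa> (\<tau>\<^sup>2))" if \<tau>: "\<tau>\<^sup>2 \<in> S" for \<tau>
    proof -
      have "exp (\<kappa> (\<tau>\<^sup>2)) = of_real \<sigma> * k1 (\<tau>\<^sup>2)" using znz[OF \<tau>] by (simp add: \<kappa>_def z_def)
      then have e: "of_real \<sigma> * (\<tau>\<^sup>2 - of_real b) * exp (\<kappa> (\<tau>\<^sup>2)) = (of_real \<sigma> * of_real \<sigma>) * ((\<tau>\<^sup>2 - of_real b) * k1 (\<tau>\<^sup>2))"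
        by (simp only: mult_ac)
      show ?thesis unfolding e \<sigma>2 mult_1 using E_props(2)[OF oS domS \<tau>, of fb] Ek1[OF \<tau>] by simp
    qed
    show "\<exists>u g. pw_expansion w a \<psi> wC aC \<psi>C T t fb ts u g (remainder_const T (\<delta>/3) L MA)"
    proof (rule pw_expansion_of_chart[OF T a \<psi> w admD(1)[OF adm] ts cS oS S0 bS _ _ \<kappa>hol Im\<kappa> \<kappa>le \<kappa>real \<sigma> F_deriv _ _ cb])
      show "of_real t + \<tau> / 2 \<in> D \<and> of_real t - \<tau> / 2 \<in> D \<and> \<tau> / 2 \<in> Dw \<and> - (\<tau> / 2) \<in> Dw" if "\<tau>\<^sup>2 \<in> S" for \<tau>
        using domS[OF that] by (simp add: dom_def)
      show "cball (of_real x) (\<delta>/3) \<subseteq> S" if "0 \<le> x" "x \<le> T\<^sup>2" for x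
        using that ab \<delta> by (intro near[of x]) auto
      show "cmod (pw_amp wC aC t \<tau>) \<le> MA" if "\<tau>\<^sup>2 \<in> S" for \<tau> using pert[OF that] by blast
    qed (use \<delta> in \<open>auto simp: L_def\<close>)
  qed
qed

text \<open>Uniqueness of the pair on the cross does the work. The phase derivative keeps its sign
  change near \<open>b0\<close>, so it has a zero \<open>x\<close> there. If the new
  \<open>b\<close> lies in \<open>S\<close>, the sign pattern places it near \<open>b0\<close>; if
  it lies below \<open>S\<close>, then \<open>x\<close> is between \<open>b\<close> and
  \<open>T^2\<close>, belongs to the new cross and must equal \<open>b\<close>. The window condition
  excludes pairs beyond \<open>T\<close>.\<close>

lemma stationary_continuity:
  assumes adm0: "adm t0 fb0 ts0" and inside: "Re (ts0\<^sup>2) < T\<^sup>2" and \<epsilon>: "0 < \<epsilon>"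
  obtains r where "0 < r"
    "\<And>t fb ts. \<bar>t - t0\<bar> < r \<Longrightarrow> \<bar>fb - fb0\<bar> < r \<Longrightarrow> adm t fb ts \<Longrightarrow> Re (ts\<^sup>2) < T\<^sup>2 \<Longrightarrow> \<bar>Re (ts\<^sup>2) - Re (ts0\<^sup>2)\<bar> < \<epsilon>"
proof -
  define b0 where "b0 = Re (ts0\<^sup>2)"
  define \<alpha> where "\<alpha> = min 0 b0"
  define \<beta> where "\<beta> = max (T\<^sup>2) b0"
  obtain \<delta> \<sigma> c k B where \<delta>: "0 < \<delta>" and \<sigma>: "\<sigma> = 1 \<or> \<sigma> = - (1::real)" and c: "0 < c"
    and dom0: "\<And>\<tau>. \<tau>\<^sup>2 \<in> (\<Union>x\<in>complex_of_real ` {\<alpha>..\<beta>}. cball x \<delta>) \<Longrightarrow> \<tau> \<in> dom t0"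
    and k: "k holomorphic_on tube \<alpha> \<beta> \<delta>"
    and Ek: "\<And>x. x \<in> tube \<alpha> \<beta> \<delta> \<Longrightarrow> E t0 fb0 x = (x - of_real b0) * k x"
    and kb: "\<And>x. x \<in> tube \<alpha> \<beta> \<delta> \<Longrightarrow> 2 * c < \<sigma> * Re (k x) \<and> \<bar>Im (k x)\<bar> < c / 80 \<and> cmod (k x) < B"
    by (rule base_point[OF adm0, folded b0_def, folded \<alpha>_def \<beta>_def]) blast
  define S where "S = tube \<alpha> \<beta> \<delta>"
  have ab: "\<alpha> \<le> 0" "T\<^sup>2 \<le> \<beta>" "\<alpha> \<le> b0" "b0 \<le> \<beta>" by (auto simp: \<alpha>_def \<beta>_def)
  have oS: "open S" unfolding S_def by (rule open_tube)
  have rS: "of_real x \<in> S" if y: "y \<in> {\<alpha>..\<beta>}" "\<bar>x - y\<bar> < \<delta>" for x y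
    unfolding S_def in_tube_iff using y by (intro bexI[OF _ y(1)]) (simp flip: of_real_diff)
  define M where "M = {\<tau>. \<tau>\<^sup>2 \<in> (\<Union>x\<in>complex_of_real ` {\<alpha>..\<beta>}. cball x \<delta>)}"
  have "compact (complex_of_real ` {\<alpha>..\<beta>})"
    by (intro compact_continuous_image continuous_intros) auto
  then have M: "compact M" unfolding M_def by (intro compact_sqrt_preimage compact_UN_cball)
  have M0: "M \<subseteq> dom t0" using dom0 by (auto simp: M_def)
  have SM: "\<tau> \<in> M" if "\<tau>\<^sup>2 \<in> S" for \<tau>
    using that tube_subset_UN_cball[of \<delta> \<delta> \<alpha> \<beta>] unfolding S_def M_def by blast
  \<comment> \<open>Below \<open>T^2 - b0\<close>, so that a zero within \<open>\<rho>\<close> of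
    \<open>b0\<close> stays inside the window, and below \<open>\<delta>\<close>, so that it lies in
    \<open>S\<close>.\<close>
  define \<rho> where "\<rho> = min \<epsilon> (min \<delta> (T\<^sup>2 - b0)) / 2"
  have \<rho>: "0 < \<rho>" "\<rho> < \<epsilon>" "\<rho> < \<delta>" "\<rho> < T\<^sup>2 - b0"
    using \<epsilon> \<delta> inside by (auto simp: \<rho>_def b0_def min_def)
  \<comment> \<open>At distance at least \<open>\<rho>\<close> from \<open>b0\<close> the
    unperturbed derivative has modulus at least \<open>2 c \<rho>\<close> on the real points of
    \<open>S\<close>, so an error below \<open>c \<rho>\<close> cannot change its sign.\<close>
  have "0 < c * \<rho>" using c \<rho> by simp
  then obtain r MA where r: "0 < r" and pert: "\<And>t fb \<tau>. \<bar>t - t0\<bar> < r \<Longrightarrow> \<bar>fb - fb0\<bar> < r \<Longrightarrow> \<tau> \<in> M \<Longrightarrow>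
       \<tau> \<in> dom t \<and> cmod (deriv (pw_phase \<psi>C t fb) \<tau> - deriv (pw_phase \<psi>C t0 fb0) \<tau>) < c * \<rho> \<and>
       cmod (pw_amp wC aC t \<tau>) \<le> MA"
    by (rule perturbation[where ?fb0.0 = fb0, OF M M0]) blast
  show thesis
  proof (rule that[OF r])
    fix t fb ts
    assume t: "\<bar>t - t0\<bar> < r" and fb: "\<bar>fb - fb0\<bar> < r" and adm: "adm t fb ts" and bT: "Re (ts\<^sup>2) < T\<^sup>2"
    define b where "b = Re (ts\<^sup>2)"
    have ts: "ts\<^sup>2 = of_real b" using admD(2)[OF adm] by (simp add: b_def)
    have domS: "\<tau> \<in> dom t" if "\<tau>\<^sup>2 \<in> S" for \<tau> using pert[OF t fb SM[OF that]] by blast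
    have Ecl: "cmod (E t fb x - E t0 fb0 x) < c * \<rho>" if "x \<in> S" for x
      using pert[OF t fb SM[of "csqrt x"]] that by (simp add: E_def)
    have Ereal: "E t fb (of_real x) \<in> \<real>" if "of_real x \<in> S" for x
      by (rule E_real[OF S_def ab(1,2) \<delta> domS admD(1)[OF adm] that])
    define \<phi> where "\<phi> = (\<lambda>x. \<sigma> * Re (E t fb (of_real x)))"
    have \<phi>0: "E t fb (of_real x) = 0" if "of_real x \<in> S" "\<phi> x = 0" for x
      using Ereal[OF that(1)] that(2) \<sigma> by (auto simp: \<phi>_def elim!: Reals_cases)
    have diff: "\<bar>\<phi> x - (x - b0) * (\<sigma> * Re (k (of_real x)))\<bar> < c * \<rho>" if x: "of_real x \<in> S" for x
    proof -
      have "\<phi> x - (x - b0) * (\<sigma> * Re (k (of_real x))) = \<sigma> * Re (E t fb (of_real x) - E t0 fb0 (of_real x))"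
      proof -
        have e: "Re (E t0 fb0 (of_real x)) = (x - b0) * Re (k (of_real x))"
          using Ek[of "of_real x"] x by (simp add: S_def)
        show ?thesis unfolding \<phi>_def minus_complex.sel e by (simp add: algebra_simps)
      qed
      moreover have "\<bar>\<sigma>\<bar> = 1" using \<sigma> by auto
      ultimately show ?thesis
        using abs_Re_le_cmod[of "E t fb (of_real x) - E t0 fb0 (of_real x)"] Ecl[OF x] by (simp add: abs_mult)
    qed
    have k2: "2 * c \<le> \<sigma> * Re (k (of_real x))" if "of_real x \<in> S" for x
      using kb[of "of_real x"] that by (simp add: S_def)
    have pos: "0 < \<phi> x" if x: "of_real x \<in> S" "b0 + \<rho> \<le> x" for x
    proof -
      have "\<rho> * (2 * c) \<le> (x - b0) * (\<sigma> * Re (k (of_real x)))"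
        using x(2) \<rho> c by (intro mult_mono[OF _ k2[OF x(1)]]) auto
      then show ?thesis using diff[OF x(1)] \<open>0 < c * \<rho>\<close> by (simp add: abs_less_iff mult_ac)
    qed
    have neg: "\<phi> x < 0" if x: "of_real x \<in> S" "x \<le> b0 - \<rho>" for x
    proof -
      have "\<rho> * (2 * c) \<le> (b0 - x) * (\<sigma> * Re (k (of_real x)))"
        using x(2) \<rho> c by (intro mult_mono[OF _ k2[OF x(1)]]) auto
      moreover have "(b0 - x) * (\<sigma> * Re (k (of_real x))) = - ((x - b0) * (\<sigma> * Re (k (of_real x))))"
        by (simp add: algebra_simps)
      ultimately show ?thesis using diff[OF x(1)] \<open>0 < c * \<rho>\<close> by (simp add: abs_less_iff mult_ac)
    qed
    have in_S: "of_real x \<in> S" if "b0 - \<rho> \<le> x" "x \<le> b0 + \<rho>" for x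
      using that ab \<rho> by (intro rS[of b0]) auto
    have cont: "continuous_on {b0 - \<rho>..b0 + \<rho>} \<phi>"
      unfolding \<phi>_def
      by (intro continuous_on_mult_left continuous_on_Re
          continuous_on_compose2[OF holomorphic_on_imp_continuous_on[OF E_props(1)[OF oS domS]]])
        (auto intro!: continuous_intros in_S)
    have "\<phi> (b0 - \<rho>) \<le> 0" "0 \<le> \<phi> (b0 + \<rho>)"
      using neg[OF in_S, of "b0 - \<rho>"] pos[OF in_S, of "b0 + \<rho>"] \<rho>(1) by (simp_all add: less_imp_le)
    then obtain x where x: "b0 - \<rho> \<le> x" "x \<le> b0 + \<rho>" "\<phi> x = 0"
      using IVT'[of \<phi> "b0 - \<rho>" 0 "b0 + \<rho>"] cont \<rho>(1) by auto
    have Ex: "E t fb (of_real x) = 0" using \<phi>0 in_S x by blast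
    have "\<bar>b - b0\<bar> < \<epsilon>"
    proof (cases "complex_of_real b \<in> S")
      case True
      have "E t fb (of_real b) = 0"
        using E_props(2)[OF oS domS, of ts fb] True admD(4)[OF adm] by (simp add: ts)
      then have "\<phi> b = 0" by (simp add: \<phi>_def)
      then show ?thesis using pos[OF True] neg[OF True] \<rho>(2) by (cases "b \<le> b0 - \<rho>"; cases "b0 + \<rho> \<le> b") auto
    next
      case False
      have "b \<le> \<alpha> - \<delta>"
      proof (rule ccontr)
        \<comment> \<open>\<open>max b \<alpha>\<close> is the point of the interval nearest to
          \<open>b\<close>, as \<open>b < T^2\<close>.\<close>
        assume "\<not> b \<le> \<alpha> - \<delta>"
        then have "of_real b \<in> S"
          using bT ab \<delta> by (intro rS[of "max b \<alpha>"]) (auto simp: b_def max_def)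
        with False show False by blast
      qed
      then have bx: "b < x" using x(1) \<rho>(3) ab(3) by linarith
      have "x \<le> T\<^sup>2" using x(2) \<rho>(4) by linarith
      then have "csqrt (of_real x) \<in> pw_cross T ts"
        using bx by (intro csqrt_in_cross[OF ts T]) auto
      from admD(6)[OF adm this] Ex have "complex_of_real x = of_real b"
        unfolding E_def ts power2_csqrt by blast
      then show ?thesis using bx by simp
    qed
    then show "\<bar>Re (ts\<^sup>2) - Re (ts0\<^sup>2)\<bar> < \<epsilon>" by (simp add: b_def b0_def)
  qed
qed

end

section \<open>From local constants to compact sets\<close>

lemma pw_expansionD:
  assumes "pw_expansion w a \<psi> wC aC \<psi>C T t fb ts u g C"
  shows "canonical_map T (pw_phase \<psi>C t fb) ts u g"
    and "u ` {ts, - ts} = {csqrt (of_real (pw_xi (pw_phase \<psi>C t fb) ts)), - csqrt (of_real (pw_xi (pw_phase \<psi>C t fb) ts))}"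
    and "0 \<le> C"
proof -
  note e = assms[unfolded pw_expansion_def Let_def]
  note e3 = conjunct2[OF conjunct2[OF conjunct2[OF conjunct2[OF e]]]]
  show "canonical_map T (pw_phase \<psi>C t fb) ts u g" by (rule conjunct1[OF e])
  show "u ` {ts, - ts} = {csqrt (of_real (pw_xi (pw_phase \<psi>C t fb) ts)), - csqrt (of_real (pw_xi (pw_phase \<psi>C t fb) ts))}"
    by (rule conjunct1[OF e3])
  note f = conjunct2[OF conjunct2[OF conjunct2[OF e3]]]
  \<comment> \<open>The estimate at \<open>chi = 1\<close> bounds a norm, so the possible constants
    are bounded below and have an infimum.\<close>
  have "0 \<le> C / 1"
    by (rule order_trans[OF norm_ge_zero conjunct2[OF f[THEN spec, THEN mp, OF order_refl]]])
  then show "0 \<le> C" by simp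
qed

text \<open>On a real cross the canonical map is injective, hence monotone, and \<open>\<xi>\<close> is the square of its
  value at the stationary points.\<close>

lemma (in pw_data) stationary_inside:
  assumes adm: "adm t fb ts" and e: "pw_expansion w a \<psi> wC aC \<psi>C T t fb ts u g C"
    and less: "pw_xi (pw_phase \<psi>C t fb) ts < (pw_q T u)\<^sup>2"
  shows "Re (ts\<^sup>2) < T\<^sup>2"
proof (rule ccontr)
  assume "\<not> Re (ts\<^sup>2) < T\<^sup>2"
  define b where "b = Re (ts\<^sup>2)"
  define \<xi> where "\<xi> = pw_xi (pw_phase \<psi>C t fb) ts"
  have ts: "ts\<^sup>2 = of_real b" using admD(2)[OF adm] by (simp add: b_def)
  have bT: "T\<^sup>2 \<le> b" using \<open>\<not> Re (ts\<^sup>2) < T\<^sup>2\<close> by (simp add: b_def)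
  define s where "s = sqrt b"
  have b: "0 < b" using bT T by (smt (verit) zero_less_power2)
  have s2: "s\<^sup>2 = b" using b by (simp add: s_def)
  have s: "0 < s" "T \<le> s" using b bT T by (auto simp: s_def real_le_rsqrt)
  note cm = pw_expansionD(1)[OF e, unfolded canonical_map_def]
  have cross: "complex_of_real x \<in> pw_cross T ts" if x: "x \<in> {-s..s}" for x
  proof -
    have "x\<^sup>2 \<le> b" using x s2 by (auto simp: abs_le_square_iff[symmetric] simp flip: s2)
    then have "of_real x \<in> closed_segment (- ts) ts"
      using b by (intro square_scaled_in_segment[of "x\<^sup>2 / b"]) (auto simp: ts)
    then show ?thesis by (simp add: pw_cross_def)
  qed
  define v where "v = (\<lambda>x. Re (u (of_real x)))"
  have uv: "u (of_real x) = of_real (v x)" if x: "x \<in> {-s..s}" for x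
    using cm cross[OF x] by (simp add: v_def)
  have inj: "inj_on v {-s..s}"
  proof (rule inj_onI)
    fix x y assume xy: "x \<in> {-s..s}" "y \<in> {-s..s}" "v x = v y"
    then have "g (u (of_real x)) = g (u (of_real y))" using uv by simp
    then have "complex_of_real x = of_real y" using cm cross xy by metis
    then show "x = y" by simp
  qed
  have contu: "continuous_on (pw_cross T ts) u"
    using cm by (meson analytic_imp_holomorphic holomorphic_on_imp_continuous_on)
  have im: "complex_of_real ` {-s..s} \<subseteq> pw_cross T ts" using cross by blast
  have cont: "continuous_on {-s..s} v"
    unfolding v_def by (intro continuous_on_Re continuous_on_compose2[OF contu _ im] continuous_on_of_real continuous_on_id)
  have "ts = of_real s \<or> ts = - of_real s"
    using ts s2 by (metis of_real_power power2_eq_iff)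
  then have "{ts, - ts} = {of_real s, - of_real s}" by auto
  then have us: "u ` {of_real s, - of_real s} = {csqrt (of_real \<xi>), - csqrt (of_real \<xi>)}"
    using pw_expansionD(2)[OF e] by (simp only: \<xi>_def)
  have v2: "(v x)\<^sup>2 = \<xi>" if x: "x = s \<or> x = - s" for x
  proof -
    have "u (of_real x) \<in> u ` {of_real s, - of_real s}" using x by auto
    then have "(u (of_real x))\<^sup>2 = of_real \<xi>" unfolding us by auto
    then have "complex_of_real ((v x)\<^sup>2) = of_real \<xi>" using uv[of x] x s by auto
    then show ?thesis by (simp only: of_real_eq_iff)
  qed
  have q: "pw_q T u = v T" by (simp add: pw_q_def v_def)
  have "(v T)\<^sup>2 \<le> \<xi>"
  proof (cases "T = s")
    case True
    then show ?thesis using v2[of s] by simp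
  next
    case False
    \<comment> \<open>Two distinct reals with the same square \<open>\<xi>\<close> are opposite, and
      \<open>v T\<close> lies between them by monotonicity.\<close>
    have "v (- s) \<noteq> v s" using inj s by (auto dest: inj_onD)
    then have vs: "v (- s) = - v s" using v2[of s] v2[of "- s"] by (simp add: power2_eq_iff) (metis power2_eq_iff)
    have "(v (- s) < v T \<and> v T < v s) \<or> (v s < v T \<and> v T < v (- s))"
      using continuous_inj_imp_mono[of "- s" T s v] cont inj s False T by auto
    then have "\<bar>v T\<bar> \<le> \<bar>v s\<bar>" unfolding vs by auto
    then show ?thesis using v2[of s] by (simp add: abs_le_square_iff)
  qed
  then show False using less by (simp add: q \<xi>_def)
qed

theorem theoremD1:
  fixes w a \<psi> :: "real \<Rightarrow> real"
    and wC aC \<psi>C :: "complex \<Rightarrow> complex"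
    and I :: "real set" and D Dw :: "complex set"
    and T :: real
    and \<tau>s :: "real \<Rightarrow> real \<Rightarrow> complex"
  assumes T: "0 < T"
    and I: "is_interval I"
    and a: "real_analytic_on a I" "continuation_on aC a I D"
    and \<psi>: "real_analytic_on \<psi> I" "continuation_on \<psi>C \<psi> I D"
    and w_even: "\<And>s. s \<in> {- T / 2..T / 2} \<Longrightarrow> w (- s) = w s"
    and w: "real_analytic_on w {- T / 2..T / 2}" "continuation_on wC w {- T / 2..T / 2} Dw"
    and w_taper: "w (T / 2) = 0" "w (- T / 2) = 0"
  shows "\<exists>(u :: real \<Rightarrow> real \<Rightarrow> complex \<Rightarrow> complex) (g :: real \<Rightarrow> real \<Rightarrow> complex \<Rightarrow> complex)
            (C :: real \<Rightarrow> real \<Rightarrow> real).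
     (\<forall>t fb. admissible I D Dw T \<psi> \<psi>C t fb (\<tau>s t fb) \<longrightarrow>
        (let F = pw_phase \<psi>C t fb; A = pw_amp wC aC t; ts = \<tau>s t fb; \<xi> = pw_xi F ts;
             q = pw_q T (u t fb); A0 = pw_A0 A (g t fb) \<xi>
         in canonical_map T F ts (u t fb) (g t fb) \<and>
            u t fb (of_real T) = of_real q \<and> u t fb (- of_real T) = - of_real q \<and>
            pw_phase \<psi> t fb T = q ^ 3 / 3 - \<xi> * q \<and>
            u t fb ` {ts, - ts} = {csqrt (of_real \<xi>), - csqrt (of_real \<xi>)} \<and>
            A0 = pw_G A (g t fb) (- csqrt (of_real \<xi>)) \<and>
            (\<xi> \<noteq> 0 \<longrightarrow>
               A0 = of_real (sgn q * \<bar>\<xi>\<bar> powr (1 / 4)) * A ts * of_real (sqrt (cmod (2 / deriv (deriv F) ts)))) \<and>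
            (\<forall>chi\<ge>1.
               pwvd w T (signal a \<psi> chi) t (chi * fb) =
                 (LBINT \<tau>=-T..T. of_real (pw_amp w a t \<tau>) * exp (\<i> * of_real (chi * pw_phase \<psi> t fb \<tau>))) \<and>
               cmod (pwvd w T (signal a \<psi> chi) t (chi * fb) -
                     of_real (2 * pi / chi powr (1 / 3)) * A0 *
                       Phi_inc (- (chi powr (2 / 3)) * \<xi>) (chi powr (1 / 3) * q))
                 \<le> C t fb / chi))) \<and>
     (\<forall>(K :: (real \<times> real) set) c. compact K \<longrightarrow> 0 < c \<longrightarrow>
        (\<forall>(t, fb)\<in>K. admissible I D Dw T \<psi> \<psi>C t fb (\<tau>s t fb) \<and>
           (\<forall>chi\<ge>1. c \<le> \<bar>(deriv ^^ 2) (inst_freq chi \<psi>) t\<bar>) \<and>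
           pw_xi (pw_phase \<psi>C t fb) (\<tau>s t fb) < (pw_q T (u t fb))\<^sup>2) \<longrightarrow>
        (\<exists>Cmax. \<forall>(t, fb)\<in>K. C t fb \<le> Cmax))"
proof -
  interpret pw_data w a \<psi> wC aC \<psi>C I D Dw T
    by unfold_locales (rule T a(2) \<psi>(2) w(2))+
  let ?ex = "\<lambda>t fb u g C. pw_expansion w a \<psi> wC aC \<psi>C T t fb (\<tau>s t fb) u g C"
  \<comment> \<open>The set ranges over all maps and inverses, so a constant obtained around a
    neighbouring base point counts even if it comes with another \<open>u\<close> and
    \<open>g\<close>.\<close>
  define X where "X = (\<lambda>t fb. {C. \<exists>u g. ?ex t fb u g C})"
  have Xne: "X t fb \<noteq> {}" if adm: "adm t fb (\<tau>s t fb)" for t fb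
  proof -
    obtain r C where "0 < r" "\<And>t' fb' ts. \<bar>t' - t\<bar> < r \<Longrightarrow> \<bar>fb' - fb\<bar> < r \<Longrightarrow> \<bar>Re (ts\<^sup>2) - Re ((\<tau>s t fb)\<^sup>2)\<bar> < r \<Longrightarrow> adm t' fb' ts \<Longrightarrow>
       \<exists>u g. pw_expansion w a \<psi> wC aC \<psi>C T t' fb' ts u g C"
      using local_expansion[OF adm] by blast
    from this(2)[of t fb "\<tau>s t fb"] this(1) adm show ?thesis by (auto simp: X_def)
  qed
  have Xbdd: "bdd_below (X t fb)" for t fb
    by (rule bdd_belowI[of _ 0]) (auto simp: X_def dest: pw_expansionD(3))
  text \<open>Constants within \<open>1\<close> of the best possible one inherit every local bound.\<close>
  have "\<exists>h. adm t fb (\<tau>s t fb) \<longrightarrow> ?ex t fb (fst h) (fst (snd h)) (snd (snd h)) \<and> snd (snd h) < Inf (X t fb) + 1" for t fb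
  proof (cases "adm t fb (\<tau>s t fb)")
    case True
    obtain C where "C \<in> X t fb" "C < Inf (X t fb) + 1"
      using cInf_lessD[OF Xne[OF True], of "Inf (X t fb) + 1"] by auto
    then obtain u g where "?ex t fb u g C" by (auto simp: X_def)
    then show ?thesis using \<open>C < Inf (X t fb) + 1\<close> by (intro exI[of _ "(u, g, C)"]) simp
  qed simp
  then obtain h where h: "\<And>t fb. adm t fb (\<tau>s t fb) \<Longrightarrow>
      ?ex t fb (fst (h t fb)) (fst (snd (h t fb))) (snd (snd (h t fb))) \<and> snd (snd (h t fb)) < Inf (X t fb) + 1"
    by metis
  define u g C where "u = (\<lambda>t fb. fst (h t fb))" and "g = (\<lambda>t fb. fst (snd (h t fb)))" and "C = (\<lambda>t fb. snd (snd (h t fb)))"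
  have ex: "?ex t fb (u t fb) (g t fb) (C t fb)" and C_less: "C t fb < Inf (X t fb) + 1" if "adm t fb (\<tau>s t fb)" for t fb
    using h[OF that] by (auto simp: u_def g_def C_def)
  have C_le: "C t fb \<le> C' + 1" if "adm t fb (\<tau>s t fb)" "?ex t fb u' g' C'" for t fb u' g' C'
  proof -
    have "C' \<in> X t fb" using that(2) by (auto simp: X_def)
    then have "Inf (X t fb) \<le> C'" by (rule cInf_lower[OF _ Xbdd])
    then show ?thesis using C_less[OF that(1)] by linarith
  qed
  have bounded: "\<exists>Cmax. \<forall>(t, fb)\<in>K. C t fb \<le> Cmax"
    if K: "compact K" and adm: "\<And>t fb. (t, fb) \<in> K \<Longrightarrow> adm t fb (\<tau>s t fb)"
      and xi: "\<And>t fb. (t, fb) \<in> K \<Longrightarrow> pw_xi (pw_phase \<psi>C t fb) (\<tau>s t fb) < (pw_q T (u t fb))\<^sup>2" for K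
  proof -
    \<comment> \<open>The condition on \<open>\<xi>\<close> and \<open>q\<close> concerns the chosen
      map; it is traded here for one on the stationary points alone, which can be compared between
      points.\<close>
    have inside: "Re ((\<tau>s t fb)\<^sup>2) < T\<^sup>2" if p: "(t, fb) \<in> K" for t fb
      by (rule stationary_inside[OF adm[OF p] ex[OF adm[OF p]] xi[OF p]])
    have "\<exists>r Cp. 0 < r \<and> (\<forall>q\<in>K. dist p q < r \<longrightarrow> C (fst q) (snd q) \<le> Cp)" if p: "p \<in> K" for p
    proof -
      define t0 fb0 where "t0 = fst p" and "fb0 = snd p"
      have p': "(t0, fb0) \<in> K" using p by (simp add: t0_def fb0_def)
      obtain r C0 where r: "0 < r" and loc: "\<And>t fb ts. \<bar>t - t0\<bar> < r \<Longrightarrow> \<bar>fb - fb0\<bar> < r \<Longrightarrow> \<bar>Re (ts\<^sup>2) - Re ((\<tau>s t0 fb0)\<^sup>2)\<bar> < r \<Longrightarrow> adm t fb ts \<Longrightarrow>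
         \<exists>u g. pw_expansion w a \<psi> wC aC \<psi>C T t fb ts u g C0"
        using local_expansion[OF adm[OF p']] by blast
      \<comment> \<open>The radius \<open>r\<close> of the local expansion is the tolerance demanded
        of the stationary points, so closeness of \<open>(t, fb)\<close> within \<open>K\<close>
        then suffices.\<close>
      obtain r' where r': "0 < r'" and cont: "\<And>t fb ts. \<bar>t - t0\<bar> < r' \<Longrightarrow> \<bar>fb - fb0\<bar> < r' \<Longrightarrow> adm t fb ts \<Longrightarrow> Re (ts\<^sup>2) < T\<^sup>2 \<Longrightarrow> \<bar>Re (ts\<^sup>2) - Re ((\<tau>s t0 fb0)\<^sup>2)\<bar> < r"
        using stationary_continuity[OF adm[OF p'] inside[OF p'] r] by blast
      have "C (fst q) (snd q) \<le> C0 + 1" if q: "q \<in> K" "dist p q < min r r'" for q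
      proof -
        define t fb where "t = fst q" and "fb = snd q"
        have q': "(t, fb) \<in> K" using q by (simp add: t_def fb_def)
        have "\<bar>t - t0\<bar> \<le> dist p q" "\<bar>fb - fb0\<bar> \<le> dist p q"
          using dist_fst_le[of p q] dist_snd_le[of p q] by (simp_all add: t_def fb_def t0_def fb0_def dist_real_def abs_minus_commute)
        then have d: "\<bar>t - t0\<bar> < r" "\<bar>fb - fb0\<bar> < r" "\<bar>t - t0\<bar> < r'" "\<bar>fb - fb0\<bar> < r'" using q(2) by linarith+
        obtain u' g' where "?ex t fb u' g' C0"
          using loc[OF d(1,2) cont[OF d(3,4) adm[OF q'] inside[OF q']] adm[OF q']] by blast
        then have "C t fb \<le> C0 + 1" by (rule C_le[OF adm[OF q']])
        then show ?thesis by (simp add: t_def fb_def)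
      qed
      then show ?thesis using r r' by (intro exI[of _ "min r r'"] exI[of _ "C0 + 1"]) auto
    qed
    then obtain r Cp where rC: "\<And>p. p \<in> K \<Longrightarrow> 0 < r p" "\<And>p q. p \<in> K \<Longrightarrow> q \<in> K \<Longrightarrow> dist p q < r p \<Longrightarrow> C (fst q) (snd q) \<le> Cp p"
      by metis
    have "K \<subseteq> (\<Union>p\<in>K. ball p (r p))" using rC(1) by force
    then obtain K' where K': "K' \<subseteq> K" "finite K'" "K \<subseteq> (\<Union>p\<in>K'. ball p (r p))"
      using compactE_image[OF K, of K "\<lambda>p. ball p (r p)"] by auto
    \<comment> \<open>The sum of absolute values over the finite subcover stands in for a maximum
      and makes sense for an empty one too.\<close>
    have "C (fst q) (snd q) \<le> (\<Sum>p\<in>K'. \<bar>Cp p\<bar>)" if q: "q \<in> K" for q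
    proof -
      obtain p where p: "p \<in> K'" "dist p q < r p" using K'(3) q by auto
      then have "C (fst q) (snd q) \<le> \<bar>Cp p\<bar>" using rC(2)[of p q] K'(1) q by fastforce
      also have "\<dots> \<le> (\<Sum>p\<in>K'. \<bar>Cp p\<bar>)" using p(1) K'(2) by (intro member_le_sum) auto
      finally show ?thesis .
    qed
    then show ?thesis by (intro exI[of _ "\<Sum>p\<in>K'. \<bar>Cp p\<bar>"]) auto
  qed
  show ?thesis
  proof (rule exI[of _ u], rule exI[of _ g], rule exI[of _ C], intro conjI allI impI)
    fix t fb assume "adm t fb (\<tau>s t fb)"
    from ex[OF this, unfolded pw_expansion_def]
    show "let F = pw_phase \<psi>C t fb; A = pw_amp wC aC t; ts = \<tau>s t fb; \<xi> = pw_xi F ts;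
             q = pw_q T (u t fb); A0 = pw_A0 A (g t fb) \<xi>
         in canonical_map T F ts (u t fb) (g t fb) \<and>
            u t fb (of_real T) = of_real q \<and> u t fb (- of_real T) = - of_real q \<and>
            pw_phase \<psi> t fb T = q ^ 3 / 3 - \<xi> * q \<and>
            u t fb ` {ts, - ts} = {csqrt (of_real \<xi>), - csqrt (of_real \<xi>)} \<and>
            A0 = pw_G A (g t fb) (- csqrt (of_real \<xi>)) \<and>
            (\<xi> \<noteq> 0 \<longrightarrow>
               A0 = of_real (sgn q * \<bar>\<xi>\<bar> powr (1 / 4)) * A ts * of_real (sqrt (cmod (2 / deriv (deriv F) ts)))) \<and>
            (\<forall>chi\<ge>1.
               pwvd w T (signal a \<psi> chi) t (chi * fb) =
                 (LBINT \<tau>=-T..T. of_real (pw_amp w a t \<tau>) * exp (\<i> * of_real (chi * pw_phase \<psi> t fb \<tau>))) \<and>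
               cmod (pwvd w T (signal a \<psi> chi) t (chi * fb) -
                     of_real (2 * pi / chi powr (1 / 3)) * A0 *
                       Phi_inc (- (chi powr (2 / 3)) * \<xi>) (chi powr (1 / 3) * q))
                 \<le> C t fb / chi)"
      unfolding Let_def .
  next
    fix K :: "(real \<times> real) set" and c :: real
    assume K: "compact K" and "0 < c" and A: "\<forall>(t, fb)\<in>K. adm t fb (\<tau>s t fb) \<and>
           (\<forall>chi\<ge>1. c \<le> \<bar>(deriv ^^ 2) (inst_freq chi \<psi>) t\<bar>) \<and>
           pw_xi (pw_phase \<psi>C t fb) (\<tau>s t fb) < (pw_q T (u t fb))\<^sup>2"
    show "\<exists>Cmax. \<forall>(t, fb)\<in>K. C t fb \<le> Cmax"
      by (rule bounded[OF K]) (use A in auto)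
  qed
qed

end
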